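(* Let $X\sim\mathcal N(\mu,\Sigma)$ on $\mathbb R^n$ with $\mu\in\mathbb R^n$ and $\Sigma\in\mathbb R^{n\times n}$, $\Sigma\succ0$. Let $f:\mathbb R^n\to\mathbb R$ be a measurable function which fulfills the bounded differences property with constants $c=(c_1,\dots,c_n)^\top$, $c_i\ge0$. Then, with $\kappa^\star(\Sigma):=\lambda_{\max}(D^{1/2}\Sigma D^{1/2})$ where $D:=\operatorname{diag}(\Sigma^{-1})$, for all $t>0$, $$\mathbb P\left(|f(X)-\mathbb E[f(X)]|\ge t\right)\le2\exp\left(-\frac{2t^2}{\kappa^\star(\Sigma)\|c\|_2^2}\right).$$
   Context: Bounded differences property with constants $c_1,\dots,c_n\ge0$: for every $i\in\{1,\dots,n\}$, $\sup_{y,x_1,\dots,x_n\in\mathbb R}|f(x_1,\dots,x_n)-f(x_1,\dots,x_{i-1},y,x_{i+1},\dots,x_n)|\le c_i$. For a square matrix $A$, $\operatorname{diag}(A)$ is the diagonal matrix with the same diagonal as $A$; $\lambda_{\max}$ is the largest eigenvalue. If $c=0$ the right-hand side is read as $0$. *)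

theory Defs
  imports "HOL-Probability.Probability"
begin

definition pos_definite :: "real^'n^'n \<Rightarrow> bool" where
  "pos_definite A \<longleftrightarrow> transpose A = A \<and> (\<forall>x. x \<noteq> 0 \<longrightarrow> x \<bullet> (A *v x) > 0)"

definition mvnormal_density :: "real^'n \<Rightarrow> real^'n^'n \<Rightarrow> real^'n \<Rightarrow> real" where
  "mvnormal_density \<mu> \<Sigma> x =
     1 / sqrt ((2 * pi) ^ CARD('n) * det \<Sigma>)
       * exp (- ((x - \<mu>) \<bullet> (matrix_inv \<Sigma> *v (x - \<mu>))) / 2)"

(* The supremum is taken in the extended reals, where it exists without a boundedness assumption;
   in type real, SUP is unspecified on sets that are not bounded above. *)
definition bounded_differences :: "(real^'n \<Rightarrow> real) \<Rightarrow> real^'n \<Rightarrow> bool" where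
  "bounded_differences f c \<longleftrightarrow>
     (\<forall>i. (SUP (y, x) \<in> UNIV. ereal \<bar>f x - f (\<chi> j. if j = i then y else x $ j)\<bar>) \<le> ereal (c $ i))"

lemma bounded_differences_iff:
  "bounded_differences f c \<longleftrightarrow>
     (\<forall>i y x. \<bar>f x - f (\<chi> j. if j = i then y else x $ j)\<bar> \<le> c $ i)"
  unfolding bounded_differences_def by (auto simp: SUP_le_iff)

definition diagonal_part :: "real^'n^'n \<Rightarrow> real^'n^'n" where
  "diagonal_part A = (\<chi> i j. if i = j then A $ i $ j else 0)"

(* The power D^(1/2), meaningful only for a diagonal matrix D with nonnegative entries. *)
definition diagonal_sqrt :: "real^'n^'n \<Rightarrow> real^'n^'n" where
  "diagonal_sqrt D = (\<chi> i j. if i = j then sqrt (D $ i $ j) else 0)"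

lemma diagonal_sqrt_square:
  assumes "\<And>i. 0 \<le> D $ i $ i" and "\<And>i j. i \<noteq> j \<Longrightarrow> D $ i $ j = 0"
  shows "diagonal_sqrt D ** diagonal_sqrt D = D"
proof -
  have "(diagonal_sqrt D ** diagonal_sqrt D) $ i $ j = D $ i $ j" for i j
  proof -
    have "(diagonal_sqrt D ** diagonal_sqrt D) $ i $ j =
        (\<Sum>k\<in>UNIV. if k = i then if i = j then sqrt (D $ i $ i) * sqrt (D $ i $ i) else 0 else 0)"
      unfolding matrix_matrix_mult_def diagonal_sqrt_def vec_lambda_beta
      by (intro sum.cong refl) auto
    also have "\<dots> = D $ i $ j"
      using assms by auto
    finally show ?thesis .
  qed
  then show ?thesis
    by (simp add: vec_eq_iff)
qed

(* Only real eigenvalues are considered; for a symmetric matrix these are all of them, and they form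
   a finite nonempty set, so that lambda_max is then well defined. *)
definition eigenvalues :: "real^'n^'n \<Rightarrow> real set" where
  "eigenvalues A = {l. \<exists>v. v \<noteq> 0 \<and> A *v v = l *\<^sub>R v}"

definition lambda_max :: "real^'n^'n \<Rightarrow> real" where
  "lambda_max A = Max (eigenvalues A)"

definition kappa_star :: "real^'n^'n \<Rightarrow> real" where
  "kappa_star \<Sigma> =
     (let D = diagonal_part (matrix_inv \<Sigma>)
      in lambda_max (diagonal_sqrt D ** \<Sigma> ** diagonal_sqrt D))"

end

theory Submission
  imports Defs
begin

text \<open>
The theorem follows from an approximate tensorization of entropy. Write
\<open>Ent g = E[g ln g] - E[g] ln E[g]\<close>, and let \<open>Ent_i g\<close> be the same expression for the conditional law
of the \<open>i\<close>-th coordinate given all the others. For a product measure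
\<open>Ent g \<le> (\<Sum>i. E[Ent_i g])\<close>. Hoeffding's lemma bounds \<open>Ent_i (exp (l f))\<close> by \<open>l^2 c_i^2 / 8\<close> times
the conditional mean of \<open>exp (l f)\<close>, and Herbst's argument turns the resulting bound on
\<open>Ent (exp (l f))\<close> into the bound \<open>exp (l E f + l^2 |c|^2 / 8)\<close> on the moment generating function,
from which Markov's inequality gives McDiarmid's inequality. For the law \<open>N(\<mu>, \<Sigma>)\<close> everything goes
through in the same way, and \<open>|c|^2\<close> is replaced by \<open>\<kappa> |c|^2\<close>, as soon as
\<open>Ent g \<le> \<kappa> * (\<Sum>i. E[Ent_i g])\<close> with \<open>\<kappa> = kappa_star \<Sigma>\<close>.

To prove this inequality, let \<open>Y\<close> be an independent copy of the centred Gaussian vector \<open>X\<close> and put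
\<open>P_\<theta> g x = E[g (cos \<theta> x + sin \<theta> Y)]\<close> for \<open>\<theta>\<close> between \<open>0\<close> and \<open>pi/2\<close>. Then
\<open>\<Phi> \<theta> = E[P_\<theta> g (X) ln (P_\<theta> g (X))]\<close> decreases from \<open>E[g ln g]\<close> to \<open>E[g] ln E[g]\<close>, and by
\<open>entropy_dissipation\<close> its derivative is \<open>- sin \<theta> cos \<theta>\<close> times the Fisher information
\<open>E[(v \<bullet> \<Sigma> v) / P_\<theta> g]\<close> where \<open>v = P_\<theta> (\<nabla> g)\<close>. Rotating only the \<open>i\<close>-th coordinate, given the
others, produces a function \<open>\<Phi>_i\<close> with total decrease \<open>E[Ent_i g]\<close>; its dissipation involves only
the \<open>i\<close>-th partial derivative, weighted by the conditional variance, which is the reciprocal of the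
\<open>i\<close>-th diagonal entry \<open>q_i\<close> of the inverse of \<open>\<Sigma>\<close>.

Two facts compare these dissipations. The definition of \<open>kappa_star\<close> says exactly that
\<open>v \<bullet> \<Sigma> v \<le> \<kappa> * (\<Sum>i. v_i^2 / q_i)\<close> (\<open>kappa_star_frame\<close>). And by the Cauchy-Schwarz inequality the
Fisher information in direction \<open>i\<close> of the full flow is at most that of the flow along the line
(\<open>mehler_fisher_le_line_mehler_fisher\<close>), because the full flow is an average of line flows. Hence
\<open>\<Phi> - \<kappa> * (\<Sum>i. \<Phi>_i)\<close> is nondecreasing in \<open>\<theta>\<close>, and comparing its values at both ends gives
\<open>approximate_tensorization\<close>.

The flow argument needs a differentiable \<open>g\<close>, while \<open>f\<close> is only measurable. But \<open>P_\<theta> f\<close> is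
differentiable for \<open>\<theta> > 0\<close>, has the same mean as \<open>f\<close> and inherits its bounded differences, and it
converges to \<open>f\<close> in \<open>L^1\<close> as \<open>\<theta>\<close> tends to \<open>0\<close>; so the bound on the moment generating function passes
from \<open>P_\<theta> f\<close> to \<open>f\<close>.

All of this takes place on an arbitrary Euclidean space, with finitely many directions in place of
the coordinate directions; the real line is the instance that describes the conditional laws.
\<close>

section \<open>Differentiation under the integral sign and linear changes of variables\<close>

text \<open>
The difference quotients are dominated by \<open>2 * H\<close> because of the mean value theorem, so dominated
convergence applies along every sequence tending to the base point. The Frechet form serves both for
derivatives in space and, with the real line as parameter space, for derivatives along flows.
\<close>

lemma has_derivative_integral_dominated:
  fixes F :: "'b::real_normed_vector \<Rightarrow> 'x \<Rightarrow> real"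
  assumes e: "e > 0"
    and int: "\<And>p. p \<in> ball p0 e \<Longrightarrow> integrable M (F p)"
    and der: "\<And>p x. p \<in> ball p0 e \<Longrightarrow> x \<in> space M \<Longrightarrow> ((\<lambda>p. F p x) has_derivative F' p x) (at p)"
    and bd: "\<And>p x v. p \<in> ball p0 e \<Longrightarrow> x \<in> space M \<Longrightarrow> \<bar>F' p x v\<bar> \<le> H x * norm v"
    and meas: "\<And>v. (\<lambda>x. F' p0 x v) \<in> borel_measurable M"
    and H: "integrable M H" and H0: "\<And>x. x \<in> space M \<Longrightarrow> 0 \<le> H x"
  shows "((\<lambda>p. \<integral>x. F p x \<partial>M) has_derivative (\<lambda>v. \<integral>x. F' p0 x v \<partial>M)) (at p0)"
proof -
  have p0: "p0 \<in> ball p0 e" using e by simp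
  have lin: "bounded_linear (F' p0 x)" if "x \<in> space M" for x
    using der[OF p0 that] by (rule has_derivative_bounded_linear)
  have intF': "integrable M (\<lambda>x. F' p0 x v)" for v
  proof (rule Bochner_Integration.integrable_bound[OF _ meas])
    show "integrable M (\<lambda>x. H x * norm v)" using H by simp
    show "AE x in M. norm (F' p0 x v) \<le> norm (H x * norm v)"
      using bd[OF p0, of _ v] by (intro AE_I2) fastforce
  qed
  have blin: "bounded_linear (\<lambda>v. \<integral>x. F' p0 x v \<partial>M)"
  proof (rule bounded_linear_intro[where K = "\<integral>x. H x \<partial>M"])
    fix v w
    have "(\<integral>x. F' p0 x (v + w) \<partial>M) = (\<integral>x. F' p0 x v + F' p0 x w \<partial>M)"
      by (intro Bochner_Integration.integral_cong refl) (simp add: lin linear_simps)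
    then show "(\<integral>x. F' p0 x (v + w) \<partial>M) = (\<integral>x. F' p0 x v \<partial>M) + (\<integral>x. F' p0 x w \<partial>M)"
      using intF' by simp
  next
    fix r v
    have "(\<integral>x. F' p0 x (r *\<^sub>R v) \<partial>M) = (\<integral>x. r * F' p0 x v \<partial>M)"
      by (intro Bochner_Integration.integral_cong refl) (simp add: lin linear_simps)
    then show "(\<integral>x. F' p0 x (r *\<^sub>R v) \<partial>M) = r *\<^sub>R (\<integral>x. F' p0 x v \<partial>M)"
      by simp
  next
    fix v
    have "\<bar>\<integral>x. F' p0 x v \<partial>M\<bar> \<le> (\<integral>x. \<bar>F' p0 x v\<bar> \<partial>M)" by (rule integral_abs_bound)
    also have "\<dots> \<le> (\<integral>x. H x * norm v \<partial>M)"
      using bd[OF p0] H intF' by (intro integral_mono) auto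
    finally show "norm (\<integral>x. F' p0 x v \<partial>M) \<le> norm v * (\<integral>x. H x \<partial>M)" 
      by (simp add: mult.commute)
  qed
  define R where "R h x = \<bar>F (p0 + h) x - F p0 x - F' p0 x h\<bar> / norm h" for h x
  have Rbd: "R h x \<le> 2 * H x" if x: "x \<in> space M" and h: "h \<noteq> 0" "norm h < e" for h x
  proof -
    have "norm (F (p0 + h) x - F p0 x) \<le> H x * norm (p0 + h - p0)"
    proof (rule differentiable_bound[where S = "ball p0 e" and f' = "\<lambda>p. F' p x"])
      show "((\<lambda>p. F p x) has_derivative F' p x) (at p within ball p0 e)" if "p \<in> ball p0 e" for p
        using der[OF that x] by (rule has_derivative_at_withinI)
      show "onorm (F' p x) \<le> H x" if "p \<in> ball p0 e" for p
        using bd[OF that x] H0[OF x] by (intro onorm_bound) auto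
      show "p0 + h \<in> ball p0 e" using h by (simp add: dist_norm)
    qed (use e in auto)
    moreover have "\<bar>F' p0 x h\<bar> \<le> H x * norm h" by (rule bd[OF p0 x])
    ultimately have "\<bar>F (p0 + h) x - F p0 x - F' p0 x h\<bar> \<le> 2 * H x * norm h" by auto
    then show ?thesis using h by (simp add: R_def divide_simps)
  qed
  have lim: "(\<lambda>n. \<integral>x. R (X n) x \<partial>M) \<longlonglongrightarrow> 0"
    if X: "\<And>n. X n \<noteq> 0" "X \<longlonglongrightarrow> 0" for X :: "nat \<Rightarrow> 'b"
  proof -
    from X(2) e obtain N where N: "\<And>n. n \<ge> N \<Longrightarrow> norm (X n) < e"
      by (auto simp: LIMSEQ_iff)
    have "(\<lambda>n. \<integral>x. R (X (n + N)) x \<partial>M) \<longlonglongrightarrow> (\<integral>x. 0 \<partial>M)"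
    proof (rule integral_dominated_convergence[where w = "\<lambda>x. 2 * H x"])
      show "R (X (n + N)) \<in> borel_measurable M" for n
      proof -
        have "p0 + X (n+N) \<in> ball p0 e" using N[of "n+N"] by (simp add: dist_norm)
        note [measurable] = borel_measurable_integrable[OF int[OF this]]
          borel_measurable_integrable[OF int[OF p0]] meas
        show ?thesis unfolding R_def[abs_def] by measurable
      qed
      show "AE x in M. (\<lambda>n. R (X (n + N)) x) \<longlonglongrightarrow> 0"
      proof (rule AE_I2)
        fix x assume x: "x \<in> space M"
        have "((\<lambda>h. R h x) \<longlongrightarrow> 0) (at 0)"
          using der[OF p0 x] unfolding has_derivative_at R_def by simp
        then have "(\<lambda>n. R (X n) x) \<longlonglongrightarrow> 0"
          using X unfolding tendsto_at_iff_sequentially by (auto simp: comp_def)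
        then show "(\<lambda>n. R (X (n + N)) x) \<longlonglongrightarrow> 0" by (rule LIMSEQ_ignore_initial_segment)
      qed
      show "AE x in M. norm (R (X (n + N)) x) \<le> 2 * H x" for n
        using Rbd[OF _ X(1) N] by (intro AE_I2) (auto simp: R_def)
    qed (use H in auto)
    then show ?thesis by (simp add: LIMSEQ_offset)
  qed
  have "((\<lambda>h. norm ((\<integral>x. F (p0 + h) x \<partial>M) - (\<integral>x. F p0 x \<partial>M) - (\<integral>x. F' p0 x h \<partial>M)) / norm h) \<longlongrightarrow> 0) (at 0)"
    unfolding tendsto_at_iff_sequentially comp_def
  proof (intro allI impI)
    fix X :: "nat \<Rightarrow> 'b" assume X0: "\<forall>i. X i \<in> UNIV - {0}" "X \<longlonglongrightarrow> 0"
    then have X: "\<And>n. X n \<noteq> 0" by auto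
    from X0(2) e obtain N where N: "\<And>n. n \<ge> N \<Longrightarrow> norm (X n) < e"
      by (auto simp: LIMSEQ_iff)
    show "(\<lambda>n. norm ((\<integral>x. F (p0 + X n) x \<partial>M) - (\<integral>x. F p0 x \<partial>M) - (\<integral>x. F' p0 x (X n) \<partial>M)) / norm (X n)) \<longlonglongrightarrow> 0"
    proof (rule tendsto_sandwich[OF _ _ tendsto_const lim[OF X X0(2)]])
      show "\<forall>\<^sub>F n in sequentially. 0 \<le> norm ((\<integral>x. F (p0 + X n) x \<partial>M) - (\<integral>x. F p0 x \<partial>M) - (\<integral>x. F' p0 x (X n) \<partial>M)) / norm (X n)"
        by simp
      show "\<forall>\<^sub>F n in sequentially. norm ((\<integral>x. F (p0 + X n) x \<partial>M) - (\<integral>x. F p0 x \<partial>M) - (\<integral>x. F' p0 x (X n) \<partial>M)) / norm (X n) \<le> (\<integral>x. R (X n) x \<partial>M)"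
        unfolding eventually_sequentially
      proof (intro exI allI impI)
        fix n assume "N \<le> n"
        then have b: "p0 + X n \<in> ball p0 e" using N[of n] by (simp add: dist_norm)
        have "(\<integral>x. F (p0 + X n) x \<partial>M) - (\<integral>x. F p0 x \<partial>M) - (\<integral>x. F' p0 x (X n) \<partial>M)
          = (\<integral>x. F (p0 + X n) x - F p0 x - F' p0 x (X n) \<partial>M)"
          using int[OF b] int[OF p0] intF' by simp
        then have "norm ((\<integral>x. F (p0 + X n) x \<partial>M) - (\<integral>x. F p0 x \<partial>M) - (\<integral>x. F' p0 x (X n) \<partial>M))
          \<le> (\<integral>x. \<bar>F (p0 + X n) x - F p0 x - F' p0 x (X n)\<bar> \<partial>M)"
          by (simp add: integral_abs_bound)
        then show "norm ((\<integral>x. F (p0 + X n) x \<partial>M) - (\<integral>x. F p0 x \<partial>M) - (\<integral>x. F' p0 x (X n) \<partial>M)) / norm (X n) \<le> (\<integral>x. R (X n) x \<partial>M)"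
          unfolding R_def by (simp add: divide_right_mono)
      qed
    qed
  qed
  then show ?thesis using blin by (simp add: has_derivative_at)
qed

lemma nn_integral_lborel_translate:
  fixes f :: "'a::euclidean_space \<Rightarrow> ennreal"
  assumes [measurable]: "f \<in> borel_measurable borel"
  shows "(\<integral>\<^sup>+x. f (x + a) \<partial>lborel) = (\<integral>\<^sup>+x. f x \<partial>lborel)"
proof -
  have "(\<integral>\<^sup>+x. f x \<partial>lborel) = (\<integral>\<^sup>+x. f x \<partial>distr lborel borel ((+) a))"
    by (simp add: lborel_distr_plus)
  also have "\<dots> = (\<integral>\<^sup>+x. f (x + a) \<partial>lborel)"
    by (subst nn_integral_distr) (auto simp: add.commute)
  finally show ?thesis by simp
qed

lemma nn_integral_lborel_scale:
  fixes f :: "'a::euclidean_space \<Rightarrow> ennreal"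
  assumes [measurable]: "f \<in> borel_measurable borel" and r: "r \<noteq> 0"
  shows "(\<integral>\<^sup>+x. f x \<partial>lborel) = ennreal (\<bar>r\<bar> ^ DIM('a)) * (\<integral>\<^sup>+x. f (r *\<^sub>R x) \<partial>lborel)"
proof -
  have "(\<integral>\<^sup>+x. f x \<partial>lborel) = (\<integral>\<^sup>+x. f x \<partial>density (distr lborel borel (\<lambda>x. 0 + r *\<^sub>R x)) (\<lambda>_. \<bar>r\<bar>^DIM('a)))"
    using lborel_affine[OF r, of "0::'a"] by simp
  also have "\<dots> = ennreal (\<bar>r\<bar> ^ DIM('a)) * (\<integral>\<^sup>+x. f (r *\<^sub>R x) \<partial>lborel)"
    by (subst nn_integral_density) (auto simp: nn_integral_distr nn_integral_cmult)
  finally show ?thesis .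
qed

section \<open>Centred Gaussian measures on a Euclidean space\<close>

text \<open>
The measure is given by its precision operator \<open>L\<close>, since conditional variances along lines and
integration by parts are expressed through \<open>L\<close>; \<open>S\<close> is the covariance operator.
\<close>

locale gaussian =
  fixes L S :: "'a::euclidean_space \<Rightarrow> 'a" and C m :: real
  assumes linL: "linear L"
    and symL: "\<And>x y. L x \<bullet> y = x \<bullet> L y"
    and m: "m > 0" and coercive: "\<And>x. m * (x \<bullet> x) \<le> x \<bullet> L x"
    and linS: "linear S"
    and LS: "\<And>v. L (S v) = v"
    and C: "C > 0"
    and total: "(\<integral>\<^sup>+x. ennreal (C * exp (- (x \<bullet> L x) / 2)) \<partial>lborel) = 1"
begin

definition q :: "'a \<Rightarrow> real" where "q x = C * exp (- (x \<bullet> L x) / 2)"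
definition N :: "'a measure" where "N = density lborel (\<lambda>x. ennreal (q x))"

lemma measL: "L \<in> borel_measurable borel"
  by (intro borel_measurable_continuous_onI linear_continuous_on linear_conv_bounded_linear[THEN iffD1] linL)

lemma measS: "S \<in> borel_measurable borel"
  by (intro borel_measurable_continuous_onI linear_continuous_on linear_conv_bounded_linear[THEN iffD1] linS)

lemma q_pos [simp]: "q x > 0" and q_nonneg [simp]: "q x \<ge> 0"
  using C by (auto simp: q_def intro: less_imp_le)

lemma measq [measurable]: "q \<in> borel_measurable borel"
proof -
  note measL[measurable]
  show ?thesis unfolding q_def[abs_def] by measurable
qed

lemma sets_N [simp, measurable_cong]: "sets N = sets borel" and space_N [simp]: "space N = UNIV"
  by (auto simp: N_def)

lemma prob_space_N: "prob_space N"
proof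
  show "emeasure N (space N) = 1"
    using total[folded q_def] by (simp add: N_def emeasure_density)
qed

sublocale N: prob_space N by (rule prob_space_N)

sublocale NN: pair_prob_space N N ..

lemma nn_integral_N:
  "f \<in> borel_measurable borel \<Longrightarrow> (\<integral>\<^sup>+x. f x \<partial>N) = (\<integral>\<^sup>+x. ennreal (q x) * f x \<partial>lborel)"
  unfolding N_def by (subst nn_integral_density) auto

text \<open>
By coercivity \<open>K * norm x\<close> is absorbed by half of the quadratic form in the exponent, and the other
half gives, up to a constant, the density of a dilated Gaussian measure.
\<close>

lemma integrable_exp_norm: "integrable N (\<lambda>x. exp (K * norm x))"
proof (rule integrableI_bounded)
  have "(\<integral>\<^sup>+x. ennreal (norm (exp (K * norm x))) \<partial>N)
      \<le> (\<integral>\<^sup>+x. ennreal (exp (K\<^sup>2 / m)) * ennreal (q ((1/sqrt 2) *\<^sub>R x)) \<partial>lborel)"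
    unfolding N_def
  proof (subst nn_integral_density, simp, simp, intro nn_integral_mono)
    fix x :: 'a
    have "K * norm x \<le> K\<^sup>2 / m + m * (norm x)\<^sup>2 / 4"
    proof -
      have "0 \<le> (K / sqrt m - sqrt m * norm x / 2)\<^sup>2" by simp
      also have "\<dots> = K\<^sup>2 / m - K * norm x + m * (norm x)\<^sup>2 / 4"
        using m by (simp add: power2_diff power_divide power_mult_distrib)
      finally show ?thesis by simp
    qed
    also have "m * (norm x)\<^sup>2 \<le> x \<bullet> L x"
      using coercive[of x] by (simp add: power2_norm_eq_inner)
    finally have 1: "K * norm x \<le> K\<^sup>2 / m + (x \<bullet> L x) / 4" by simp
    have "q x * exp (K * norm x) = C * exp (K * norm x - (x \<bullet> L x) / 2)"
      by (simp add: q_def flip: exp_add)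
    also have "\<dots> \<le> C * exp (K\<^sup>2 / m - (x \<bullet> L x) / 4)"
      using 1 C by simp
    also have "\<dots> = exp (K\<^sup>2 / m) * q ((1/sqrt 2) *\<^sub>R x)"
      by (simp add: q_def linear_cmul[OF linL] flip: exp_add)
    finally show "ennreal (q x) * ennreal (norm (exp (K * norm x))) \<le> ennreal (exp (K\<^sup>2 / m)) * ennreal (q ((1/sqrt 2) *\<^sub>R x))"
      by (simp flip: ennreal_mult')
  qed
  also have "\<dots> = ennreal (exp (K\<^sup>2 / m)) * (\<integral>\<^sup>+x. ennreal (q ((1/sqrt 2) *\<^sub>R x)) \<partial>lborel)"
    by (rule nn_integral_cmult) measurable
  also have "\<dots> < \<infinity>"
  proof -
    have "1 = (\<integral>\<^sup>+x. ennreal (q x) \<partial>lborel)" using total by (simp add: q_def)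
    also have "\<dots> = ennreal (\<bar>1/sqrt 2\<bar> ^ DIM('a)) * (\<integral>\<^sup>+x. ennreal (q ((1/sqrt 2) *\<^sub>R x)) \<partial>lborel)"
      by (rule nn_integral_lborel_scale) auto
    finally have "(\<integral>\<^sup>+x. ennreal (q ((1/sqrt 2) *\<^sub>R x)) \<partial>lborel) \<noteq> \<infinity>"
      by (auto simp: ennreal_mult_eq_top_iff ennreal_mult_top split: if_splits) 
    then show ?thesis by (simp add: ennreal_mult_less_top less_top)
  qed
  finally show "(\<integral>\<^sup>+x. ennreal (norm (exp (K * norm x))) \<partial>N) < \<infinity>" .
qed simp

end

section \<open>Rotation invariance and integration by parts\<close>

text \<open>
A rotation of a pair \<open>(x, y)\<close> of vectors is a composition of three shears, each of which moves one
variable by a multiple of the other. Shears preserve Lebesgue measure by Fubini's theorem and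
translation invariance, so no Jacobian determinant enters. Writing the first shear requires
dividing by \<open>1 + c\<close>, whence the restriction on \<open>c\<close>.
\<close>

lemma nn_integral_lborel_rotate:
  fixes f :: "'a::euclidean_space \<Rightarrow> 'a \<Rightarrow> ennreal"
  assumes [measurable]: "case_prod f \<in> borel_measurable (borel \<Otimes>\<^sub>M borel)"
    and cs: "c\<^sup>2 + s\<^sup>2 = 1" "- 1 < c"
  shows "(\<integral>\<^sup>+x. \<integral>\<^sup>+y. f (c *\<^sub>R x + s *\<^sub>R y) (c *\<^sub>R y - s *\<^sub>R x) \<partial>lborel \<partial>lborel) =
    (\<integral>\<^sup>+x. \<integral>\<^sup>+y. f x y \<partial>lborel \<partial>lborel)"
proof -
  define a b where "a = s / (1 + c)" and "b = - s"
  have c1: "1 + c \<noteq> 0" using cs(2) by simp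
  have ss: "s * s = (1 - c) * (1 + c)" using cs(1) by (simp add: power2_eq_square algebra_simps)
  have ab: "1 + a * b = c"
    using c1 ss by (simp add: a_def b_def divide_simps)
  have "a + c * a = a * (1 + c)" by (simp add: algebra_simps)
  then have ab2: "a + c * a = s" using c1 by (simp add: a_def)
  have shear2: "(\<integral>\<^sup>+x. \<integral>\<^sup>+y. g x (y + t *\<^sub>R x) \<partial>lborel \<partial>lborel) = (\<integral>\<^sup>+x. \<integral>\<^sup>+y. g x y \<partial>lborel \<partial>lborel)"
    if [measurable]: "case_prod g \<in> borel_measurable (borel \<Otimes>\<^sub>M borel)" for g :: "'a \<Rightarrow> 'a \<Rightarrow> ennreal" and t
    by (intro nn_integral_cong nn_integral_lborel_translate) measurable
  have shear1: "(\<integral>\<^sup>+x. \<integral>\<^sup>+y. g (x + t *\<^sub>R y) y \<partial>lborel \<partial>lborel) = (\<integral>\<^sup>+x. \<integral>\<^sup>+y. g x y \<partial>lborel \<partial>lborel)"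
    if [measurable]: "case_prod g \<in> borel_measurable (borel \<Otimes>\<^sub>M borel)" for g :: "'a \<Rightarrow> 'a \<Rightarrow> ennreal" and t
  proof -
    have "(\<integral>\<^sup>+x. \<integral>\<^sup>+y. g (x + t *\<^sub>R y) y \<partial>lborel \<partial>lborel) = (\<integral>\<^sup>+y. \<integral>\<^sup>+x. g (x + t *\<^sub>R y) y \<partial>lborel \<partial>lborel)"
      by (rule lborel_pair.Fubini'[symmetric]) measurable
    also have "\<dots> = (\<integral>\<^sup>+y. \<integral>\<^sup>+x. g x y \<partial>lborel \<partial>lborel)"
      by (intro nn_integral_cong nn_integral_lborel_translate) measurable
    also have "\<dots> = (\<integral>\<^sup>+x. \<integral>\<^sup>+y. g x y \<partial>lborel \<partial>lborel)"
      by (rule lborel_pair.Fubini') measurable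
    finally show ?thesis .
  qed
  have e1: "c *\<^sub>R x + s *\<^sub>R y = (x + a *\<^sub>R y) + a *\<^sub>R (y + b *\<^sub>R (x + a *\<^sub>R y))" for x y :: 'a
  proof -
    have "(x + a *\<^sub>R y) + a *\<^sub>R (y + b *\<^sub>R (x + a *\<^sub>R y))
        = (1 + a*b) *\<^sub>R x + (a *\<^sub>R y + (1 + a*b) *\<^sub>R a *\<^sub>R y)"
      by (simp add: algebra_simps)
    then show ?thesis by (simp add: ab flip: ab2 scaleR_add_left)
  qed
  have e2: "c *\<^sub>R y - s *\<^sub>R x = y + b *\<^sub>R (x + a *\<^sub>R y)" for x y :: 'a
  proof -
    have "y + b *\<^sub>R (x + a *\<^sub>R y) = (1 + a*b) *\<^sub>R y + b *\<^sub>R x"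
      by (simp add: algebra_simps)
    then show ?thesis by (simp only: ab) (simp add: b_def)
  qed
  have "(\<integral>\<^sup>+x. \<integral>\<^sup>+y. f (c *\<^sub>R x + s *\<^sub>R y) (c *\<^sub>R y - s *\<^sub>R x) \<partial>lborel \<partial>lborel)
    = (\<integral>\<^sup>+x. \<integral>\<^sup>+y. (\<lambda>x y. f (x + a *\<^sub>R (y + b *\<^sub>R x)) (y + b *\<^sub>R x)) (x + a *\<^sub>R y) y \<partial>lborel \<partial>lborel)"
    by (simp only: e1 e2)
  also have "\<dots> = (\<integral>\<^sup>+x. \<integral>\<^sup>+y. f (x + a *\<^sub>R (y + b *\<^sub>R x)) (y + b *\<^sub>R x) \<partial>lborel \<partial>lborel)"
    by (rule shear1) measurable
  also have "\<dots> = (\<integral>\<^sup>+x. \<integral>\<^sup>+y. f (x + a *\<^sub>R y) y \<partial>lborel \<partial>lborel)"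
    by (rule shear2[where g = "\<lambda>x y. f (x + a *\<^sub>R y) y"]) measurable
  also have "\<dots> = (\<integral>\<^sup>+x. \<integral>\<^sup>+y. f x y \<partial>lborel \<partial>lborel)"
    by (rule shear1) measurable
  finally show ?thesis .
qed

context gaussian begin

lemma L_add: "L (x + y) = L x + L y" and L_diff: "L (x - y) = L x - L y"
  and L_scale: "L (r *\<^sub>R x) = r *\<^sub>R L x"
  using linL by (auto simp: linear_add linear_diff linear_cmul)

lemma nn_integral_NN:
  assumes [measurable]: "case_prod f \<in> borel_measurable (borel \<Otimes>\<^sub>M borel)"
  shows "(\<integral>\<^sup>+z. case_prod f z \<partial>(N \<Otimes>\<^sub>M N)) = (\<integral>\<^sup>+x. \<integral>\<^sup>+y. ennreal (q x * q y) * f x y \<partial>lborel \<partial>lborel)"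
proof -
  have "(\<integral>\<^sup>+z. case_prod f z \<partial>(N \<Otimes>\<^sub>M N)) = (\<integral>\<^sup>+x. \<integral>\<^sup>+y. f x y \<partial>N \<partial>N)"
    by (subst N.nn_integral_fst[symmetric]) auto
  also have "\<dots> = (\<integral>\<^sup>+x. ennreal (q x) * (\<integral>\<^sup>+y. ennreal (q y) * f x y \<partial>lborel) \<partial>lborel)"
    by (subst nn_integral_N, measurable) (intro nn_integral_cong arg_cong2[of _ _ _ _ "(*)"] refl nn_integral_N, measurable)
  also have "\<dots> = (\<integral>\<^sup>+x. \<integral>\<^sup>+y. ennreal (q x * q y) * f x y \<partial>lborel \<partial>lborel)"
    by (subst nn_integral_cmult[symmetric], measurable)
       (intro nn_integral_cong, simp add: ennreal_mult' mult.assoc)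
  finally show ?thesis .
qed

text \<open>
The product density depends on \<open>(x, y)\<close> only through \<open>x \<bullet> L x + y \<bullet> L y\<close>, which rotations preserve.
\<close>

lemma distr_rotation:
  assumes cs: "c\<^sup>2 + s\<^sup>2 = 1" "- 1 < c"
  shows "distr (N \<Otimes>\<^sub>M N) (N \<Otimes>\<^sub>M N) (\<lambda>(x, y). (c *\<^sub>R x + s *\<^sub>R y, c *\<^sub>R y - s *\<^sub>R x)) = N \<Otimes>\<^sub>M N" (is "distr _ _ ?R = _")
proof (rule measure_eqI)
  have [measurable]: "?R \<in> measurable (N \<Otimes>\<^sub>M N) (N \<Otimes>\<^sub>M N)" by measurable
  fix A assume "A \<in> sets (distr (N \<Otimes>\<^sub>M N) (N \<Otimes>\<^sub>M N) ?R)"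
  then have A[measurable]: "A \<in> sets (N \<Otimes>\<^sub>M N)" by simp
  then have A'[measurable]: "A \<in> sets (borel \<Otimes>\<^sub>M borel)"
    using sets_pair_measure_cong[OF sets_N sets_N] by simp
  have qq: "q x * q y = q (c *\<^sub>R x + s *\<^sub>R y) * q (c *\<^sub>R y - s *\<^sub>R x)" for x y
  proof -
    have "(c *\<^sub>R x + s *\<^sub>R y) \<bullet> L (c *\<^sub>R x + s *\<^sub>R y) + (c *\<^sub>R y - s *\<^sub>R x) \<bullet> L (c *\<^sub>R y - s *\<^sub>R x)
      = (c\<^sup>2 + s\<^sup>2) * (x \<bullet> L x) + (c\<^sup>2 + s\<^sup>2) * (y \<bullet> L y)"
      by (simp add: L_add L_diff L_scale inner_simps algebra_simps power2_eq_square)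
    then show ?thesis unfolding q_def cs by (simp flip: exp_add add: add_divide_distrib)
  qed
  have "emeasure (distr (N \<Otimes>\<^sub>M N) (N \<Otimes>\<^sub>M N) ?R) A = (\<integral>\<^sup>+z. indicator A z \<partial>distr (N \<Otimes>\<^sub>M N) (N \<Otimes>\<^sub>M N) ?R)"
    by simp
  also have "\<dots> = (\<integral>\<^sup>+z. indicator A (?R z) \<partial>(N \<Otimes>\<^sub>M N))"
    by (rule nn_integral_distr) auto
  also have "\<dots> = (\<integral>\<^sup>+z. (case z of (x, y) \<Rightarrow> indicator A (c *\<^sub>R x + s *\<^sub>R y, c *\<^sub>R y - s *\<^sub>R x)) \<partial>(N \<Otimes>\<^sub>M N))"
    by (intro nn_integral_cong) auto
  also have "\<dots> = (\<integral>\<^sup>+x. \<integral>\<^sup>+y. ennreal (q x * q y) * indicator A (c *\<^sub>R x + s *\<^sub>R y, c *\<^sub>R y - s *\<^sub>R x) \<partial>lborel \<partial>lborel)"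
    by (rule nn_integral_NN) measurable
  also have "\<dots> = (\<integral>\<^sup>+x. \<integral>\<^sup>+y. (\<lambda>x y. ennreal (q x * q y) * indicator A (x, y)) (c *\<^sub>R x + s *\<^sub>R y) (c *\<^sub>R y - s *\<^sub>R x) \<partial>lborel \<partial>lborel)"
    by (subst qq) (rule refl)
  also have "\<dots> = (\<integral>\<^sup>+x. \<integral>\<^sup>+y. ennreal (q x * q y) * indicator A (x, y) \<partial>lborel \<partial>lborel)"
    by (rule nn_integral_lborel_rotate[OF _ cs]) measurable
  also have "\<dots> = (\<integral>\<^sup>+z. (case z of (x, y) \<Rightarrow> indicator A (x, y)) \<partial>(N \<Otimes>\<^sub>M N))"
    by (rule nn_integral_NN[symmetric]) measurable
  also have "\<dots> = emeasure (N \<Otimes>\<^sub>M N) A"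
    by simp
  finally show "emeasure (distr (N \<Otimes>\<^sub>M N) (N \<Otimes>\<^sub>M N) ?R) A = emeasure (N \<Otimes>\<^sub>M N) A" .
qed simp

lemma Cameron_Martin:
  fixes k :: "'a \<Rightarrow> real"
  assumes [measurable]: "k \<in> borel_measurable borel"
  shows "(\<integral>w. k (w + h) \<partial>N) = (\<integral>w. k w * exp (w \<bullet> L h - (h \<bullet> L h) / 2) \<partial>N)"
proof -
  have "distr N borel (\<lambda>w. w + h) = density N (\<lambda>w. ennreal (exp (w \<bullet> L h - (h \<bullet> L h) / 2)))" (is "?A = ?B")
  proof (rule measure_eqI)
    fix A assume "A \<in> sets ?A"
    then have [measurable]: "A \<in> sets borel" by simp
    have "emeasure ?A A = (\<integral>\<^sup>+w. indicator A w \<partial>?A)" by simp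
    also have "\<dots> = (\<integral>\<^sup>+w. indicator A (w + h) \<partial>N)" by (rule nn_integral_distr) auto
    also have "\<dots> = (\<integral>\<^sup>+w. ennreal (q w) * indicator A (w + h) \<partial>lborel)"
      by (rule nn_integral_N) measurable
    also have "\<dots> = (\<integral>\<^sup>+w. ennreal (q (w - h)) * indicator A w \<partial>lborel)"
      using nn_integral_lborel_translate[of "\<lambda>w. ennreal (q (w - h)) * indicator A w" h] by simp
    also have "\<dots> = (\<integral>\<^sup>+w. ennreal (q w) * (ennreal (exp (w \<bullet> L h - (h \<bullet> L h) / 2)) * indicator A w) \<partial>lborel)"
    proof (rule nn_integral_cong)
      fix w
      have "(w - h) \<bullet> L (w - h) = w \<bullet> L w - 2 * (w \<bullet> L h) + h \<bullet> L h"
        using symL[of h w] by (simp add: L_diff inner_simps inner_commute)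
      then have "q (w - h) = q w * exp (w \<bullet> L h - (h \<bullet> L h) / 2)"
        by (simp add: q_def field_simps flip: exp_add)
      then show "ennreal (q (w - h)) * indicator A w = ennreal (q w) * (ennreal (exp (w \<bullet> L h - (h \<bullet> L h) / 2)) * indicator A w)"
        by (simp add: ennreal_mult' mult.assoc)
    qed
    also have "\<dots> = (\<integral>\<^sup>+w. ennreal (exp (w \<bullet> L h - (h \<bullet> L h) / 2)) * indicator A w \<partial>N)"
      by (rule nn_integral_N[symmetric]) measurable
    also have "\<dots> = emeasure ?B A" by (subst emeasure_density) auto
    finally show "emeasure ?A A = emeasure ?B A" .
  qed simp
  then have "(\<integral>w. k w \<partial>?A) = (\<integral>w. k w \<partial>?B)" by simp
  then show ?thesis
    by (simp add: integral_distr integral_density mult.commute)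
qed

lemma integrable_norm: "integrable N norm"
proof (rule Bochner_Integration.integrable_bound[OF integrable_exp_norm[of 1]])
  have "norm x \<le> exp (norm x)" for x :: 'a
    using exp_ge_add_one_self[of "norm x"] by linarith
  then show "AE x in N. norm (norm x) \<le> norm (exp (1 * norm x))"
    by (intro AE_I2) simp
qed simp

lemma L_bound: obtains K where "K \<ge> 0" "\<And>v. norm (L v) \<le> K * norm v"
proof -
  have "bounded_linear L" by (rule linear_conv_bounded_linear[THEN iffD1, OF linL])
  from bounded_linear.nonneg_bounded[OF this]
  obtain K where "0 \<le> K" "\<And>v. norm (L v) \<le> norm v * K" by blast
  then show thesis by (intro that[of K]) (simp_all add: mult.commute[of K])
qed

text \<open>
By the Cameron-Martin formula the translation can be moved from \<open>k\<close> to the density, which is smooth.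
This is why averaging over the Gaussian measure makes every bounded measurable function
differentiable.
\<close>

lemma has_derivative_translate_expectation:
  assumes k[measurable]: "k \<in> borel_measurable borel" and B: "\<And>x. \<bar>k x\<bar> \<le> B"
  shows "((\<lambda>p. \<integral>w. k (w + p) \<partial>N) has_derivative (\<lambda>v. \<integral>w. k (w + p) * (w \<bullet> L v) \<partial>N)) (at p)"
proof -
  from L_bound obtain K where K: "K \<ge> 0" "\<And>v. norm (L v) \<le> K * norm v" by blast
  have B0: "0 \<le> B" using B[of 0] by linarith
  define E where "E h w = exp (w \<bullet> L h - (h \<bullet> L h) / 2)" for h w
  have Lh0: "0 \<le> h \<bullet> L h" for h
    using coercive[of h] m by (meson inner_ge_zero less_eq_real_def mult_nonneg_nonneg order_trans)
  have wL: "\<bar>w \<bullet> L v\<bar> \<le> K * norm w * norm v" for w v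
    using Cauchy_Schwarz_ineq2[of w "L v"] mult_left_mono[OF K(2)[of v], of "norm w"]
    by (simp add: mult_ac)
  have E: "E h w \<le> exp (K * norm w)" if "norm h \<le> 1" for h w
  proof -
    have "K * norm w * norm h \<le> K * norm w * 1" using that K(1) by (intro mult_left_mono) auto
    then have "w \<bullet> L h - (h \<bullet> L h) / 2 \<le> K * norm w" using wL[of w h] Lh0[of h] by linarith
    then show ?thesis by (simp add: E_def)
  qed
  have E0: "0 < E h w" for h w by (simp add: E_def)
  have kE: "\<bar>k (w + p) * E h w\<bar> \<le> B * exp (K * norm w)" if "norm h \<le> 1" for h w
    unfolding abs_mult using E[OF that, of w] E0[of h w] B[of "w + p"] B0 by (intro mult_mono) auto
  have "((\<lambda>h. \<integral>w. k (w + p) * E h w \<partial>N) has_derivative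
      (\<lambda>v. \<integral>w. k (w + p) * E 0 w * (w \<bullet> L v - 0 \<bullet> L v) \<partial>N)) (at 0)"
  proof (rule has_derivative_integral_dominated[where e = 1 and H = "\<lambda>w. B * K * exp ((K + 1) * norm w)"
        and F' = "\<lambda>h w v. k (w + p) * E h w * (w \<bullet> L v - h \<bullet> L v)"])
    fix h :: 'a assume h: "h \<in> ball 0 1"
    then have h1: "norm h \<le> 1" by simp
    show "integrable N (\<lambda>w. k (w + p) * E h w)"
    proof (rule Bochner_Integration.integrable_bound)
      show "integrable N (\<lambda>w. B * exp (K * norm w))" using integrable_exp_norm by simp
      show "AE w in N. norm (k (w + p) * E h w) \<le> norm (B * exp (K * norm w))"
        using kE[OF h1] B0 by (intro AE_I2) (auto simp: abs_mult)
    qed (simp add: E_def)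
    fix w
    have sy: "v \<bullet> L h = h \<bullet> L v" for v using symL[of h v] by (simp add: inner_commute)
    have Lder: "(L has_derivative L) (at h)"
      by (rule bounded_linear_imp_has_derivative, rule linear_conv_bounded_linear[THEN iffD1, OF linL])
    have "((\<lambda>h. w \<bullet> L h - (1/2) * (h \<bullet> L h)) has_derivative (\<lambda>v. w \<bullet> L v - (1/2) * (h \<bullet> L v + v \<bullet> L h))) (at h)"
      by (intro has_derivative_diff has_derivative_inner_right has_derivative_mult_right has_derivative_inner Lder has_derivative_ident)
    then have "((\<lambda>h. w \<bullet> L h - (h \<bullet> L h) / 2) has_derivative (\<lambda>v. w \<bullet> L v - h \<bullet> L v)) (at h)"
      by (simp add: sy)
    from has_derivative_mult_right[OF has_derivative_exp[OF this], of "k (w + p)"]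
    show "((\<lambda>h. k (w + p) * E h w) has_derivative (\<lambda>v. k (w + p) * E h w * (w \<bullet> L v - h \<bullet> L v))) (at h)"
      by (simp add: E_def mult_ac)
    fix v
    have "\<bar>w \<bullet> L v - h \<bullet> L v\<bar> \<le> K * (norm w + 1) * norm v"
    proof -
      have "K * norm h * norm v \<le> K * 1 * norm v" using h1 K(1) by (intro mult_right_mono mult_left_mono) auto
      then show ?thesis using wL[of w v] wL[of h v] by (auto simp: algebra_simps)
    qed
    also have "\<dots> \<le> K * exp (norm w) * norm v"
      using K(1) exp_ge_add_one_self[of "norm w"] by (intro mult_right_mono mult_left_mono) (auto simp: add.commute)
    finally have "\<bar>k (w + p) * E h w\<bar> * \<bar>w \<bullet> L v - h \<bullet> L v\<bar> \<le> (B * exp (K * norm w)) * (K * exp (norm w) * norm v)"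
      using B0 K(1) by (intro mult_mono kE h1) auto
    then show "\<bar>k (w + p) * E h w * (w \<bullet> L v - h \<bullet> L v)\<bar> \<le> B * K * exp ((K + 1) * norm w) * norm v"
      by (simp add: abs_mult mult_ac distrib_left[of _ K 1] exp_add)
  next
    show "integrable N (\<lambda>w. B * K * exp ((K + 1) * norm w))" using integrable_exp_norm by simp
  qed (use B0 K(1) in \<open>auto simp: E_def\<close>)
  then have *: "((\<lambda>h. \<integral>w. k (w + p) * E h w \<partial>N) has_derivative
      (\<lambda>v. \<integral>w. k (w + p) * (w \<bullet> L v) \<partial>N)) (at (p - p))"
    by (simp add: E_def linear_0[OF linL])
  have eq: "(\<integral>w. k (w + x) \<partial>N) = (\<integral>w. k (w + p) * E (x - p) w \<partial>N)" for x
  proof -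
    have "(\<lambda>w. k (w + p)) \<in> borel_measurable borel" by measurable
    from Cameron_Martin[OF this, of "x - p"] show ?thesis by (simp add: E_def algebra_simps)
  qed
  have "((\<lambda>x. x - p) has_derivative (\<lambda>v. v)) (at p)" by (auto intro!: derivative_eq_intros)
  from has_derivative_compose[OF this *] show ?thesis by (simp add: eq)
qed

text \<open>
Integration by parts: for differentiable \<open>k\<close> the translated expectation can be differentiated in two
ways, under the integral sign and through the density.
\<close>

lemma Stein:
  assumes k[measurable]: "k \<in> borel_measurable borel" and B: "\<And>x. \<bar>k x\<bar> \<le> B"
    and der: "\<And>x. (k has_derivative k' x) (at x)" and K: "\<And>x v. \<bar>k' x v\<bar> \<le> K * norm v" "0 \<le> K"
    and [measurable]: "\<And>v. (\<lambda>x. k' x v) \<in> borel_measurable borel"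
  shows "(\<integral>w. k w * (w \<bullet> L v) \<partial>N) = (\<integral>w. k' w v \<partial>N)"
proof -
  have "((\<lambda>p. \<integral>w. k (w + p) \<partial>N) has_derivative (\<lambda>v. \<integral>w. k' (w + 0) v \<partial>N)) (at 0)"
  proof (rule has_derivative_integral_dominated[where e = 1 and H = "\<lambda>_. K"])
    fix p w :: 'a
    have "((\<lambda>p. w + p) has_derivative (\<lambda>v. v)) (at p)" by (auto intro!: derivative_eq_intros)
    from has_derivative_compose[OF this der]
    show "((\<lambda>p. k (w + p)) has_derivative k' (w + p)) (at p)" by simp
    show "integrable N (\<lambda>w. k (w + p))"
      by (rule N.integrable_const_bound[where B = B]) (use B in auto)
  qed (use K in auto)
  from has_derivative_unique[OF this has_derivative_translate_expectation[OF k B, of 0]]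
  show ?thesis by (auto simp: fun_eq_iff)
qed


section \<open>The Mehler flow and the dissipation of entropy\<close>

text \<open>
For \<open>c = cos \<theta>\<close> and \<open>s = sin \<theta>\<close> this is the Ornstein-Uhlenbeck semigroup at time \<open>- ln (cos \<theta>)\<close>.
The angle is the better parameter: the whole evolution takes place on the compact interval from \<open>0\<close>
to \<open>pi/2\<close>, and both ends are attained.
\<close>

definition mehler :: "real \<Rightarrow> real \<Rightarrow> ('a \<Rightarrow> 'b) \<Rightarrow> 'a \<Rightarrow> 'b::{banach, second_countable_topology}"
  where "mehler c s g x = (\<integral>y. g (c *\<^sub>R x + s *\<^sub>R y) \<partial>N)"

lemma prob_UNIV [simp]: "measure N UNIV = 1"
  using N.prob_space by simp

lemma borel_measurable_N_N [simp]: "borel_measurable (N \<Otimes>\<^sub>M N) = borel_measurable (borel \<Otimes>\<^sub>M borel)"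
  by (rule measurable_cong_sets) (auto intro: sets_pair_measure_cong)

lemma borel_measurable_N [simp]: "borel_measurable N = borel_measurable borel"
  by (rule measurable_cong_sets) auto

lemma measurable_mehler [measurable]:
  assumes [measurable]: "g \<in> borel_measurable borel"
  shows "mehler c s g \<in> borel_measurable borel"
proof -
  have "(\<lambda>x. \<integral>y. g (c *\<^sub>R x + s *\<^sub>R y) \<partial>N) \<in> borel_measurable N"
    by (rule N.borel_measurable_lebesgue_integral) simp
  then show ?thesis unfolding mehler_def[abs_def] by simp
qed

lemma mehler_1_0 [simp]: "mehler 1 0 (g :: 'a \<Rightarrow> real) x = g x"
  by (simp add: mehler_def)

lemma mehler_0_1 [simp]: "mehler 0 1 (g :: 'a \<Rightarrow> real) x = (\<integral>y. g y \<partial>N)"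
  by (simp add: mehler_def)

lemma integrable_bounded_N:
  fixes g :: "'a \<Rightarrow> 'b::{banach, second_countable_topology}"
  assumes "g \<in> borel_measurable borel" "\<And>x. norm (g x) \<le> B"
  shows "integrable N g"
  using assms by (intro N.integrable_const_bound[where B = B]) auto

lemma integrable_bounded_NN:
  fixes g :: "'a \<times> 'a \<Rightarrow> 'b::{banach, second_countable_topology}"
  assumes "g \<in> borel_measurable (borel \<Otimes>\<^sub>M borel)" "\<And>x. norm (g x) \<le> B"
  shows "integrable (N \<Otimes>\<^sub>M N) g"
  using assms by (intro NN.P.integrable_const_bound[where B = B]) auto

lemma mehler_bounds:
  fixes g :: "'a \<Rightarrow> real"
  assumes [measurable]: "g \<in> borel_measurable borel" and ab: "\<And>x. a \<le> g x" "\<And>x. g x \<le> b"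
  shows "a \<le> mehler c s g x" "mehler c s g x \<le> b"
proof -
  have "\<bar>g x\<bar> \<le> \<bar>a\<bar> + \<bar>b\<bar>" for x using ab[of x] by linarith
  then have i: "integrable N (\<lambda>y. g (c *\<^sub>R x + s *\<^sub>R y))"
    by (intro integrable_bounded_N[where B = "\<bar>a\<bar> + \<bar>b\<bar>"]) auto
  show "a \<le> mehler c s g x" unfolding mehler_def
    by (rule N.integral_ge_const[OF i]) (use ab in auto)
  show "mehler c s g x \<le> b" unfolding mehler_def
    by (rule N.integral_le_const[OF i]) (use ab in auto)
qed

lemma norm_mehler_le:
  fixes g :: "'a \<Rightarrow> 'b::{banach, second_countable_topology}"
  assumes [measurable]: "g \<in> borel_measurable borel" and K: "\<And>x. norm (g x) \<le> K"
  shows "norm (mehler c s g x) \<le> K"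
proof -
  have i: "integrable N (\<lambda>y. norm (g (c *\<^sub>R x + s *\<^sub>R y)))"
    by (rule integrable_bounded_N[where B = K]) (use K in auto)
  have "norm (mehler c s g x) \<le> (\<integral>y. norm (g (c *\<^sub>R x + s *\<^sub>R y)) \<partial>N)"
    unfolding mehler_def by (rule integral_norm_bound)
  also have "\<dots> \<le> K"
    by (rule N.integral_le_const[OF i]) (use K in auto)
  finally show ?thesis .
qed

lemma integral_rotate:
  fixes f :: "'a \<Rightarrow> 'a \<Rightarrow> 'b::{banach, second_countable_topology}"
  assumes cs: "c\<^sup>2 + s\<^sup>2 = 1" "- 1 < c"
    and meas[measurable]: "case_prod f \<in> borel_measurable (borel \<Otimes>\<^sub>M borel)"
  shows "(\<integral>(x, y). f (c *\<^sub>R x + s *\<^sub>R y) (c *\<^sub>R y - s *\<^sub>R x) \<partial>(N \<Otimes>\<^sub>M N)) = (\<integral>(x, y). f x y \<partial>(N \<Otimes>\<^sub>M N))"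
    and "integrable (N \<Otimes>\<^sub>M N) (\<lambda>(x, y). f (c *\<^sub>R x + s *\<^sub>R y) (c *\<^sub>R y - s *\<^sub>R x)) \<longleftrightarrow> integrable (N \<Otimes>\<^sub>M N) (\<lambda>(x, y). f x y)"
proof -
  let ?R = "\<lambda>(x, y). (c *\<^sub>R x + s *\<^sub>R y, c *\<^sub>R y - s *\<^sub>R x)"
  have R: "?R \<in> measurable (N \<Otimes>\<^sub>M N) (N \<Otimes>\<^sub>M N)" by measurable
  have f: "case_prod f \<in> borel_measurable (N \<Otimes>\<^sub>M N)" using meas by simp
  have eq: "(\<lambda>z. case_prod f (?R z)) = (\<lambda>(x, y). f (c *\<^sub>R x + s *\<^sub>R y) (c *\<^sub>R y - s *\<^sub>R x))"
    by (auto simp: fun_eq_iff)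
  show "(\<integral>(x, y). f (c *\<^sub>R x + s *\<^sub>R y) (c *\<^sub>R y - s *\<^sub>R x) \<partial>(N \<Otimes>\<^sub>M N)) = (\<integral>(x, y). f x y \<partial>(N \<Otimes>\<^sub>M N))"
    using integral_distr[OF R f] by (simp only: distr_rotation[OF cs] eq)
  show "integrable (N \<Otimes>\<^sub>M N) (\<lambda>(x, y). f (c *\<^sub>R x + s *\<^sub>R y) (c *\<^sub>R y - s *\<^sub>R x)) \<longleftrightarrow> integrable (N \<Otimes>\<^sub>M N) (\<lambda>(x, y). f x y)"
    using integrable_distr_eq[OF R f] by (simp only: distr_rotation[OF cs] eq)
qed

lemma integral_mehler:
  fixes g :: "'a \<Rightarrow> 'b::{banach, second_countable_topology}"
  assumes cs: "c\<^sup>2 + s\<^sup>2 = 1" "- 1 < c"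
    and [measurable]: "g \<in> borel_measurable borel" and B: "\<And>x. norm (g x) \<le> B"
  shows "(\<integral>x. mehler c s g x \<partial>N) = (\<integral>x. g x \<partial>N)"
proof -
  have "(\<integral>x. mehler c s g x \<partial>N) = (\<integral>(x, y). g (c *\<^sub>R x + s *\<^sub>R y) \<partial>(N \<Otimes>\<^sub>M N))"
    unfolding mehler_def
    by (rule NN.integral_fst, rule integrable_bounded_NN[where B = B]) (use B in auto)
  also have "\<dots> = (\<integral>(x, y). g x \<partial>(N \<Otimes>\<^sub>M N))"
    by (rule integral_rotate[OF cs, where f = "\<lambda>x y. g x"]) measurable
  also have "\<dots> = (\<integral>x. \<integral>y. g x \<partial>N \<partial>N)"
    by (rule NN.integral_fst[symmetric], rule integrable_bounded_NN[where B = B]) (use B in auto)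
  also have "\<dots> = (\<integral>x. g x \<partial>N)" by simp
  finally show ?thesis .
qed

lemma gradient_mehler:
  fixes g :: "'a \<Rightarrow> real"
  assumes [measurable]: "g \<in> borel_measurable borel" "G \<in> borel_measurable borel"
    and B: "\<And>x. \<bar>g x\<bar> \<le> B"
    and der: "\<And>x. (g has_derivative (\<lambda>h. G x \<bullet> h)) (at x)" and K: "\<And>x. norm (G x) \<le> K"
  shows "(mehler c s g has_derivative (\<lambda>h. c * (mehler c s G x \<bullet> h))) (at x)"
proof -
  have K0: "0 \<le> K" using K[of 0] norm_ge_zero order_trans by blast
  have "((\<lambda>x. \<integral>y. g (c *\<^sub>R x + s *\<^sub>R y) \<partial>N) has_derivative (\<lambda>h. \<integral>y. G (c *\<^sub>R x + s *\<^sub>R y) \<bullet> (c *\<^sub>R h) \<partial>N)) (at x)"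
  proof (rule has_derivative_integral_dominated[where e = 1 and H = "\<lambda>_. K * \<bar>c\<bar>"])
    fix p y :: 'a
    show "integrable N (\<lambda>y. g (c *\<^sub>R p + s *\<^sub>R y))"
      by (rule integrable_bounded_N[where B = B]) (use B in auto)
    have "((\<lambda>p. c *\<^sub>R p + s *\<^sub>R y) has_derivative (\<lambda>h. c *\<^sub>R h)) (at p)" by (auto intro!: derivative_eq_intros)
    from has_derivative_compose[OF this der]
    show "((\<lambda>p. g (c *\<^sub>R p + s *\<^sub>R y)) has_derivative (\<lambda>h. G (c *\<^sub>R p + s *\<^sub>R y) \<bullet> (c *\<^sub>R h))) (at p)" .
    fix h :: 'a
    have "\<bar>G (c *\<^sub>R p + s *\<^sub>R y) \<bullet> (c *\<^sub>R h)\<bar> \<le> norm (G (c *\<^sub>R p + s *\<^sub>R y)) * norm (c *\<^sub>R h)"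
      by (rule Cauchy_Schwarz_ineq2)
    also have "\<dots> \<le> K * norm (c *\<^sub>R h)" by (intro mult_right_mono K) auto
    finally show "\<bar>G (c *\<^sub>R p + s *\<^sub>R y) \<bullet> (c *\<^sub>R h)\<bar> \<le> K * \<bar>c\<bar> * norm h" by (simp add: mult_ac)
  qed (use K0 in auto)
  moreover have "integrable N (\<lambda>y. G (c *\<^sub>R x + s *\<^sub>R y))"
    by (rule integrable_bounded_N[where B = K]) (use K in auto)
  ultimately show ?thesis
    by (simp add: mehler_def[abs_def])
qed

text \<open>
Differentiating under both integrals gives the expectation of
\<open>(1 + ln (P g x)) * (G (c x + s y) \<bullet> (c y - s x))\<close> over independent \<open>x\<close> and \<open>y\<close>, with \<open>P\<close> the flow at
angle \<open>\<theta>\<close>. In the rotated pair \<open>z = c x + s y\<close>, \<open>w = c y - s x\<close>, which is again independent, the last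
factor is \<open>G z \<bullet> w\<close>, linear in \<open>w\<close>. Integration by parts in \<open>w\<close> in the direction \<open>S (G z)\<close> moves a
derivative onto \<open>1 + ln (P g x)\<close>, where \<open>x = c z - s w\<close>; this produces the factor \<open>- s * c / P g x\<close>.
Rotating back and averaging over \<open>y\<close> turns the remaining gradient into its flow.
\<close>

lemma entropy_dissipation:
  fixes g :: "'a \<Rightarrow> real"
  assumes g[measurable]: "g \<in> borel_measurable borel" and G[measurable]: "G \<in> borel_measurable borel"
    and ab: "0 < a" "\<And>x. a \<le> g x" "\<And>x. g x \<le> b"
    and der: "\<And>x. (g has_derivative (\<lambda>h. G x \<bullet> h)) (at x)" and K: "\<And>x. norm (G x) \<le> K"
    and cos: "- 1 < cos \<theta>"
  shows "((\<lambda>\<theta>. \<integral>x. mehler (cos \<theta>) (sin \<theta>) g x * ln (mehler (cos \<theta>) (sin \<theta>) g x) \<partial>N) has_real_derivative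
    - (sin \<theta> * cos \<theta> * (\<integral>x. (mehler (cos \<theta>) (sin \<theta>) G x \<bullet> S (mehler (cos \<theta>) (sin \<theta>) G x)) / mehler (cos \<theta>) (sin \<theta>) g x \<partial>N))) (at \<theta>)"
proof -
  note measS[measurable]
  define c s where "c = cos \<theta>" and "s = sin \<theta>"
  have cs: "c\<^sup>2 + s\<^sup>2 = 1" "- 1 < c" using cos by (auto simp: c_def s_def)
  have K0: "0 \<le> K" using K[of 0] norm_ge_zero order_trans by blast
  have gb: "\<bar>g x\<bar> \<le> b" for x using ab(1) ab(2,3)[of x] by auto
  define \<Lambda> where "\<Lambda> = 1 + \<bar>ln a\<bar> + \<bar>ln b\<bar>"
  have ln_bd: "\<bar>1 + ln p\<bar> \<le> \<Lambda>" "\<bar>ln p\<bar> \<le> \<Lambda>" if "a \<le> p" "p \<le> b" for p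
  proof -
    have "ln a \<le> ln p" "ln p \<le> ln b" using that ab(1) by auto
    then show "\<bar>1 + ln p\<bar> \<le> \<Lambda>" "\<bar>ln p\<bar> \<le> \<Lambda>" unfolding \<Lambda>_def by linarith+
  qed
  have \<Lambda>0: "0 \<le> \<Lambda>" by (simp add: \<Lambda>_def)
  define P where "P t x = mehler (cos t) (sin t) g x" for t x
  have P_meas[measurable]: "P t \<in> borel_measurable borel" for t unfolding P_def[abs_def] by measurable
  have P_bd: "a \<le> P t x" "P t x \<le> b" for t x
    using mehler_bounds[OF g ab(2,3)] by (auto simp: P_def)
  have P_pos: "0 < P t x" for t x using P_bd(1)[of t x] ab(1) by linarith
  define d where "d t x = (\<integral>y. G (cos t *\<^sub>R x + sin t *\<^sub>R y) \<bullet> (cos t *\<^sub>R y - sin t *\<^sub>R x) \<partial>N)" for t x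
  have i_bd: "\<bar>G (cos t *\<^sub>R x + sin t *\<^sub>R y) \<bullet> (cos t *\<^sub>R y - sin t *\<^sub>R x)\<bar> \<le> K * (norm x + norm y)" for t x y
  proof -
    have "norm (cos t *\<^sub>R y - sin t *\<^sub>R x) \<le> norm (cos t *\<^sub>R y) + norm (sin t *\<^sub>R x)" by (rule norm_triangle_ineq4)
    also have "\<dots> \<le> 1 * norm y + 1 * norm x"
      unfolding norm_scaleR by (intro add_mono mult_right_mono) auto
    finally have 1: "norm (cos t *\<^sub>R y - sin t *\<^sub>R x) \<le> norm x + norm y" by simp
    have "\<bar>G (cos t *\<^sub>R x + sin t *\<^sub>R y) \<bullet> (cos t *\<^sub>R y - sin t *\<^sub>R x)\<bar>
        \<le> norm (G (cos t *\<^sub>R x + sin t *\<^sub>R y)) * norm (cos t *\<^sub>R y - sin t *\<^sub>R x)"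
      by (rule Cauchy_Schwarz_ineq2)
    also have "\<dots> \<le> K * (norm x + norm y)" by (intro mult_mono K 1 K0 norm_ge_zero)
    finally show ?thesis .
  qed
  have i_int: "integrable N (\<lambda>y. G (cos t *\<^sub>R x + sin t *\<^sub>R y) \<bullet> (cos t *\<^sub>R y - sin t *\<^sub>R x))" for t x
    by (rule Bochner_Integration.integrable_bound[where f = "\<lambda>y. K * (norm x + norm y)"])
      (use i_bd K0 integrable_norm in \<open>auto intro!: AE_I2 simp: abs_mult\<close>)
  have dP: "((\<lambda>t. P t x) has_derivative (\<lambda>h. h * d t x)) (at t)" for t x
  proof -
    have "((\<lambda>t. \<integral>y. g (cos t *\<^sub>R x + sin t *\<^sub>R y) \<partial>N) has_derivative
      (\<lambda>h. \<integral>y. h * (G (cos t *\<^sub>R x + sin t *\<^sub>R y) \<bullet> (cos t *\<^sub>R y - sin t *\<^sub>R x)) \<partial>N)) (at t)"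
    proof (rule has_derivative_integral_dominated[where e = 1 and H = "\<lambda>y. K * (norm x + norm y)"])
      fix p :: real and y :: 'a
      show "integrable N (\<lambda>y. g (cos p *\<^sub>R x + sin p *\<^sub>R y))"
        by (rule integrable_bounded_N[where B = b]) (use gb in auto)
      have "((\<lambda>p. cos p *\<^sub>R x + sin p *\<^sub>R y) has_derivative (\<lambda>h. h *\<^sub>R (cos p *\<^sub>R y - sin p *\<^sub>R x))) (at p)"
        by (rule derivative_eq_intros refl)+ (simp add: algebra_simps)
      from has_derivative_compose[OF this der]
      show "((\<lambda>p. g (cos p *\<^sub>R x + sin p *\<^sub>R y)) has_derivative
          (\<lambda>h. h * (G (cos p *\<^sub>R x + sin p *\<^sub>R y) \<bullet> (cos p *\<^sub>R y - sin p *\<^sub>R x)))) (at p)" by simp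
      show "\<bar>h * (G (cos p *\<^sub>R x + sin p *\<^sub>R y) \<bullet> (cos p *\<^sub>R y - sin p *\<^sub>R x))\<bar> \<le> K * (norm x + norm y) * norm h" for h
        using mult_right_mono[OF i_bd[of p x y], of "\<bar>h\<bar>"] by (simp add: abs_mult mult_ac)
    qed (use K0 integrable_norm in auto)
    then show ?thesis by (simp add: P_def mehler_def d_def)
  qed
  have d_meas[measurable]: "d t \<in> borel_measurable borel" for t
  proof -
    have "d t \<in> borel_measurable N" unfolding d_def[abs_def]
      by (rule N.borel_measurable_lebesgue_integral) simp
    then show ?thesis by simp
  qed
  have d_bd: "\<bar>d t x\<bar> \<le> K * (norm x + (\<integral>y. norm y \<partial>N))" for t x
  proof -
    have "\<bar>d t x\<bar> \<le> (\<integral>y. \<bar>G (cos t *\<^sub>R x + sin t *\<^sub>R y) \<bullet> (cos t *\<^sub>R y - sin t *\<^sub>R x)\<bar> \<partial>N)"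
      unfolding d_def by (rule integral_abs_bound)
    also have "\<dots> \<le> (\<integral>y. K * (norm x + norm y) \<partial>N)"
      by (rule integral_mono) (use i_bd i_int integrable_norm in auto)
    also have "\<dots> = K * (norm x + (\<integral>y. norm y \<partial>N))"
      using integrable_norm by simp
    finally show ?thesis .
  qed
  have "((\<lambda>t. \<integral>x. P t x * ln (P t x) \<partial>N) has_derivative (\<lambda>h. \<integral>x. (1 + ln (P \<theta> x)) * (h * d \<theta> x) \<partial>N)) (at \<theta>)"
  proof (rule has_derivative_integral_dominated[where e = 1 and H = "\<lambda>x. \<Lambda> * (K * (norm x + (\<integral>y. norm y \<partial>N)))"])
    fix t :: real and x :: 'a
    show "integrable N (\<lambda>x. P t x * ln (P t x))"
    proof (rule integrable_bounded_N[where B = "b * \<Lambda>"])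
      fix x
      have "\<bar>P t x\<bar> * \<bar>ln (P t x)\<bar> \<le> b * \<Lambda>"
        using P_bd[of t x] P_pos[of t x] ln_bd(2)[OF P_bd[of t x]] by (intro mult_mono) auto
      then show "norm (P t x * ln (P t x)) \<le> b * \<Lambda>" by (simp add: abs_mult)
    qed measurable
    have "((\<lambda>y. y * ln y) has_derivative (\<lambda>h. (1 + ln (P t x)) * h)) (at (P t x))"
      using P_pos[of t x] by (auto intro!: derivative_eq_intros simp: algebra_simps)
    from has_derivative_compose[OF dP this]
    show "((\<lambda>t. P t x * ln (P t x)) has_derivative (\<lambda>h. (1 + ln (P t x)) * (h * d t x))) (at t)" .
    fix h :: real
    have "\<bar>1 + ln (P t x)\<bar> * \<bar>d t x\<bar> \<le> \<Lambda> * (K * (norm x + (\<integral>y. norm y \<partial>N)))"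
      by (intro mult_mono ln_bd P_bd d_bd \<Lambda>0) auto
    from mult_right_mono[OF this abs_ge_zero[of h]]
    show "\<bar>(1 + ln (P t x)) * (h * d t x)\<bar> \<le> \<Lambda> * (K * (norm x + (\<integral>y. norm y \<partial>N))) * norm h"
      by (simp add: abs_mult mult_ac)
  qed (use K0 \<Lambda>0 integrable_norm in \<open>auto intro!: mult_nonneg_nonneg add_nonneg_nonneg\<close>)
  then have D1: "((\<lambda>t. \<integral>x. P t x * ln (P t x) \<partial>N) has_real_derivative (\<integral>x. (1 + ln (P \<theta> x)) * d \<theta> x \<partial>N)) (at \<theta>)"
    unfolding has_field_derivative_def
    by (simp add: mult.left_commute mult_commute_abs)
  define p where "p = P \<theta>"
  define PG where "PG = mehler c s G"
  have pm: "p = mehler c s g" by (simp add: p_def P_def[abs_def] c_def s_def)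
  have p_meas[measurable]: "p \<in> borel_measurable borel" unfolding p_def by measurable
  have p_bd: "a \<le> p x" "p x \<le> b" "0 < p x" for x using P_bd P_pos by (auto simp: p_def)
  have PG_meas[measurable]: "PG \<in> borel_measurable borel" unfolding PG_def by measurable
  have PG_bd: "norm (PG x) \<le> K" for x unfolding PG_def by (rule norm_mehler_le[OF G K])
  have "bounded_linear S" by (rule linear_conv_bounded_linear[THEN iffD1, OF linS])
  from bounded_linear.nonneg_bounded[OF this]
  obtain KS where KS: "KS \<ge> 0" "\<And>v. norm (S v) \<le> norm v * KS" by blast
  \<comment> \<open>The integrand that remains after the integration by parts.\<close>
  define J where "J x z = (PG x \<bullet> S (G z)) / p x" for x z
  have J_meas[measurable]: "case_prod J \<in> borel_measurable (borel \<Otimes>\<^sub>M borel)" unfolding J_def[abs_def] by measurable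
  have SG: "norm (S (G z)) \<le> K * KS" for z
    by (rule order_trans[OF KS(2)]) (intro mult_right_mono K KS(1))
  have JJ: "\<bar>PG x \<bullet> S (G z)\<bar> \<le> K * (K * KS)" for x z
  proof -
    have "\<bar>PG x \<bullet> S (G z)\<bar> \<le> norm (PG x) * norm (S (G z))" by (rule Cauchy_Schwarz_ineq2)
    also have "\<dots> \<le> K * (K * KS)" by (intro mult_mono PG_bd SG K0 norm_ge_zero)
    finally show ?thesis .
  qed
  have J_bd: "\<bar>J x z\<bar> \<le> K * (K * KS) / a" for x z
    unfolding J_def abs_divide using p_bd[of x] ab(1) K0 KS(1) by (intro frac_le JJ) auto
  have rot1: "c *\<^sub>R (c *\<^sub>R x + s *\<^sub>R y) - s *\<^sub>R (c *\<^sub>R y - s *\<^sub>R x) = x" for x y :: 'a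
  proof -
    have "c *\<^sub>R (c *\<^sub>R x + s *\<^sub>R y) - s *\<^sub>R (c *\<^sub>R y - s *\<^sub>R x) = (c\<^sup>2 + s\<^sup>2) *\<^sub>R x"
      by (simp add: algebra_simps power2_eq_square)
    then show ?thesis by (simp add: cs)
  qed
  have 3: "integrable (N \<Otimes>\<^sub>M N) (\<lambda>(x, y). (1 + ln (p x)) * (G (c *\<^sub>R x + s *\<^sub>R y) \<bullet> (c *\<^sub>R y - s *\<^sub>R x)))"
  proof (rule Bochner_Integration.integrable_bound[where f = "\<lambda>(x, y). \<Lambda> * (K * (norm x + norm y))"])
    have "integrable (N \<Otimes>\<^sub>M N) (\<lambda>z. norm (fst z))"
      using integrable_norm by (intro NN.Fubini_integrable) auto
    moreover have "integrable (N \<Otimes>\<^sub>M N) (\<lambda>z. norm (snd z))"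
      using integrable_norm by (intro NN.Fubini_integrable) auto
    ultimately show "integrable (N \<Otimes>\<^sub>M N) (\<lambda>(x, y). \<Lambda> * (K * (norm x + norm y)))"
      by (simp add: split_beta')
    show "AE z in N \<Otimes>\<^sub>M N. norm (case z of (x, y) \<Rightarrow> (1 + ln (p x)) * (G (c *\<^sub>R x + s *\<^sub>R y) \<bullet> (c *\<^sub>R y - s *\<^sub>R x)))
        \<le> norm (case z of (x, y) \<Rightarrow> \<Lambda> * (K * (norm x + norm y)))"
    proof (rule AE_I2, clarify)
      fix x y :: 'a
      have "\<bar>1 + ln (p x)\<bar> * \<bar>G (c *\<^sub>R x + s *\<^sub>R y) \<bullet> (c *\<^sub>R y - s *\<^sub>R x)\<bar> \<le> \<Lambda> * (K * (norm x + norm y))"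
        unfolding c_def s_def by (intro mult_mono ln_bd p_bd i_bd \<Lambda>0) auto
      then show "norm ((1 + ln (p x)) * (G (c *\<^sub>R x + s *\<^sub>R y) \<bullet> (c *\<^sub>R y - s *\<^sub>R x))) \<le> norm (\<Lambda> * (K * (norm x + norm y)))"
        by (simp add: abs_mult K0 \<Lambda>0)
    qed
  qed simp
  have "(\<integral>x. (1 + ln (P \<theta> x)) * d \<theta> x \<partial>N)
      = (\<integral>x. \<integral>y. (1 + ln (p x)) * (G (c *\<^sub>R x + s *\<^sub>R y) \<bullet> (c *\<^sub>R y - s *\<^sub>R x)) \<partial>N \<partial>N)"
    by (simp add: d_def p_def c_def s_def)
  also have "\<dots> = (\<integral>(x, y). (1 + ln (p x)) * (G (c *\<^sub>R x + s *\<^sub>R y) \<bullet> (c *\<^sub>R y - s *\<^sub>R x)) \<partial>(N \<Otimes>\<^sub>M N))"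
    by (rule NN.integral_fst[OF 3])
  also have "\<dots> = (\<integral>(z, w). (1 + ln (p (c *\<^sub>R z - s *\<^sub>R w))) * (G z \<bullet> w) \<partial>(N \<Otimes>\<^sub>M N))"
    using integral_rotate(1)[OF cs, where f = "\<lambda>z w. (1 + ln (p (c *\<^sub>R z - s *\<^sub>R w))) * (G z \<bullet> w)"]
    by (simp add: rot1)
  also have "\<dots> = (\<integral>z. \<integral>w. (1 + ln (p (c *\<^sub>R z - s *\<^sub>R w))) * (G z \<bullet> w) \<partial>N \<partial>N)"
  proof (rule NN.integral_fst[symmetric])
    show "integrable (N \<Otimes>\<^sub>M N) (\<lambda>(z, w). (1 + ln (p (c *\<^sub>R z - s *\<^sub>R w))) * (G z \<bullet> w))"
      using 3 integral_rotate(2)[OF cs, where f = "\<lambda>z w. (1 + ln (p (c *\<^sub>R z - s *\<^sub>R w))) * (G z \<bullet> w)"]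
      by (simp add: rot1)
  qed
  also have "\<dots> = (\<integral>z. \<integral>w. - (s * c) * J (c *\<^sub>R z - s *\<^sub>R w) z \<partial>N \<partial>N)"
  proof (rule Bochner_Integration.integral_cong[OF refl])
    fix z :: 'a
    \<comment> \<open>Since \<open>L\<close> inverts \<open>S\<close>, the linear factor \<open>G z \<bullet> w\<close> has the form required by Stein's identity.\<close>
    have "(\<integral>w. (1 + ln (p (c *\<^sub>R z - s *\<^sub>R w))) * (w \<bullet> L (S (G z))) \<partial>N)
        = (\<integral>w. 1 / p (c *\<^sub>R z - s *\<^sub>R w) * (c * (PG (c *\<^sub>R z - s *\<^sub>R w) \<bullet> (- s *\<^sub>R S (G z)))) \<partial>N)"
    proof (rule Stein[where B = \<Lambda> and K = "1/a * (\<bar>c\<bar> * (K * \<bar>s\<bar>))" and k = "\<lambda>w. 1 + ln (p (c *\<^sub>R z - s *\<^sub>R w))" and k' = "\<lambda>w v. 1 / p (c *\<^sub>R z - s *\<^sub>R w) * (c * (PG (c *\<^sub>R z - s *\<^sub>R w) \<bullet> (- s *\<^sub>R v)))"])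
      fix w :: 'a
      show "\<bar>1 + ln (p (c *\<^sub>R z - s *\<^sub>R w))\<bar> \<le> \<Lambda>" by (intro ln_bd p_bd)
      have a1: "((\<lambda>w. c *\<^sub>R z - s *\<^sub>R w) has_derivative (\<lambda>v. - s *\<^sub>R v)) (at w)"
        by (auto intro!: derivative_eq_intros)
      have "(p has_derivative (\<lambda>h. c * (PG x \<bullet> h))) (at x)" for x
        unfolding pm PG_def by (rule gradient_mehler[OF g G gb der K])
      from has_derivative_compose[OF a1 this]
      have a2: "((\<lambda>w. p (c *\<^sub>R z - s *\<^sub>R w)) has_derivative (\<lambda>v. c * (PG (c *\<^sub>R z - s *\<^sub>R w) \<bullet> (- s *\<^sub>R v)))) (at w)" .
      have "((\<lambda>y. 1 + ln y) has_derivative (\<lambda>h. 1 / p (c *\<^sub>R z - s *\<^sub>R w) * h)) (at (p (c *\<^sub>R z - s *\<^sub>R w)))"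
        using p_bd(3)[of "c *\<^sub>R z - s *\<^sub>R w"] by (auto intro!: derivative_eq_intros simp: field_simps)
      from has_derivative_compose[OF a2 this]
      show "((\<lambda>w. 1 + ln (p (c *\<^sub>R z - s *\<^sub>R w))) has_derivative
          (\<lambda>v. 1 / p (c *\<^sub>R z - s *\<^sub>R w) * (c * (PG (c *\<^sub>R z - s *\<^sub>R w) \<bullet> (- s *\<^sub>R v))))) (at w)" .
      fix v :: 'a
      have "\<bar>PG (c *\<^sub>R z - s *\<^sub>R w) \<bullet> (- s *\<^sub>R v)\<bar> \<le> norm (PG (c *\<^sub>R z - s *\<^sub>R w)) * norm (- s *\<^sub>R v)"
        by (rule Cauchy_Schwarz_ineq2)
      also have "\<dots> \<le> K * norm (- s *\<^sub>R v)" by (intro mult_right_mono PG_bd norm_ge_zero)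
      finally have b1: "\<bar>PG (c *\<^sub>R z - s *\<^sub>R w) \<bullet> (- s *\<^sub>R v)\<bar> \<le> K * \<bar>s\<bar> * norm v" by (simp add: mult_ac)
      have b2: "\<bar>1 / p (c *\<^sub>R z - s *\<^sub>R w)\<bar> \<le> 1 / a"
        using p_bd[of "c *\<^sub>R z - s *\<^sub>R w"] ab(1) by (auto intro!: frac_le simp: abs_divide)
      have "\<bar>1 / p (c *\<^sub>R z - s *\<^sub>R w)\<bar> * (\<bar>c\<bar> * \<bar>PG (c *\<^sub>R z - s *\<^sub>R w) \<bullet> (- s *\<^sub>R v)\<bar>) \<le> 1 / a * (\<bar>c\<bar> * (K * \<bar>s\<bar> * norm v))"
        using ab(1) by (intro mult_mono b1 b2) auto
      then show "\<bar>1 / p (c *\<^sub>R z - s *\<^sub>R w) * (c * (PG (c *\<^sub>R z - s *\<^sub>R w) \<bullet> (- s *\<^sub>R v)))\<bar> \<le> 1/a * (\<bar>c\<bar> * (K * \<bar>s\<bar>)) * norm v"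
        by (simp only: abs_mult mult_ac)
    qed (use K0 ab(1) in \<open>auto intro!: mult_nonneg_nonneg\<close>)
    then show "(\<integral>w. (1 + ln (p (c *\<^sub>R z - s *\<^sub>R w))) * (G z \<bullet> w) \<partial>N) = (\<integral>w. - (s * c) * J (c *\<^sub>R z - s *\<^sub>R w) z \<partial>N)"
      by (simp add: LS J_def inner_commute[of "G z"] mult_ac)
  qed
  also have "\<dots> = - (s * c) * (\<integral>z. \<integral>w. J (c *\<^sub>R z - s *\<^sub>R w) z \<partial>N \<partial>N)" by simp
  also have "(\<integral>z. \<integral>w. J (c *\<^sub>R z - s *\<^sub>R w) z \<partial>N \<partial>N) = (\<integral>(z, w). J (c *\<^sub>R z - s *\<^sub>R w) z \<partial>(N \<Otimes>\<^sub>M N))"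
    by (rule NN.integral_fst, rule integrable_bounded_NN[where B = "K * (K * KS) / a"]) (use J_bd in auto)
  also have "\<dots> = (\<integral>(x, y). J x (c *\<^sub>R x + s *\<^sub>R y) \<partial>(N \<Otimes>\<^sub>M N))"
    using integral_rotate(1)[OF cs, where f = "\<lambda>z w. J (c *\<^sub>R z - s *\<^sub>R w) z"]
    by (simp add: rot1)
  also have "\<dots> = (\<integral>x. \<integral>y. J x (c *\<^sub>R x + s *\<^sub>R y) \<partial>N \<partial>N)"
    by (rule NN.integral_fst[symmetric], rule integrable_bounded_NN[where B = "K * (K * KS) / a"]) (use J_bd in auto)
  also have "\<dots> = (\<integral>x. (PG x \<bullet> S (PG x)) / p x \<partial>N)"
  proof (rule Bochner_Integration.integral_cong[OF refl])
    fix x :: 'a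
    have iG: "integrable N (\<lambda>y. G (c *\<^sub>R x + s *\<^sub>R y))"
      by (rule integrable_bounded_N[where B = K]) (use K in auto)
    have iSG: "integrable N (\<lambda>y. S (G (c *\<^sub>R x + s *\<^sub>R y)))"
      by (rule integrable_bounded_N[where B = "K * KS"]) (use SG in auto)
    have "S (PG x) = (\<integral>y. S (G (c *\<^sub>R x + s *\<^sub>R y)) \<partial>N)"
      unfolding PG_def mehler_def
      by (rule integral_bounded_linear[OF linear_conv_bounded_linear[THEN iffD1, OF linS] iG, symmetric])
    then show "(\<integral>y. J x (c *\<^sub>R x + s *\<^sub>R y) \<partial>N) = (PG x \<bullet> S (PG x)) / p x"
      using iSG by (simp add: J_def)
  qed
  finally show ?thesis using D1 by (simp add: P_def c_def s_def PG_def pm)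
qed

end

section \<open>Resampling along a line\<close>

text \<open>
The conditional law of a Gaussian vector along a line is again Gaussian, so the flow along a line is
the Mehler flow on the real line for the standard normal law.
\<close>

lemma gaussian_standard: "gaussian (\<lambda>x::real. x) (\<lambda>x. x) (1 / sqrt (2 * pi)) 1"
proof
  show "(\<integral>\<^sup>+x. ennreal (1 / sqrt (2 * pi) * exp (- ((x::real) \<bullet> x) / 2)) \<partial>lborel) = 1"
  proof -
    interpret prob_space "density lborel std_normal_density"
      using prob_space_normal_density[of 1 0] by simp
    have "(\<integral>\<^sup>+x. ennreal (std_normal_density x) \<partial>lborel) = 1"
      using emeasure_space_1 by (simp add: emeasure_density)
    then show ?thesis by (simp add: std_normal_density_def power2_eq_square inner_real_def)
  qed
qed (auto simp: linear_iff)

interpretation std: gaussian "\<lambda>x::real. x" "\<lambda>x. x" "1 / sqrt (2 * pi)" 1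
  by (rule gaussian_standard)

context prob_space begin

text \<open>
The function \<open>(a, b) \<mapsto> a^2 / b\<close> is convex and homogeneous of degree one; with \<open>r\<close> the quotient of the two
integrals, the claim is the nonnegativity of the integral of \<open>(A - r B)^2 / B\<close>.
\<close>

lemma jensen_square_div:
  fixes A B :: "'a \<Rightarrow> real"
  assumes A[measurable]: "A \<in> borel_measurable M" and B[measurable]: "B \<in> borel_measurable M"
    and a: "a > 0" "\<And>x. a \<le> B x" "\<And>x. B x \<le> b" and K: "\<And>x. \<bar>A x\<bar> \<le> K"
  shows "(\<integral>x. A x \<partial>M)\<^sup>2 / (\<integral>x. B x \<partial>M) \<le> (\<integral>x. (A x)\<^sup>2 / B x \<partial>M)"
proof -
  have Bp: "0 < B x" for x using a(2)[of x] a(1) by linarith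
  have iA: "integrable M A" by (rule integrable_const_bound[where B = K]) (use K in auto)
  have iB: "integrable M B"
    by (rule integrable_const_bound[where B = b]) (use a Bp in \<open>auto simp: abs_of_pos\<close>)
  have iAB: "integrable M (\<lambda>x. (A x)\<^sup>2 / B x)"
  proof (rule integrable_const_bound[where B = "K\<^sup>2 / a"])
    have "\<bar>(A x)\<^sup>2 / B x\<bar> \<le> K\<^sup>2 / a" for x
      unfolding abs_divide using K[of x] a(1,2) Bp[of x]
      by (intro frac_le) (auto simp: abs_le_square_iff[symmetric])
    then show "AE x in M. norm ((A x)\<^sup>2 / B x) \<le> K\<^sup>2 / a" by simp
  qed measurable
  have EB: "a \<le> (\<integral>x. B x \<partial>M)" by (rule integral_ge_const[OF iB]) (use a in auto)
  define r where "r = (\<integral>x. A x \<partial>M) / (\<integral>x. B x \<partial>M)"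
  have "0 \<le> (\<integral>x. (A x - r * B x)\<^sup>2 / B x \<partial>M)"
    by (rule integral_nonneg_AE) (use Bp in \<open>auto intro!: AE_I2 divide_nonneg_pos\<close>)
  also have "\<dots> = (\<integral>x. (A x)\<^sup>2 / B x - 2 * r * A x + r\<^sup>2 * B x \<partial>M)"
  proof (rule Bochner_Integration.integral_cong[OF refl])
    fix x show "(A x - r * B x)\<^sup>2 / B x = (A x)\<^sup>2 / B x - 2 * r * A x + r\<^sup>2 * B x"
      using Bp[of x] by (simp add: field_simps power2_eq_square)
  qed
  also have "\<dots> = (\<integral>x. (A x)\<^sup>2 / B x \<partial>M) - 2 * r * (\<integral>x. A x \<partial>M) + r\<^sup>2 * (\<integral>x. B x \<partial>M)"
    using iA iB iAB by simp
  also have "2 * r * (\<integral>x. A x \<partial>M) = 2 * ((\<integral>x. A x \<partial>M)\<^sup>2 / (\<integral>x. B x \<partial>M))"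
    by (simp add: r_def power2_eq_square)
  also have "r\<^sup>2 * (\<integral>x. B x \<partial>M) = (\<integral>x. A x \<partial>M)\<^sup>2 / (\<integral>x. B x \<partial>M)"
    using EB a(1) by (simp add: r_def power2_eq_square)
  finally show ?thesis by simp
qed

end

context gaussian begin

text \<open>
For a direction with \<open>u \<bullet> L u = 1\<close> the coordinate \<open>x \<bullet> L u\<close> along \<open>u\<close> is standard normal and
independent of \<open>transversal u x\<close>. If \<open>u\<close> is a multiple of the \<open>i\<close>-th unit vector, fixing the transversal
part amounts to fixing all coordinates other than the \<open>i\<close>-th.
\<close>

definition transversal :: "'a \<Rightarrow> 'a \<Rightarrow> 'a" where "transversal u x = x - (x \<bullet> L u) *\<^sub>R u"

lemma measurable_transversal [measurable]: "transversal u \<in> borel_measurable borel"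
  unfolding transversal_def[abs_def] by measurable

text \<open>
This is the conditional expectation given the transversal part.
\<close>

definition resample :: "'a \<Rightarrow> ('a \<Rightarrow> real) \<Rightarrow> 'a \<Rightarrow> real"
  where "resample u f x = (\<integral>t. f (transversal u x + t *\<^sub>R u) \<partial>std.N)"

definition line_mehler :: "'a \<Rightarrow> real \<Rightarrow> real \<Rightarrow> ('a \<Rightarrow> real) \<Rightarrow> 'a \<Rightarrow> real"
  where "line_mehler u c s f x = std.mehler c s (\<lambda>t. f (transversal u x + t *\<^sub>R u)) (x \<bullet> L u)"

text \<open>
Replacing the coordinate along \<open>u\<close> by an independent standard normal variable leaves the law unchanged.
Two translations prove it, one of the new variable and one of \<open>x\<close> along \<open>u\<close>, because the density
factorizes into a function of the transversal part and the standard normal density of \<open>x \<bullet> L u\<close>.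
\<close>

lemma distr_resample:
  assumes u: "u \<bullet> L u = 1"
  shows "distr (N \<Otimes>\<^sub>M std.N) borel (\<lambda>(x, t). transversal u x + t *\<^sub>R u) = N" (is "distr _ _ ?R = _")
proof (rule measure_eqI)
  have R[measurable]: "?R \<in> borel_measurable (N \<Otimes>\<^sub>M std.N)" by measurable
  fix A assume "A \<in> sets (distr (N \<Otimes>\<^sub>M std.N) borel ?R)"
  then have [measurable]: "A \<in> sets borel" by simp
  let ?I = "indicator A :: 'a \<Rightarrow> ennreal"
  have uL: "u \<bullet> L x = x \<bullet> L u" for x using symL[of u x] by (simp add: inner_commute)
  have qq: "q (x - t *\<^sub>R u) * std.q (x \<bullet> L u) = q x * std.q (t - x \<bullet> L u)" for x t
  proof -
    have "(x - t *\<^sub>R u) \<bullet> L (x - t *\<^sub>R u) = x \<bullet> L x - 2 * t * (x \<bullet> L u) + t * t"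
      by (simp only: L_diff L_scale inner_diff_left inner_diff_right inner_scaleR_left inner_scaleR_right uL[of x] u)
        algebra
    then have "- ((x - t *\<^sub>R u) \<bullet> L (x - t *\<^sub>R u)) / 2 + - ((x \<bullet> L u) \<bullet> (x \<bullet> L u)) / 2
        = - (x \<bullet> L x) / 2 + - ((t - x \<bullet> L u) \<bullet> (t - x \<bullet> L u)) / 2"
      by (simp add: field_simps)
    moreover have "C * exp v * (k * exp w) = C * k * exp (v + w)" for k v w by (simp add: exp_add)
    ultimately show ?thesis unfolding q_def std.q_def by (simp only:)
  qed
  have "emeasure (distr (N \<Otimes>\<^sub>M std.N) borel ?R) A = (\<integral>\<^sup>+z. ?I z \<partial>distr (N \<Otimes>\<^sub>M std.N) borel ?R)"
    by simp
  also have "\<dots> = (\<integral>\<^sup>+z. ?I (?R z) \<partial>(N \<Otimes>\<^sub>M std.N))"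
    by (rule nn_integral_distr) auto
  also have "\<dots> = (\<integral>\<^sup>+x. \<integral>\<^sup>+t. ?I (transversal u x + t *\<^sub>R u) \<partial>std.N \<partial>N)"
    by (subst std.N.nn_integral_fst[symmetric]) auto
  also have "\<dots> = (\<integral>\<^sup>+x. \<integral>\<^sup>+t. ennreal (std.q t) * ?I (transversal u x + t *\<^sub>R u) \<partial>lborel \<partial>N)"
    by (intro nn_integral_cong std.nn_integral_N) measurable
  also have "\<dots> = (\<integral>\<^sup>+x. ennreal (q x) * (\<integral>\<^sup>+t. ennreal (std.q t) * ?I (transversal u x + t *\<^sub>R u) \<partial>lborel) \<partial>lborel)"
  proof (rule nn_integral_N)
    have "(\<lambda>(x, t). ennreal (std.q t) * ?I (transversal u x + t *\<^sub>R u)) \<in> borel_measurable (borel \<Otimes>\<^sub>M lborel)"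
      by measurable
    then show "(\<lambda>x. \<integral>\<^sup>+t. ennreal (std.q t) * ?I (transversal u x + t *\<^sub>R u) \<partial>lborel) \<in> borel_measurable borel"
      by (rule lborel.borel_measurable_nn_integral)
  qed
  also have "\<dots> = (\<integral>\<^sup>+x. ennreal (q x) * (\<integral>\<^sup>+t. ennreal (std.q (t + x \<bullet> L u)) * ?I (x + t *\<^sub>R u) \<partial>lborel) \<partial>lborel)"
  proof (rule nn_integral_cong, rule arg_cong2[where f = "(*)"], rule refl)
    fix x
    have "(\<integral>\<^sup>+t. ennreal (std.q (t + x \<bullet> L u)) * ?I (transversal u x + (t + x \<bullet> L u) *\<^sub>R u) \<partial>lborel)
      = (\<integral>\<^sup>+t. ennreal (std.q t) * ?I (transversal u x + t *\<^sub>R u) \<partial>lborel)"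
      by (rule nn_integral_lborel_translate[of "\<lambda>t. ennreal (std.q t) * ?I (transversal u x + t *\<^sub>R u)"]) measurable
    then show "(\<integral>\<^sup>+t. ennreal (std.q t) * ?I (transversal u x + t *\<^sub>R u) \<partial>lborel) =
        (\<integral>\<^sup>+t. ennreal (std.q (t + x \<bullet> L u)) * ?I (x + t *\<^sub>R u) \<partial>lborel)"
      by (simp add: transversal_def algebra_simps)
  qed
  also have "\<dots> = (\<integral>\<^sup>+x. \<integral>\<^sup>+t. ennreal (q x * std.q (t + x \<bullet> L u)) * ?I (x + t *\<^sub>R u) \<partial>lborel \<partial>lborel)"
    by (subst nn_integral_cmult[symmetric]) (measurable, simp add: ennreal_mult' mult.assoc)
  also have "\<dots> = (\<integral>\<^sup>+t. \<integral>\<^sup>+x. ennreal (q x * std.q (t + x \<bullet> L u)) * ?I (x + t *\<^sub>R u) \<partial>lborel \<partial>lborel)"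
    by (rule lborel_pair.Fubini'[symmetric]) measurable
  also have "\<dots> = (\<integral>\<^sup>+t. \<integral>\<^sup>+x. ennreal (q x * std.q (t - x \<bullet> L u)) * ?I x \<partial>lborel \<partial>lborel)"
  proof (rule nn_integral_cong)
    fix t
    have "(\<integral>\<^sup>+x. ennreal (q x * std.q (t + x \<bullet> L u)) * ?I (x + t *\<^sub>R u) \<partial>lborel) =
        (\<integral>\<^sup>+x. ennreal (q (x + t *\<^sub>R u - t *\<^sub>R u) * std.q ((x + t *\<^sub>R u) \<bullet> L u)) * ?I (x + t *\<^sub>R u) \<partial>lborel)"
      by (simp add: inner_simps u add.commute)
    also have "\<dots> = (\<integral>\<^sup>+x. ennreal (q (x - t *\<^sub>R u) * std.q (x \<bullet> L u)) * ?I x \<partial>lborel)"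
      by (rule nn_integral_lborel_translate[of "\<lambda>x. ennreal (q (x - t *\<^sub>R u) * std.q (x \<bullet> L u)) * ?I x"]) measurable
    finally show "(\<integral>\<^sup>+x. ennreal (q x * std.q (t + x \<bullet> L u)) * ?I (x + t *\<^sub>R u) \<partial>lborel) =
        (\<integral>\<^sup>+x. ennreal (q x * std.q (t - x \<bullet> L u)) * ?I x \<partial>lborel)" by (simp only: qq)
  qed
  also have "\<dots> = (\<integral>\<^sup>+x. \<integral>\<^sup>+t. ennreal (q x * std.q (t - x \<bullet> L u)) * ?I x \<partial>lborel \<partial>lborel)"
    by (rule lborel_pair.Fubini') measurable
  also have "\<dots> = (\<integral>\<^sup>+x. ennreal (q x) * ?I x \<partial>lborel)"
  proof (rule nn_integral_cong)
    fix x
    have 1: "(\<integral>\<^sup>+t. ennreal (std.q (t - x \<bullet> L u)) \<partial>lborel) = 1"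
      using nn_integral_lborel_translate[of "\<lambda>t. ennreal (std.q t)" "- (x \<bullet> L u)"] std.total
      by (simp add: std.q_def)
    have "(\<integral>\<^sup>+t. ennreal (q x * std.q (t - x \<bullet> L u)) * ?I x \<partial>lborel) =
        (\<integral>\<^sup>+t. (ennreal (q x) * ?I x) * ennreal (std.q (t - x \<bullet> L u)) \<partial>lborel)"
      by (simp add: ennreal_mult' mult_ac)
    also have "\<dots> = (ennreal (q x) * ?I x) * (\<integral>\<^sup>+t. ennreal (std.q (t - x \<bullet> L u)) \<partial>lborel)"
      by (rule nn_integral_cmult) measurable
    finally show "(\<integral>\<^sup>+t. ennreal (q x * std.q (t - x \<bullet> L u)) * ?I x \<partial>lborel) = ennreal (q x) * ?I x"
      by (simp add: 1)
  qed
  also have "\<dots> = (\<integral>\<^sup>+x. ?I x \<partial>N)"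
    by (rule nn_integral_N[symmetric]) measurable
  also have "\<dots> = emeasure N A" by simp
  finally show "emeasure (distr (N \<Otimes>\<^sub>M std.N) borel ?R) A = emeasure N A" .
qed simp

lemma measurable_resample [measurable]:
  assumes [measurable]: "f \<in> borel_measurable borel"
  shows "resample u f \<in> borel_measurable borel"
proof -
  have "(\<lambda>x. \<integral>t. f (transversal u x + t *\<^sub>R u) \<partial>std.N) \<in> borel_measurable N"
    by (rule std.N.borel_measurable_lebesgue_integral) simp
  then show ?thesis unfolding resample_def[abs_def] by simp
qed

lemma measurable_line_mehler [measurable]:
  assumes [measurable]: "f \<in> borel_measurable borel"
  shows "line_mehler u c s f \<in> borel_measurable borel"
proof -
  have "(\<lambda>x. \<integral>t. f (transversal u x + (c *\<^sub>R (x \<bullet> L u) + s *\<^sub>R t) *\<^sub>R u) \<partial>std.N) \<in> borel_measurable N"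
    by (rule std.N.borel_measurable_lebesgue_integral) simp
  then show ?thesis unfolding line_mehler_def[abs_def] std.mehler_def by simp
qed

lemma integral_resample:
  assumes u: "u \<bullet> L u = 1" and f[measurable]: "f \<in> borel_measurable borel" and B: "\<And>x. \<bar>f x\<bar> \<le> B"
  shows "(\<integral>x. resample u f x \<partial>N) = (\<integral>x. f x \<partial>N)"
proof -
  interpret NS: pair_prob_space N std.N ..
  let ?R = "\<lambda>(x, t). transversal u x + t *\<^sub>R u"
  have R: "?R \<in> measurable (N \<Otimes>\<^sub>M std.N) borel" by measurable
  have "(\<integral>x. f x \<partial>N) = (\<integral>x. f x \<partial>distr (N \<Otimes>\<^sub>M std.N) borel ?R)"
    by (simp add: distr_resample[OF u])
  also have "\<dots> = (\<integral>z. f (?R z) \<partial>(N \<Otimes>\<^sub>M std.N))"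
    by (rule integral_distr[OF R f])
  also have "\<dots> = (\<integral>(x, t). f (transversal u x + t *\<^sub>R u) \<partial>(N \<Otimes>\<^sub>M std.N))"
    by (simp add: split_beta')
  also have "\<dots> = (\<integral>x. \<integral>t. f (transversal u x + t *\<^sub>R u) \<partial>std.N \<partial>N)"
    by (rule NS.integral_fst[symmetric], rule NS.P.integrable_const_bound[where B = B]) (use B in auto)
  finally show ?thesis by (simp add: resample_def)
qed

lemma transversal_line [simp]:
  assumes "u \<bullet> L u = 1" shows "transversal u (transversal u x + t *\<^sub>R u) = transversal u x"
    and "(transversal u x + t *\<^sub>R u) \<bullet> L u = t"
  using assms by (auto simp: transversal_def inner_simps algebra_simps)

lemma line_mehler_bounds:
  assumes [measurable]: "g \<in> borel_measurable borel" and ab: "\<And>x. a \<le> g x" "\<And>x. g x \<le> b"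
  shows "a \<le> line_mehler u c s g x" "line_mehler u c s g x \<le> b"
  unfolding line_mehler_def using ab by (auto intro!: std.mehler_bounds)

lemma abs_line_mehler_le:
  assumes [measurable]: "g \<in> borel_measurable borel" and ab: "\<And>x. \<bar>g x\<bar> \<le> K"
  shows "\<bar>line_mehler u c s g x\<bar> \<le> K"
proof -
  have "norm (line_mehler u c s g x) \<le> K"
    unfolding line_mehler_def using ab by (intro std.norm_mehler_le) auto
  then show ?thesis by simp
qed

lemma line_mehler_1_0 [simp]: "line_mehler u 1 0 g x = g x"
  by (simp add: line_mehler_def std.mehler_def transversal_def)

lemma line_mehler_0_1 [simp]: "line_mehler u 0 1 g x = resample u g x"
  by (simp add: line_mehler_def std.mehler_def resample_def)

lemma abs_resample_le:
  assumes "f \<in> borel_measurable borel" "\<And>x. \<bar>f x\<bar> \<le> B"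
  shows "\<bar>resample u f x\<bar> \<le> B"
  using abs_line_mehler_le[OF assms, of u 0 1 x] by simp

text \<open>
The component of \<open>y\<close> along \<open>u\<close> can be resampled before the average over \<open>y\<close> is taken, and resampling it
is a step of the flow along the line through the point with mixed transversal part.
\<close>

lemma mehler_eq_average_line_mehler:
  assumes u: "u \<bullet> L u = 1" and f[measurable]: "f \<in> borel_measurable borel" and B: "\<And>x. \<bar>f x\<bar> \<le> B"
  shows "mehler c s f x = (\<integral>y. line_mehler u c s f (c *\<^sub>R transversal u x + s *\<^sub>R transversal u y + (x \<bullet> L u) *\<^sub>R u) \<partial>N)"
proof -
  have "mehler c s f x = (\<integral>y. resample u (\<lambda>y. f (c *\<^sub>R x + s *\<^sub>R y)) y \<partial>N)"
    unfolding mehler_def by (rule integral_resample[OF u, symmetric, where B = B]) (use B in auto)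
  also have "\<dots> = (\<integral>y. line_mehler u c s f (c *\<^sub>R transversal u x + s *\<^sub>R transversal u y + (x \<bullet> L u) *\<^sub>R u) \<partial>N)"
  proof (rule Bochner_Integration.integral_cong[OF refl])
    fix y
    define z where "z = c *\<^sub>R transversal u x + s *\<^sub>R transversal u y + (x \<bullet> L u) *\<^sub>R u"
    have z1: "z \<bullet> L u = x \<bullet> L u" and z2: "transversal u z = c *\<^sub>R transversal u x + s *\<^sub>R transversal u y"
      using u by (auto simp: z_def transversal_def inner_simps algebra_simps)
    have "c *\<^sub>R x + s *\<^sub>R (transversal u y + t *\<^sub>R u) = transversal u z + (c *\<^sub>R (z \<bullet> L u) + s *\<^sub>R t) *\<^sub>R u" for t
      unfolding z1 z2 by (simp add: transversal_def algebra_simps)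
    then show "resample u (\<lambda>y. f (c *\<^sub>R x + s *\<^sub>R y)) y = line_mehler u c s f z"
      by (simp add: resample_def line_mehler_def std.mehler_def)
  qed
  finally show ?thesis .
qed

text \<open>
The point at which the line flow is evaluated in the preceding lemma is again distributed according
to the Gaussian measure: resampling the coordinate of \<open>x\<close> along \<open>u\<close> reveals it as a resampling of
\<open>c x + s y\<close>, which has the right law by rotation invariance.
\<close>

lemma integral_mixed_resample:
  fixes f :: "'a \<Rightarrow> real"
  assumes u: "u \<bullet> L u = 1" and f[measurable]: "f \<in> borel_measurable borel" and B: "\<And>x. \<bar>f x\<bar> \<le> B"
    and cs: "c\<^sup>2 + s\<^sup>2 = 1" "- 1 < c"
  shows "(\<integral>x. \<integral>y. f (c *\<^sub>R transversal u x + s *\<^sub>R transversal u y + (x \<bullet> L u) *\<^sub>R u) \<partial>N \<partial>N) = (\<integral>x. f x \<partial>N)"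
proof -
  interpret SN: pair_prob_space std.N N ..
  define h where "h x = (\<integral>y. f (c *\<^sub>R transversal u x + s *\<^sub>R transversal u y + (x \<bullet> L u) *\<^sub>R u) \<partial>N)" for x
  have h_meas: "h \<in> borel_measurable borel"
  proof -
    have "(\<lambda>(x, y). f (c *\<^sub>R transversal u x + s *\<^sub>R transversal u y + (x \<bullet> L u) *\<^sub>R u)) \<in> borel_measurable (N \<Otimes>\<^sub>M N)"
      by simp
    from N.borel_measurable_lebesgue_integral[OF this] have "h \<in> borel_measurable N"
      by (simp add: h_def[abs_def])
    then show ?thesis by simp
  qed
  have B0: "0 \<le> B" using B[of 0] by linarith
  have h_bd: "\<bar>h x\<bar> \<le> B" for x
  proof -
    have "\<bar>h x\<bar> \<le> (\<integral>y. \<bar>f (c *\<^sub>R transversal u x + s *\<^sub>R transversal u y + (x \<bullet> L u) *\<^sub>R u)\<bar> \<partial>N)"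
      unfolding h_def by (rule integral_abs_bound)
    also have "\<dots> \<le> B"
      by (rule N.integral_le_const, rule integrable_bounded_N[where B = B]) (use B in auto)
    finally show ?thesis .
  qed
  have "(\<integral>x. h x \<partial>N) = (\<integral>x. resample u h x \<partial>N)"
    by (rule integral_resample[OF u h_meas h_bd, symmetric])
  also have "\<dots> = (\<integral>x. mehler c s (resample u f) x \<partial>N)"
  proof (rule Bochner_Integration.integral_cong[OF refl])
    fix x
    have "resample u h x = (\<integral>t. \<integral>y. f (c *\<^sub>R transversal u x + s *\<^sub>R transversal u y + t *\<^sub>R u) \<partial>N \<partial>std.N)"
      by (simp add: resample_def h_def u)
    also have "\<dots> = (\<integral>y. \<integral>t. f (c *\<^sub>R transversal u x + s *\<^sub>R transversal u y + t *\<^sub>R u) \<partial>std.N \<partial>N)"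
      by (rule SN.Fubini_integral[symmetric], rule SN.P.integrable_const_bound[where B = B])
        (use B in \<open>auto simp: split_beta'\<close>)
    also have "\<dots> = mehler c s (resample u f) x"
    proof -
      have "transversal u (c *\<^sub>R x + s *\<^sub>R y) = c *\<^sub>R transversal u x + s *\<^sub>R transversal u y" for y
        by (simp add: transversal_def inner_simps algebra_simps)
      then show ?thesis by (simp add: mehler_def resample_def)
    qed
    finally show "resample u h x = mehler c s (resample u f) x" .
  qed
  also have "\<dots> = (\<integral>x. resample u f x \<partial>N)"
  proof (rule integral_mehler[OF cs, where B = B])
    show "norm (resample u f x) \<le> B" for x using abs_resample_le[OF f B] by simp
  qed measurable
  also have "\<dots> = (\<integral>x. f x \<partial>N)" by (rule integral_resample[OF u f B])
  finally show ?thesis by (simp add: h_def)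
qed

text \<open>
Both \<open>mehler c s h\<close> and \<open>mehler c s g\<close> are averages of the corresponding line flows over the same
points, so Jensen's inequality for \<open>a^2 / b\<close> applies pointwise; by the preceding lemma the averaged
points have the Gaussian law. For \<open>h\<close> the derivative of \<open>g\<close> along \<open>u\<close>, this says that smoothing in the
other directions can only decrease the Fisher information in direction \<open>u\<close>.
\<close>

lemma mehler_fisher_le_line_mehler_fisher:
  assumes u: "u \<bullet> L u = 1" and g[measurable]: "g \<in> borel_measurable borel" and h[measurable]: "h \<in> borel_measurable borel"
    and ab: "0 < a" "\<And>x. a \<le> g x" "\<And>x. g x \<le> b" and K: "\<And>x. \<bar>h x\<bar> \<le> K"
    and cs: "c\<^sup>2 + s\<^sup>2 = 1" "- 1 < c"
  shows "(\<integral>x. (mehler c s h x)\<^sup>2 / mehler c s g x \<partial>N) \<le> (\<integral>x. (line_mehler u c s h x)\<^sup>2 / line_mehler u c s g x \<partial>N)"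
proof -
  define T where "T x y = c *\<^sub>R transversal u x + s *\<^sub>R transversal u y + (x \<bullet> L u) *\<^sub>R u" for x y
  have T[measurable]: "(\<lambda>z. T (fst z) (snd z)) \<in> borel_measurable (borel \<Otimes>\<^sub>M borel)" unfolding T_def by measurable
  define r where "r x = (line_mehler u c s h x)\<^sup>2 / line_mehler u c s g x" for x
  have r[measurable]: "r \<in> borel_measurable borel" unfolding r_def[abs_def] by measurable
  have gb: "\<bar>g x\<bar> \<le> b" for x using ab(1) ab(2,3)[of x] by auto
  have P: "a \<le> line_mehler u c s g x" "line_mehler u c s g x \<le> b" for x
    by (rule line_mehler_bounds[OF g ab(2,3)])+
  have PK: "\<bar>line_mehler u c s h x\<bar> \<le> K" for x by (rule abs_line_mehler_le[OF h K])
  have div: "\<bar>v\<^sup>2 / w\<bar> \<le> K\<^sup>2 / a" if "\<bar>v\<bar> \<le> K" "a \<le> w" for v w :: real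
    unfolding abs_divide using that ab(1) by (intro frac_le) (auto simp: abs_le_square_iff[symmetric])
  have rb: "\<bar>r x\<bar> \<le> K\<^sup>2 / a" for x unfolding r_def by (intro div PK P)
  have Tx[measurable]: "T x \<in> borel_measurable borel" for x unfolding T_def by measurable
  have "(\<integral>x. (mehler c s h x)\<^sup>2 / mehler c s g x \<partial>N) \<le> (\<integral>x. \<integral>y. r (T x y) \<partial>N \<partial>N)"
  proof (rule integral_mono)
    show "integrable N (\<lambda>x. (mehler c s h x)\<^sup>2 / mehler c s g x)"
    proof (rule integrable_bounded_N[where B = "K\<^sup>2 / a"])
      show "norm ((mehler c s h x)\<^sup>2 / mehler c s g x) \<le> K\<^sup>2 / a" for x
        unfolding real_norm_def using norm_mehler_le[OF h, of K] K
        by (intro div mehler_bounds(1)[OF g ab(2,3)]) auto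
    qed measurable
    have "integrable (N \<Otimes>\<^sub>M N) (\<lambda>(x, y). r (T x y))"
      by (rule integrable_bounded_NN[where B = "K\<^sup>2 / a"]) (use rb in \<open>auto simp: split_beta'\<close>)
    from NN.integrable_fst[OF this] show "integrable N (\<lambda>x. \<integral>y. r (T x y) \<partial>N)" .
    fix x
    have "mehler c s h x = (\<integral>y. line_mehler u c s h (T x y) \<partial>N)"
      unfolding T_def by (rule mehler_eq_average_line_mehler[OF u h K])
    moreover have "mehler c s g x = (\<integral>y. line_mehler u c s g (T x y) \<partial>N)"
      unfolding T_def by (rule mehler_eq_average_line_mehler[OF u g gb])
    ultimately show "(mehler c s h x)\<^sup>2 / mehler c s g x \<le> (\<integral>y. r (T x y) \<partial>N)"
      unfolding r_def using P PK ab(1) by (simp only:) (rule N.jensen_square_div[where a = a and b = b and K = K], auto)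
  qed
  also have "\<dots> = (\<integral>x. r x \<partial>N)"
    unfolding T_def by (rule integral_mixed_resample[OF u r rb cs])
  finally show ?thesis by (simp add: r_def)
qed

text \<open>
Conditionally on the transversal part this is the dissipation identity on the real line; resampling
inserts the conditioning and a further differentiation under the integral sign averages it.
\<close>

lemma line_entropy_dissipation:
  assumes u: "u \<bullet> L u = 1"
    and g[measurable]: "g \<in> borel_measurable borel" and G[measurable]: "G \<in> borel_measurable borel"
    and ab: "0 < a" "\<And>x. a \<le> g x" "\<And>x. g x \<le> b"
    and der: "\<And>x. (g has_derivative (\<lambda>h. G x \<bullet> h)) (at x)" and K: "\<And>x. norm (G x) \<le> K"
    and cos: "- 1 < cos \<theta>"
  shows "((\<lambda>\<theta>. \<integral>x. line_mehler u (cos \<theta>) (sin \<theta>) g x * ln (line_mehler u (cos \<theta>) (sin \<theta>) g x) \<partial>N) has_real_derivative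
    - (sin \<theta> * cos \<theta> * (\<integral>x. (line_mehler u (cos \<theta>) (sin \<theta>) (\<lambda>x. G x \<bullet> u) x)\<^sup>2 / line_mehler u (cos \<theta>) (sin \<theta>) g x \<partial>N))) (at \<theta>)"
proof -
  define P where "P t x = line_mehler u (cos t) (sin t) g x" for t x
  define Q where "Q t x = line_mehler u (cos t) (sin t) (\<lambda>x. G x \<bullet> u) x" for t x
  have [measurable]: "P t \<in> borel_measurable borel" "Q t \<in> borel_measurable borel" for t
    unfolding P_def[abs_def] Q_def[abs_def] by measurable
  have Gu: "\<bar>G x \<bullet> u\<bar> \<le> K * norm u" for x
    using Cauchy_Schwarz_ineq2[of "G x" u] mult_right_mono[OF K[of x] norm_ge_zero[of u]] by linarith
  have P_bd: "a \<le> P t x" "P t x \<le> b" for t x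
    unfolding P_def by (rule line_mehler_bounds[OF g ab(2,3)])+
  have P_pos: "0 < P t x" for t x using P_bd(1)[of t x] ab(1) by linarith
  have Q_bd: "\<bar>Q t x\<bar> \<le> K * norm u" for t x
    unfolding Q_def by (rule abs_line_mehler_le) (use Gu in auto)
  define \<Lambda> where "\<Lambda> = \<bar>ln a\<bar> + \<bar>ln b\<bar>"
  have PlnP: "\<bar>P t x * ln (P t x)\<bar> \<le> b * \<Lambda>" for t x
  proof -
    have "ln a \<le> ln (P t x)" "ln (P t x) \<le> ln b" using P_bd[of t x] ab(1) by auto
    then have "\<bar>ln (P t x)\<bar> \<le> \<Lambda>" unfolding \<Lambda>_def by linarith
    then show ?thesis unfolding abs_mult
      using P_bd[of t x] P_pos[of t x] by (intro mult_mono) auto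
  qed
  define k where "k = (K * norm u)\<^sup>2 / a"
  have QP: "\<bar>(Q t x)\<^sup>2 / P t x\<bar> \<le> k" for t x
    unfolding abs_divide k_def using Q_bd[of t x] P_bd[of t x] P_pos[of t x] ab(1)
    by (intro frac_le) (auto simp: abs_le_square_iff[symmetric])
  have k0: "0 \<le> k" using ab(1) by (simp add: k_def)
  have eq1: "(\<integral>x. P t x * ln (P t x) \<partial>N) = (\<integral>x. resample u (\<lambda>x. P t x * ln (P t x)) x \<partial>N)" for t
    by (rule integral_resample[OF u, symmetric]) (use PlnP in auto)
  have eq2: "(\<integral>x. (Q t x)\<^sup>2 / P t x \<partial>N) = (\<integral>x. resample u (\<lambda>x. (Q t x)\<^sup>2 / P t x) x \<partial>N)" for t
    by (rule integral_resample[OF u, symmetric]) (use QP in auto)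
  have "open {t::real. - 1 < cos t}" by (intro open_Collect_less continuous_intros)
  then obtain e where e: "0 < e" "ball \<theta> e \<subseteq> {t. - 1 < cos t}" using cos by (auto elim: openE)
  have D: "((\<lambda>t. resample u (\<lambda>x. P t x * ln (P t x)) x) has_real_derivative
      - (sin t * cos t * resample u (\<lambda>x. (Q t x)\<^sup>2 / P t x) x)) (at t)" if "- 1 < cos t" for t x
  proof -
    have dl: "((\<lambda>r. g (transversal u x + r *\<^sub>R u)) has_derivative (\<lambda>h. (G (transversal u x + r *\<^sub>R u) \<bullet> u) \<bullet> h)) (at r)" for r :: real
    proof -
      have "((\<lambda>r. transversal u x + r *\<^sub>R u) has_derivative (\<lambda>h. h *\<^sub>R u)) (at r)"
        by (auto intro!: derivative_eq_intros)
      from has_derivative_compose[OF this der] show ?thesis by (simp add: mult.commute)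
    qed
    have PQ: "P t (transversal u x + r *\<^sub>R u) = std.mehler (cos t) (sin t) (\<lambda>r. g (transversal u x + r *\<^sub>R u)) r"
      "Q t (transversal u x + r *\<^sub>R u) = std.mehler (cos t) (sin t) (\<lambda>r. G (transversal u x + r *\<^sub>R u) \<bullet> u) r" for t r
      by (simp_all add: P_def Q_def line_mehler_def u)
    show ?thesis
      using std.entropy_dissipation[of "\<lambda>r. g (transversal u x + r *\<^sub>R u)" "\<lambda>r. G (transversal u x + r *\<^sub>R u) \<bullet> u" a b "K * norm u" t, OF _ _ ab(1) ab(2) ab(3) dl _ that] Gu
      by (simp add: resample_def PQ power2_eq_square)
  qed
  have "((\<lambda>t. \<integral>x. resample u (\<lambda>x. P t x * ln (P t x)) x \<partial>N) has_derivative
      (\<lambda>h. \<integral>x. h * - (sin \<theta> * cos \<theta> * resample u (\<lambda>x. (Q \<theta> x)\<^sup>2 / P \<theta> x) x) \<partial>N)) (at \<theta>)"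
  proof (rule has_derivative_integral_dominated[where e = e and H = "\<lambda>_. k"])
    fix t x assume t: "t \<in> ball \<theta> e"
    show "integrable N (resample u (\<lambda>x. P t x * ln (P t x)))"
      by (rule integrable_bounded_N[where B = "b * \<Lambda>"], measurable, simp only: real_norm_def, rule abs_resample_le) (use PlnP in auto)
    show "((\<lambda>t. resample u (\<lambda>x. P t x * ln (P t x)) x) has_derivative
        (\<lambda>h. h * - (sin t * cos t * resample u (\<lambda>x. (Q t x)\<^sup>2 / P t x) x))) (at t)"
    proof -
      have "- 1 < cos t" using e(2) t by auto
      from D[OF this, of x] show ?thesis
        unfolding has_field_derivative_def by (rule has_derivative_eq_rhs) (simp add: fun_eq_iff)
    qed
    fix h :: real
    have "\<bar>sin t\<bar> * (\<bar>cos t\<bar> * \<bar>resample u (\<lambda>x. (Q t x)\<^sup>2 / P t x) x\<bar>) \<le> 1 * (1 * k)"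
      by (intro mult_mono abs_resample_le QP) (auto intro!: mult_nonneg_nonneg k0)
    from mult_left_mono[OF this abs_ge_zero[of h]]
    show "\<bar>h * - (sin t * cos t * resample u (\<lambda>x. (Q t x)\<^sup>2 / P t x) x)\<bar> \<le> k * norm h"
      by (simp add: abs_mult mult_ac)
  qed (use e k0 in auto)
  then have "((\<lambda>t. \<integral>x. resample u (\<lambda>x. P t x * ln (P t x)) x \<partial>N) has_real_derivative
      - (sin \<theta> * cos \<theta> * (\<integral>x. resample u (\<lambda>x. (Q \<theta> x)\<^sup>2 / P \<theta> x) x \<partial>N))) (at \<theta>)"
    unfolding has_field_derivative_def by (rule has_derivative_eq_rhs) (simp add: fun_eq_iff)
  then show ?thesis
    unfolding eq1[symmetric] eq2[symmetric] by (simp only: P_def Q_def)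
qed

end

section \<open>Entropy of exponentials: Hoeffding and Herbst\<close>

context prob_space begin

text \<open>
Let \<open>\<nu>\<close> be the probability measure with density proportional to \<open>exp (l f)\<close>. After division by the
normalizing constant, the left-hand side is the relative entropy of \<open>\<nu>\<close>, which equals the logarithm of
the \<open>\<nu>\<close>-expectation of \<open>exp (- l * (f - m))\<close> with \<open>m\<close> the \<open>\<nu>\<close>-mean of \<open>f\<close>. Hoeffding's lemma for \<open>- f\<close> under
\<open>\<nu>\<close> bounds it with the optimal constant.
\<close>

lemma entropy_exp_le:
  fixes f :: "'a \<Rightarrow> real"
  assumes f[measurable]: "f \<in> borel_measurable M" and osc: "\<And>x y. f x - f y \<le> r" and l: "0 < l"
  shows "(\<integral>x. exp (l * f x) * (l * f x) \<partial>M) - (\<integral>x. exp (l * f x) \<partial>M) * ln (\<integral>x. exp (l * f x) \<partial>M)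
    \<le> l\<^sup>2 * r\<^sup>2 / 8 * (\<integral>x. exp (l * f x) \<partial>M)"
proof -
  define b where "b = (SUP x. f x)"
  have bdd: "bdd_above (range f)" using osc[of _ undefined] by (intro bdd_aboveI[of _ "f undefined + r"]) (auto simp: algebra_simps)
  have ub: "f x \<le> b" for x unfolding b_def by (rule cSUP_upper[OF _ bdd]) simp
  have lb: "b - r \<le> f x" for x
  proof -
    have "b \<le> f x + r" unfolding b_def by (rule cSUP_least) (use osc[of _ x] in \<open>auto simp: algebra_simps\<close>)
    then show ?thesis by simp
  qed
  define Z where "Z = (\<integral>x. exp (l * f x) \<partial>M)"
  have ig: "integrable M (\<lambda>x. exp (l * f x))"
    by (rule integrable_const_bound[where B = "exp (l * b)"]) (use ub l in auto)
  have "exp (l * (b - r)) \<le> Z" unfolding Z_def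
    by (rule integral_ge_const[OF ig]) (use lb l in auto)
  then have Z: "0 < Z" by (rule less_le_trans[OF exp_gt_zero])
  define \<nu> where "\<nu> = density M (\<lambda>x. ennreal (exp (l * f x) / Z))"
  have \<nu>: "prob_space \<nu>"
  proof
    have "emeasure \<nu> (space \<nu>) = (\<integral>\<^sup>+x. ennreal (exp (l * f x) / Z) \<partial>M)"
      by (simp add: \<nu>_def emeasure_density)
    also have "\<dots> = ennreal (\<integral>x. exp (l * f x) / Z \<partial>M)"
      by (rule nn_integral_eq_integral) (use ig Z in auto)
    also have "\<dots> = 1" using Z by (simp flip: Z_def)
    finally show "emeasure \<nu> (space \<nu>) = 1" .
  qed
  have nbd: "- b \<le> - f x" "- f x \<le> r - b" for x using ub[of x] lb[of x] by auto
  interpret \<nu>: interval_bounded_random_variable \<nu> "\<lambda>x. - f x" "- b" "r - b"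
  proof (intro interval_bounded_random_variable.intro \<nu> interval_bounded_random_variable_axioms.intro)
    show "(\<lambda>x. - f x) \<in> borel_measurable \<nu>" by (simp add: \<nu>_def)
  qed (use nbd in auto)
  define e where "e = (\<integral>x. - f x \<partial>\<nu>)"
  have e: "Z * e = - (\<integral>x. exp (l * f x) * f x \<partial>M)"
  proof -
    have "e = (\<integral>x. exp (l * f x) / Z * (- f x) \<partial>M)"
      unfolding e_def \<nu>_def using Z by (subst integral_density) auto
    also have "\<dots> = - (\<integral>x. exp (l * f x) * f x \<partial>M) / Z" by simp
    finally show ?thesis using Z by simp
  qed
  have "(\<integral>\<^sup>+x. ennreal (exp (l * (- f x - e))) \<partial>\<nu>) \<le> ennreal (exp (l\<^sup>2 * (r - b - - b)\<^sup>2 / 8))"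
    unfolding e_def by (rule \<nu>.Hoeffdings_lemma_nn_integral[OF l])
  also have "(\<integral>\<^sup>+x. ennreal (exp (l * (- f x - e))) \<partial>\<nu>) = (\<integral>\<^sup>+x. ennreal (exp (- l * e) / Z) \<partial>M)"
    unfolding \<nu>_def
  proof (subst nn_integral_density, simp, simp, rule nn_integral_cong)
    fix x
    have "exp (l * f x) / Z * exp (l * (- f x - e)) = exp (- l * e) / Z"
      by (simp flip: exp_add add: algebra_simps)
    then show "ennreal (exp (l * f x) / Z) * ennreal (exp (l * (- f x - e))) = ennreal (exp (- l * e) / Z)"
      using Z by (simp flip: ennreal_mult'')
  qed
  also have "\<dots> = ennreal (exp (- l * e) / Z)" by (simp add: emeasure_space_1)
  finally have "exp (- l * e) / Z \<le> exp (l\<^sup>2 * r\<^sup>2 / 8)" by simp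
  then have "ln (exp (- l * e) / Z) \<le> ln (exp (l\<^sup>2 * r\<^sup>2 / 8))" using Z by (subst ln_le_cancel_iff) auto
  then have "- l * e - ln Z \<le> l\<^sup>2 * r\<^sup>2 / 8" using Z by (simp add: ln_div)
  then have "Z * (- l * e - ln Z) \<le> Z * (l\<^sup>2 * r\<^sup>2 / 8)" using Z by (intro mult_left_mono) auto
  moreover have "Z * (- l * e - ln Z) = l * (\<integral>x. exp (l * f x) * f x \<partial>M) - Z * ln Z"
    using arg_cong[OF e, of "(*) l"] by (simp add: algebra_simps)
  moreover have "l * (\<integral>x. exp (l * f x) * f x \<partial>M) = (\<integral>x. exp (l * f x) * (l * f x) \<partial>M)"
    by (simp add: mult.left_commute)
  ultimately show ?thesis by (simp add: Z_def mult_ac)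
qed

text \<open>
With \<open>Z l\<close> the moment generating function, the hypothesis says that \<open>ln (Z l) / l - k l\<close> has
nonpositive derivative for \<open>l > 0\<close>, and its limit at \<open>0\<close> is the mean of \<open>f\<close>.
\<close>

lemma Herbst:
  fixes f :: "'a \<Rightarrow> real"
  assumes f[measurable]: "f \<in> borel_measurable M" and B: "\<And>x. \<bar>f x\<bar> \<le> B"
    and ent: "\<And>l. 0 < l \<Longrightarrow> (\<integral>x. exp (l * f x) * (l * f x) \<partial>M) - (\<integral>x. exp (l * f x) \<partial>M) * ln (\<integral>x. exp (l * f x) \<partial>M)
      \<le> l\<^sup>2 * k * (\<integral>x. exp (l * f x) \<partial>M)"
    and l: "0 < l"
  shows "(\<integral>x. exp (l * f x) \<partial>M) \<le> exp (l * (\<integral>x. f x \<partial>M) + l\<^sup>2 * k)"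
proof -
  define Z where "Z l = (\<integral>x. exp (l * f x) \<partial>M)" for l
  define Z' where "Z' l = (\<integral>x. exp (l * f x) * f x \<partial>M)" for l
  have B0: "0 \<le> B" using B abs_ge_zero order_trans by blast
  have lf: "\<bar>l * f x\<bar> \<le> \<bar>l\<bar> * B" for l x unfolding abs_mult by (intro mult_left_mono B) auto
  have lf': "- (\<bar>l\<bar> * B) \<le> l * f x" "l * f x \<le> \<bar>l\<bar> * B" for l x using lf[of l x] by auto
  have ig: "integrable M (\<lambda>x. exp (l * f x))" for l
    by (rule integrable_const_bound[where B = "exp (\<bar>l\<bar> * B)"]) (use lf' in auto)
  have Zpos: "0 < Z l" for l
  proof -
    have "exp (- (\<bar>l\<bar> * B)) \<le> Z l" unfolding Z_def by (rule integral_ge_const[OF ig]) (use lf' in auto)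
    then show ?thesis by (rule less_le_trans[OF exp_gt_zero])
  qed
  have dZ: "(Z has_real_derivative Z' l) (at l)" for l
  proof -
    have "((\<lambda>l. \<integral>x. exp (l * f x) \<partial>M) has_derivative (\<lambda>h. \<integral>x. exp (l * f x) * f x * h \<partial>M)) (at l)"
    proof (rule has_derivative_integral_dominated[where e = 1 and H = "\<lambda>_. exp ((\<bar>l\<bar> + 1) * B) * B"])
      fix p x assume p: "p \<in> ball l 1"
      show "integrable M (\<lambda>x. exp (p * f x))" by (rule ig)
      have "((\<lambda>p. exp (p * f x)) has_real_derivative exp (p * f x) * f x) (at p)"
        by (auto intro!: derivative_eq_intros)
      then show "((\<lambda>p. exp (p * f x)) has_derivative (\<lambda>h. exp (p * f x) * f x * h)) (at p)"
        by (simp add: has_field_derivative_def)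
      fix h :: real
      have "\<bar>p\<bar> * B \<le> (\<bar>l\<bar> + 1) * B" using p B0 by (intro mult_right_mono) (auto simp: dist_real_def)
      then have "exp (p * f x) \<le> exp ((\<bar>l\<bar> + 1) * B)" using lf'(2)[of p x] by simp
      then have "exp (p * f x) * \<bar>f x\<bar> * \<bar>h\<bar> \<le> exp ((\<bar>l\<bar> + 1) * B) * B * \<bar>h\<bar>"
        using B[of x] by (intro mult_mono mult_right_mono) auto
      then show "\<bar>exp (p * f x) * f x * h\<bar> \<le> exp ((\<bar>l\<bar> + 1) * B) * B * norm h" by (simp add: abs_mult)
    qed (use B0 in auto)
    then show ?thesis unfolding has_field_derivative_def Z_def[abs_def] Z'_def
      by (rule has_derivative_eq_rhs) (simp add: fun_eq_iff)
  qed
  define G where "G l = ln (Z l) / l - k * l" for l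
  have Z0: "Z 0 = 1" by (simp add: Z_def prob_space)
  have Z'0: "Z' 0 = (\<integral>x. f x \<partial>M)" by (simp add: Z'_def)
  have dln: "((\<lambda>l. ln (Z l)) has_real_derivative Z' l / Z l) (at l)" for l
    using DERIV_ln_divide[OF Zpos[of l]] dZ[of l] by (rule DERIV_chain2[THEN DERIV_cong]) simp
  have dec: "G l \<le> G e" if e: "0 < e" "e \<le> l" for e
  proof (rule DERIV_nonpos_imp_nonincreasing[OF e(2)])
    fix t assume "e \<le> t" "t \<le> l"
    then have t: "0 < t" using e by simp
    have "(G has_real_derivative ((Z' t / Z t) * t - ln (Z t) * 1) / (t * t) - k * 1) (at t)"
      unfolding G_def[abs_def] using t
      by (intro DERIV_diff DERIV_divide DERIV_cmult dln DERIV_ident) auto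
    moreover have "((Z' t / Z t) * t - ln (Z t) * 1) / (t * t) - k * 1 \<le> 0"
    proof -
      have "t * Z' t - Z t * ln (Z t) \<le> t\<^sup>2 * k * Z t"
        using ent[OF t] by (simp add: Z_def Z'_def mult.left_commute)
      then have "(Z' t / Z t) * t - ln (Z t) \<le> t * t * k"
        using Zpos[of t] by (simp add: field_simps power2_eq_square)
      then show ?thesis using t by (simp add: field_simps)
    qed
    ultimately show "\<exists>y. (G has_real_derivative y) (at t) \<and> y \<le> 0" by blast
  qed
  have "((\<lambda>h. (ln (Z (0 + h)) - ln (Z 0)) / h) \<longlongrightarrow> Z' 0 / Z 0) (at 0)"
    using dln[of 0] unfolding DERIV_def .
  then have "((\<lambda>h. ln (Z h) / h) \<longlongrightarrow> (\<integral>x. f x \<partial>M)) (at 0)" by (simp add: Z0 Z'0)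
  then have "((\<lambda>h. ln (Z h) / h) \<longlongrightarrow> (\<integral>x. f x \<partial>M)) (at_right 0)"
    by (rule filterlim_mono) (auto simp: at_le)
  then have "(G \<longlongrightarrow> (\<integral>x. f x \<partial>M) - k * 0) (at_right 0)"
    unfolding G_def[abs_def] by (intro tendsto_intros)
  moreover have "eventually (\<lambda>e. G l \<le> G e) (at_right 0)"
    using eventually_at_right_less[of 0] eventually_at_right_real[OF l]
    by eventually_elim (use dec in auto)
  ultimately have "G l \<le> (\<integral>x. f x \<partial>M) - k * 0"
    by (intro tendsto_lowerbound) auto
  then have "ln (Z l) \<le> l * (\<integral>x. f x \<partial>M) + l\<^sup>2 * k"
    using l by (simp add: G_def field_simps power2_eq_square)
  then have "Z l \<le> exp (l * (\<integral>x. f x \<partial>M) + l\<^sup>2 * k)"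
    using ln_ge_iff[of "Z l"] exp_le_cancel_iff exp_ln[OF Zpos[of l]] by metis
  then show ?thesis by (simp add: Z_def)
qed

end

context gaussian begin

section \<open>Approximate tensorization of entropy\<close>

text \<open>
The frame inequality compares the dissipation of the full flow with the sum of the Fisher informations
in the directions \<open>u i\<close>, and these are dominated by the dissipations of the line flows. At angle \<open>0\<close>
all flows leave \<open>g\<close> unchanged; at angle \<open>pi/2\<close> the full flow yields the mean of \<open>g\<close> and the line
flows yield the conditional expectations.
\<close>

theorem approximate_tensorization:
  fixes u :: "'i \<Rightarrow> 'a"
  assumes I: "finite I" and u: "\<And>i. i \<in> I \<Longrightarrow> u i \<bullet> L (u i) = 1"
    and frame: "\<And>v. v \<bullet> S v \<le> \<kappa> * (\<Sum>i\<in>I. (u i \<bullet> v)\<^sup>2)" and \<kappa>: "0 \<le> \<kappa>"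
    and g[measurable]: "g \<in> borel_measurable borel" and G[measurable]: "G \<in> borel_measurable borel"
    and ab: "0 < a" "\<And>x. a \<le> g x" "\<And>x. g x \<le> b"
    and der: "\<And>x. (g has_derivative (\<lambda>h. G x \<bullet> h)) (at x)" and K: "\<And>x. norm (G x) \<le> K"
  shows "(\<integral>x. g x * ln (g x) \<partial>N) - (\<integral>x. g x \<partial>N) * ln (\<integral>x. g x \<partial>N)
    \<le> \<kappa> * (\<Sum>i\<in>I. (\<integral>x. g x * ln (g x) \<partial>N) - (\<integral>x. resample (u i) g x * ln (resample (u i) g x) \<partial>N))"
proof -
  define \<Phi> where "\<Phi> t = (\<integral>x. mehler (cos t) (sin t) g x * ln (mehler (cos t) (sin t) g x) \<partial>N)" for t
  define \<Phi>i where "\<Phi>i i t = (\<integral>x. line_mehler (u i) (cos t) (sin t) g x * ln (line_mehler (u i) (cos t) (sin t) g x) \<partial>N)" for i t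
  define F where "F t = (\<integral>x. (mehler (cos t) (sin t) G x \<bullet> S (mehler (cos t) (sin t) G x)) / mehler (cos t) (sin t) g x \<partial>N)" for t
  define Fi where "Fi i t = (\<integral>x. (line_mehler (u i) (cos t) (sin t) (\<lambda>x. G x \<bullet> u i) x)\<^sup>2 / line_mehler (u i) (cos t) (sin t) g x \<partial>N)" for i t
  define A where "A t = \<Phi> t - \<kappa> * (\<Sum>i\<in>I. \<Phi>i i t)" for t
  have K0: "0 \<le> K" using K[of 0] norm_ge_zero order_trans by blast
  have FF: "F t \<le> \<kappa> * (\<Sum>i\<in>I. Fi i t)" if c: "- 1 < cos t" for t
  proof -
    define c s where "c = cos t" and "s = sin t"
    have cs: "c\<^sup>2 + s\<^sup>2 = 1" "- 1 < c" using c by (auto simp: c_def s_def)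
    have P: "a \<le> mehler c s g x" "0 < mehler c s g x" for x
      using mehler_bounds(1)[OF g ab(2,3), of c s x] ab(1) by auto
    have GG: "mehler c s (\<lambda>x. G x \<bullet> v) x = v \<bullet> mehler c s G x" for v x
    proof -
      have "integrable N (\<lambda>y. G (c *\<^sub>R x + s *\<^sub>R y))"
        by (rule integrable_bounded_N[where B = K]) (use K in auto)
      then show ?thesis by (simp add: mehler_def inner_commute)
    qed
    have Gu: "\<bar>G x \<bullet> v\<bar> \<le> K * norm v" for x v
      using Cauchy_Schwarz_ineq2[of "G x" v] mult_right_mono[OF K[of x] norm_ge_zero[of v]] by linarith
    have bd: "\<bar>w / mehler c s g x\<bar> \<le> k / a" if "\<bar>w\<bar> \<le> k" for w k x
      unfolding abs_divide using that ab(1) P[of x] by (intro frac_le) auto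
    have int_fisher: "integrable N (\<lambda>x. (mehler c s (\<lambda>x. G x \<bullet> u i) x)\<^sup>2 / mehler c s g x)" for i
    proof (rule integrable_bounded_N[where B = "(K * norm (u i))\<^sup>2 / a"])
      fix x
      have "\<bar>mehler c s (\<lambda>x. G x \<bullet> u i) x\<bar> \<le> K * norm (u i)"
        using norm_mehler_le[of "\<lambda>x. G x \<bullet> u i" "K * norm (u i)" c s x] Gu by auto
      then have "\<bar>(mehler c s (\<lambda>x. G x \<bullet> u i) x)\<^sup>2\<bar> \<le> (K * norm (u i))\<^sup>2"
        by (auto simp: abs_le_square_iff[symmetric])
      then show "norm ((mehler c s (\<lambda>x. G x \<bullet> u i) x)\<^sup>2 / mehler c s g x) \<le> (K * norm (u i))\<^sup>2 / a"
        by (simp only: real_norm_def bd)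
    qed measurable
    have "F t \<le> (\<integral>x. \<kappa> * (\<Sum>i\<in>I. (mehler c s (\<lambda>x. G x \<bullet> u i) x)\<^sup>2 / mehler c s g x) \<partial>N)"
      unfolding F_def c_def[symmetric] s_def[symmetric]
    proof (rule integral_mono)
      have "bounded_linear S" by (rule linear_conv_bounded_linear[THEN iffD1, OF linS])
      from bounded_linear.nonneg_bounded[OF this]
      obtain KS where KS: "KS \<ge> 0" "\<And>v. norm (S v) \<le> norm v * KS" by blast
      note measS[measurable]
      have m: "norm (mehler c s G x) \<le> K" for x by (rule norm_mehler_le[OF G K])
      have "\<bar>mehler c s G x \<bullet> S (mehler c s G x)\<bar> \<le> K * (K * KS)" for x
      proof -
        have "\<bar>mehler c s G x \<bullet> S (mehler c s G x)\<bar> \<le> norm (mehler c s G x) * norm (S (mehler c s G x))"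
          by (rule Cauchy_Schwarz_ineq2)
        also have "\<dots> \<le> K * (K * KS)"
          by (intro mult_mono m K0 norm_ge_zero order_trans[OF KS(2)] KS(1)) auto
        finally show ?thesis .
      qed
      then show "integrable N (\<lambda>x. (mehler c s G x \<bullet> S (mehler c s G x)) / mehler c s g x)"
        by (intro integrable_bounded_N[where B = "K * (K * KS) / a"]) (measurable, simp only: real_norm_def bd)
      show "integrable N (\<lambda>x. \<kappa> * (\<Sum>i\<in>I. (mehler c s (\<lambda>x. G x \<bullet> u i) x)\<^sup>2 / mehler c s g x))"
        using int_fisher by simp
      fix x
      show "(mehler c s G x \<bullet> S (mehler c s G x)) / mehler c s g x \<le> \<kappa> * (\<Sum>i\<in>I. (mehler c s (\<lambda>x. G x \<bullet> u i) x)\<^sup>2 / mehler c s g x)"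
        using divide_right_mono[OF frame[of "mehler c s G x"], of "mehler c s g x"] P(2)[of x]
        by (simp add: GG flip: sum_divide_distrib)
    qed
    also have "\<dots> = \<kappa> * (\<Sum>i\<in>I. (\<integral>x. (mehler c s (\<lambda>x. G x \<bullet> u i) x)\<^sup>2 / mehler c s g x \<partial>N))"
      using int_fisher by (simp add: Bochner_Integration.integral_sum)
    also have "\<dots> \<le> \<kappa> * (\<Sum>i\<in>I. Fi i t)"
      unfolding Fi_def c_def[symmetric] s_def[symmetric]
    proof (intro mult_left_mono[OF _ \<kappa>] sum_mono)
      fix i assume i: "i \<in> I"
      show "(\<integral>x. (mehler c s (\<lambda>x. G x \<bullet> u i) x)\<^sup>2 / mehler c s g x \<partial>N)
          \<le> (\<integral>x. (line_mehler (u i) c s (\<lambda>x. G x \<bullet> u i) x)\<^sup>2 / line_mehler (u i) c s g x \<partial>N)"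
        by (rule mehler_fisher_le_line_mehler_fisher[OF u[OF i] g _ ab _ cs, where K = "K * norm (u i)"])
          (use Gu in auto)
    qed
    finally show ?thesis .
  qed
  have "A 0 \<le> A (pi / 2)"
  proof (rule DERIV_nonneg_imp_nondecreasing[where f = A and a = 0 and b = "pi / 2"])
    fix t :: real assume t: "0 \<le> t" "t \<le> pi / 2"
    have c: "0 \<le> cos t" "0 \<le> sin t" using t by (auto intro!: cos_ge_zero sin_ge_zero)
    then have c1: "- 1 < cos t" by linarith
    have "(\<Phi> has_real_derivative - (sin t * cos t * F t)) (at t)"
      unfolding \<Phi>_def[abs_def] F_def by (rule entropy_dissipation[OF g G ab der K c1])
    moreover have "(\<Phi>i i has_real_derivative - (sin t * cos t * Fi i t)) (at t)" if "i \<in> I" for i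
      unfolding \<Phi>i_def[abs_def] Fi_def by (rule line_entropy_dissipation[OF u[OF that] g G ab der K c1])
    ultimately have "(A has_real_derivative - (sin t * cos t * F t) - \<kappa> * (\<Sum>i\<in>I. - (sin t * cos t * Fi i t))) (at t)"
      unfolding A_def[abs_def] by (intro DERIV_diff DERIV_cmult DERIV_sum) auto
    moreover have "- (sin t * cos t * F t) - \<kappa> * (\<Sum>i\<in>I. - (sin t * cos t * Fi i t)) =
        sin t * cos t * (\<kappa> * (\<Sum>i\<in>I. Fi i t) - F t)"
      by (simp add: sum_negf sum_distrib_left[symmetric] algebra_simps)
    ultimately show "\<exists>y. (A has_real_derivative y) (at t) \<and> 0 \<le> y"
      using FF[OF c1] c by (metis mult_nonneg_nonneg diff_ge_0_iff_ge)
  qed simp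
  then show ?thesis
    by (simp add: A_def \<Phi>_def \<Phi>i_def sum_subtractf algebra_simps)
qed

section \<open>From entropy to concentration\<close>

text \<open>
Apply the tensorization inequality to \<open>exp (l f)\<close>. On each line \<open>f\<close> ranges over an interval of length
\<open>c i\<close>, so Hoeffding's lemma bounds the conditional entropies, and averaging over the lines restores
the full expectation of \<open>exp (l f)\<close>.
\<close>

lemma entropy_smooth_bounded_differences:
  fixes u :: "'i \<Rightarrow> 'a" and c :: "'i \<Rightarrow> real"
  assumes I: "finite I" and u: "\<And>i. i \<in> I \<Longrightarrow> u i \<bullet> L (u i) = 1"
    and frame: "\<And>v. v \<bullet> S v \<le> \<kappa> * (\<Sum>i\<in>I. (u i \<bullet> v)\<^sup>2)" and \<kappa>: "0 \<le> \<kappa>"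
    and f[measurable]: "f \<in> borel_measurable borel" and G[measurable]: "G \<in> borel_measurable borel"
    and B: "\<And>x. \<bar>f x\<bar> \<le> B"
    and der: "\<And>x. (f has_derivative (\<lambda>h. G x \<bullet> h)) (at x)" and K: "\<And>x. norm (G x) \<le> K"
    and osc: "\<And>i x t. i \<in> I \<Longrightarrow> \<bar>f (x + t *\<^sub>R u i) - f x\<bar> \<le> c i"
    and l: "0 < l"
  shows "(\<integral>x. exp (l * f x) * (l * f x) \<partial>N) - (\<integral>x. exp (l * f x) \<partial>N) * ln (\<integral>x. exp (l * f x) \<partial>N)
    \<le> l\<^sup>2 * (\<kappa> * (\<Sum>i\<in>I. (c i)\<^sup>2) / 8) * (\<integral>x. exp (l * f x) \<partial>N)"
proof -
  define g where "g x = exp (l * f x)" for x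
  have [measurable]: "g \<in> borel_measurable borel" unfolding g_def[abs_def] by measurable
  have B0: "0 \<le> B" using B[of 0] by linarith
  have lf: "- (l * B) \<le> l * f x" "l * f x \<le> l * B" for x
    using mult_left_mono[of "- B" "f x" l] mult_left_mono[of "f x" B l] B[of x] l by (auto simp: abs_le_iff)
  have g_bd: "exp (- (l * B)) \<le> g x" "g x \<le> exp (l * B)" for x using lf[of x] by (auto simp: g_def)
  have g_pos: "0 < g x" for x by (simp add: g_def)
  have g_abs: "\<bar>g x\<bar> \<le> exp (l * B)" for x using g_bd(2)[of x] g_pos[of x] by simp
  have gln: "g x * ln (g x) = exp (l * f x) * (l * f x)" for x by (simp add: g_def)
  have gln_bound: "\<bar>g x * ln (g x)\<bar> \<le> exp (l * B) * (l * B)" for x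
    unfolding gln abs_mult using lf[of x] g_bd(2)[of x] l B0 B[of x]
    by (intro mult_mono) (auto simp: g_def abs_mult intro!: mult_left_mono)
  have g_der: "(g has_derivative (\<lambda>h. ((l * g x) *\<^sub>R G x) \<bullet> h)) (at x)" for x
    unfolding g_def[abs_def]
    using has_derivative_exp[OF has_derivative_mult_right[OF der[of x], of l]] by (simp add: mult_ac)
  have "norm ((l * g x) *\<^sub>R G x) \<le> (l * exp (l * B)) * K" for x
    unfolding norm_scaleR using l g_pos[of x] g_bd(2)[of x] K[of x] by (intro mult_mono) (auto simp: abs_mult)
  then have AT: "(\<integral>x. g x * ln (g x) \<partial>N) - (\<integral>x. g x \<partial>N) * ln (\<integral>x. g x \<partial>N)
    \<le> \<kappa> * (\<Sum>i\<in>I. (\<integral>x. g x * ln (g x) \<partial>N) - (\<integral>x. resample (u i) g x * ln (resample (u i) g x) \<partial>N))"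
    by (intro approximate_tensorization[OF I u frame \<kappa> _ _ exp_gt_zero g_bd g_der]) auto
  also have "\<dots> \<le> \<kappa> * (\<Sum>i\<in>I. l\<^sup>2 * (c i)\<^sup>2 / 8 * (\<integral>x. g x \<partial>N))"
  proof (intro mult_left_mono[OF _ \<kappa>] sum_mono)
    fix i assume i: "i \<in> I"
    let ?r = "resample (u i)"
    have r_bd: "exp (- (l * B)) \<le> ?r g x" "?r g x \<le> exp (l * B)" for x
      using line_mehler_bounds[of g "exp (- (l * B))" "exp (l * B)" "u i" 0 1 x] g_bd by auto
    have r_pos: "0 < ?r g x" for x using r_bd(1)[of x] exp_gt_zero less_le_trans by blast
    have rln: "\<bar>?r g x * ln (?r g x)\<bar> \<le> exp (l * B) * (l * B)" for x
    proof -
      have "ln (exp (- (l * B))) \<le> ln (?r g x)" "ln (?r g x) \<le> ln (exp (l * B))"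
        using r_bd[of x] r_pos[of x] by (simp_all only: ln_le_cancel_iff exp_gt_zero)
      then have "\<bar>ln (?r g x)\<bar> \<le> l * B" by (simp add: abs_le_iff)
      then show ?thesis unfolding abs_mult using r_bd(2)[of x] r_pos[of x] by (intro mult_mono) auto
    qed
    have i1: "integrable N (?r (\<lambda>x. g x * ln (g x)))"
      by (rule integrable_bounded_N[where B = "exp (l * B) * (l * B)"], measurable, simp only: real_norm_def, rule abs_resample_le)
        (use gln_bound in auto)
    have i2: "integrable N (\<lambda>x. ?r g x * ln (?r g x))"
      by (rule integrable_bounded_N[where B = "exp (l * B) * (l * B)"]) (use rln in auto)
    have i3: "integrable N (?r g)"
      by (rule integrable_bounded_N[where B = "exp (l * B)"], measurable, simp only: real_norm_def, rule abs_resample_le)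
        (use g_abs in auto)
    have "(\<integral>x. g x * ln (g x) \<partial>N) - (\<integral>x. ?r g x * ln (?r g x) \<partial>N) = (\<integral>x. ?r (\<lambda>x. g x * ln (g x)) x - ?r g x * ln (?r g x) \<partial>N)"
      using integral_resample[OF u[OF i], of "\<lambda>x. g x * ln (g x)" "exp (l * B) * (l * B)"] gln_bound i1 i2 by simp
    also have "\<dots> \<le> (\<integral>x. l\<^sup>2 * (c i)\<^sup>2 / 8 * ?r g x \<partial>N)"
    proof (rule integral_mono)
      fix x
      have "f (transversal (u i) x + s *\<^sub>R u i) - f (transversal (u i) x + t *\<^sub>R u i) \<le> c i" for s t
        using osc[OF i, of "transversal (u i) x + t *\<^sub>R u i" "s - t"] by (simp add: algebra_simps)
      then show "?r (\<lambda>x. g x * ln (g x)) x - ?r g x * ln (?r g x) \<le> l\<^sup>2 * (c i)\<^sup>2 / 8 * ?r g x"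
        unfolding resample_def gln unfolding g_def by (intro std.N.entropy_exp_le l) auto
    qed (use i1 i2 i3 in auto)
    also have "\<dots> = l\<^sup>2 * (c i)\<^sup>2 / 8 * (\<integral>x. g x \<partial>N)"
      using integral_resample[OF u[OF i], of g "exp (l * B)"] g_abs by simp
    finally show "(\<integral>x. g x * ln (g x) \<partial>N) - (\<integral>x. ?r g x * ln (?r g x) \<partial>N) \<le> l\<^sup>2 * (c i)\<^sup>2 / 8 * (\<integral>x. g x \<partial>N)" .
  qed
  also have "\<dots> = l\<^sup>2 * (\<kappa> * (\<Sum>i\<in>I. (c i)\<^sup>2) / 8) * (\<integral>x. g x \<partial>N)"
    by (simp add: sum_distrib_left sum_distrib_right sum_divide_distrib mult_ac)
  finally show ?thesis by (simp only: gln) (simp only: g_def)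
qed

text \<open>
Substituting \<open>c x + s y = s (y + (c / s) x)\<close> turns the dependence on \<open>x\<close> into a translation of the
function \<open>f (s y)\<close>. The gradient is bounded because it is an average of \<open>f\<close> against a linear function.
\<close>

lemma mehler_differentiable:
  assumes f[measurable]: "f \<in> borel_measurable borel" and B: "\<And>x. \<bar>f x\<bar> \<le> B" and s: "s \<noteq> 0"
  obtains G K where "G \<in> borel_measurable borel" "\<And>x. norm (G x) \<le> K"
    "\<And>x. (mehler c s f has_derivative (\<lambda>h. G x \<bullet> h)) (at x)"
proof -
  have B0: "0 \<le> B" using B[of 0] by linarith
  define D where "D x v = (\<integral>w. f (c *\<^sub>R x + s *\<^sub>R w) * (w \<bullet> L ((c / s) *\<^sub>R v)) \<partial>N)" for x v
  have der: "(mehler c s f has_derivative D x) (at x)" for x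
  proof -
    have e: "s *\<^sub>R (w + (c / s) *\<^sub>R x) = c *\<^sub>R x + s *\<^sub>R w" for x w :: 'a using s by (simp add: algebra_simps)
    have "((\<lambda>x. (c / s) *\<^sub>R x) has_derivative (\<lambda>v. (c / s) *\<^sub>R v)) (at x)" by (auto intro!: derivative_eq_intros)
    from has_derivative_compose[OF this has_derivative_translate_expectation[of "\<lambda>w. f (s *\<^sub>R w)" B]]
    show ?thesis using B by (simp add: e D_def[abs_def] mehler_def[abs_def])
  qed
  define G where "G x = (\<Sum>b\<in>Basis. D x b *\<^sub>R b)" for x
  have D_meas: "(\<lambda>x. D x v) \<in> borel_measurable borel" for v
  proof -
    have "(\<lambda>(x, w). f (c *\<^sub>R x + s *\<^sub>R w) * (w \<bullet> L ((c / s) *\<^sub>R v))) \<in> borel_measurable (N \<Otimes>\<^sub>M N)"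
      by simp
    from N.borel_measurable_lebesgue_integral[OF this] show ?thesis by (simp add: D_def)
  qed
  have D_bd: "\<bar>D x v\<bar> \<le> (\<integral>w. B * (norm w * norm (L ((c / s) *\<^sub>R v))) \<partial>N)" for x v
  proof -
    have "\<bar>D x v\<bar> \<le> (\<integral>w. \<bar>f (c *\<^sub>R x + s *\<^sub>R w) * (w \<bullet> L ((c / s) *\<^sub>R v))\<bar> \<partial>N)"
      unfolding D_def by (rule integral_abs_bound)
    also have "\<dots> \<le> (\<integral>w. B * (norm w * norm (L ((c / s) *\<^sub>R v))) \<partial>N)"
    proof (rule integral_mono')
      show "\<bar>f (c *\<^sub>R x + s *\<^sub>R w) * (w \<bullet> L ((c / s) *\<^sub>R v))\<bar> \<le> B * (norm w * norm (L ((c / s) *\<^sub>R v)))" for w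
        unfolding abs_mult using B B0 by (intro mult_mono Cauchy_Schwarz_ineq2) auto
    qed (use integrable_norm B0 in auto)
    finally show ?thesis .
  qed
  show thesis
  proof (rule that)
    show "G \<in> borel_measurable borel" unfolding G_def[abs_def] using D_meas by measurable
    show "norm (G x) \<le> (\<Sum>b\<in>Basis. \<integral>w. B * (norm w * norm (L ((c / s) *\<^sub>R b))) \<partial>N)" for x
      unfolding G_def by (rule order_trans[OF norm_sum]) (intro sum_mono, use D_bd in auto)
    fix x
    have lin: "linear (D x)" using der[of x] by (rule has_derivative_linear)
    have "D x h = G x \<bullet> h" for h
    proof -
      have "D x h = D x (\<Sum>b\<in>Basis. (h \<bullet> b) *\<^sub>R b)" by (simp add: euclidean_representation)
      also have "\<dots> = (\<Sum>b\<in>Basis. (h \<bullet> b) * D x b)" by (simp add: linear_sum[OF lin] linear_cmul[OF lin])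
      finally show ?thesis by (simp add: G_def inner_sum_left inner_commute[of h] mult.commute)
    qed
    then have "D x = (\<lambda>h. G x \<bullet> h)" by (simp add: fun_eq_iff)
    then show "(mehler c s f has_derivative (\<lambda>h. G x \<bullet> h)) (at x)" using der[of x] by simp
  qed
qed

text \<open>
Moving \<open>x\<close> along \<open>u i\<close> moves every point \<open>c x + s y\<close> along \<open>u i\<close>; since the hypothesis on \<open>f\<close> bounds
displacements of every length, the flow inherits it with the same constants.
\<close>

lemma mgf_mehler_bounded_differences:
  fixes u :: "'i \<Rightarrow> 'a" and d :: "'i \<Rightarrow> real"
  assumes I: "finite I" and u: "\<And>i. i \<in> I \<Longrightarrow> u i \<bullet> L (u i) = 1"
    and frame: "\<And>v. v \<bullet> S v \<le> \<kappa> * (\<Sum>i\<in>I. (u i \<bullet> v)\<^sup>2)" and \<kappa>: "0 \<le> \<kappa>"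
    and f[measurable]: "f \<in> borel_measurable borel" and B: "\<And>x. \<bar>f x\<bar> \<le> B"
    and osc: "\<And>i x t. i \<in> I \<Longrightarrow> \<bar>f (x + t *\<^sub>R u i) - f x\<bar> \<le> d i"
    and cs: "c\<^sup>2 + s\<^sup>2 = 1" "- 1 < c" "s \<noteq> 0"
    and l: "0 < l"
  shows "(\<integral>x. exp (l * mehler c s f x) \<partial>N) \<le> exp (l * (\<integral>x. f x \<partial>N) + l\<^sup>2 * (\<kappa> * (\<Sum>i\<in>I. (d i)\<^sup>2) / 8))"
proof -
  obtain G K where G: "G \<in> borel_measurable borel" "\<And>x. norm (G x) \<le> K"
    "\<And>x. (mehler c s f has_derivative (\<lambda>h. G x \<bullet> h)) (at x)"
    using mehler_differentiable[OF f B cs(3)] by blast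
  have B': "\<bar>mehler c s f x\<bar> \<le> B" for x using norm_mehler_le[OF f, of B c s x] B by simp
  have osc': "\<bar>mehler c s f (x + t *\<^sub>R u i) - mehler c s f x\<bar> \<le> d i" if i: "i \<in> I" for i x t
  proof -
    have int: "integrable N (\<lambda>y. f (c *\<^sub>R x + s *\<^sub>R y))" for x
      by (rule integrable_bounded_N[where B = B]) (use B in auto)
    have e: "c *\<^sub>R (x + t *\<^sub>R u i) + s *\<^sub>R y = (c *\<^sub>R x + s *\<^sub>R y) + (c * t) *\<^sub>R u i" for y
      by (simp add: algebra_simps)
    have "\<bar>mehler c s f (x + t *\<^sub>R u i) - mehler c s f x\<bar> =
        \<bar>\<integral>y. f (c *\<^sub>R (x + t *\<^sub>R u i) + s *\<^sub>R y) - f (c *\<^sub>R x + s *\<^sub>R y) \<partial>N\<bar>"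
      unfolding mehler_def using int by (subst Bochner_Integration.integral_diff) auto
    also have "\<dots> \<le> (\<integral>y. \<bar>f (c *\<^sub>R (x + t *\<^sub>R u i) + s *\<^sub>R y) - f (c *\<^sub>R x + s *\<^sub>R y)\<bar> \<partial>N)"
      by (rule integral_abs_bound)
    also have "\<dots> \<le> d i"
    proof (rule N.integral_le_const)
      show "integrable N (\<lambda>y. \<bar>f (c *\<^sub>R (x + t *\<^sub>R u i) + s *\<^sub>R y) - f (c *\<^sub>R x + s *\<^sub>R y)\<bar>)"
        by (intro integrable_abs Bochner_Integration.integrable_diff int)
      show "AE y in N. \<bar>f (c *\<^sub>R (x + t *\<^sub>R u i) + s *\<^sub>R y) - f (c *\<^sub>R x + s *\<^sub>R y)\<bar> \<le> d i"
        unfolding e by (intro AE_I2 osc i)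
    qed
    finally show ?thesis .
  qed
  have "(\<integral>x. exp (l * mehler c s f x) \<partial>N) \<le> exp (l * (\<integral>x. mehler c s f x \<partial>N) + l\<^sup>2 * (\<kappa> * (\<Sum>i\<in>I. (d i)\<^sup>2) / 8))"
  proof (rule N.Herbst[OF _ B' _ l])
    show "mehler c s f \<in> borel_measurable N" by simp
    fix l :: real assume "0 < l"
    then show "(\<integral>x. exp (l * mehler c s f x) * (l * mehler c s f x) \<partial>N)
        - (\<integral>x. exp (l * mehler c s f x) \<partial>N) * ln (\<integral>x. exp (l * mehler c s f x) \<partial>N)
      \<le> l\<^sup>2 * (\<kappa> * (\<Sum>i\<in>I. (d i)\<^sup>2) / 8) * (\<integral>x. exp (l * mehler c s f x) \<partial>N)"
      by (intro entropy_smooth_bounded_differences[OF I u frame \<kappa> _ G(1) B' G(3,2) osc']) auto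
  qed
  then show ?thesis using integral_mehler[OF cs(1,2) f, of B] B by simp
qed

text \<open>
A measurable function is almost everywhere the limit of continuous functions; truncation at level \<open>B\<close>
makes the convergence dominated.
\<close>

lemma L1_continuous_approximation:
  assumes f[measurable]: "f \<in> borel_measurable borel" and B: "\<And>x. \<bar>f x\<bar> \<le> B" and e: "0 < e"
  obtains h :: "'a \<Rightarrow> real" where "continuous_on UNIV h" "\<And>x. \<bar>h x\<bar> \<le> B" "(\<integral>x. \<bar>f x - h x\<bar> \<partial>N) < e"
proof -
  have B0: "0 \<le> B" using B[of 0] by linarith
  have "f \<in> borel_measurable lebesgue" using f by (simp add: measurable_completion)
  then have "f measurable_on UNIV" by (rule lebesgue_measurable_imp_measurable_on_real) simp
  then obtain Z g where Z: "negligible Z" and g: "\<And>n. continuous_on UNIV (g n)"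
    and lim: "\<And>x. x \<notin> Z \<Longrightarrow> (\<lambda>n. g n x) \<longlonglongrightarrow> f x"
    unfolding measurable_on_def by auto
  define h where "h n x = max (- B) (min B (g n x))" for n x
  have h: "continuous_on UNIV (h n)" for n unfolding h_def by (intro continuous_intros g)
  have hB: "\<bar>h n x\<bar> \<le> B" for n x using B0 by (auto simp: h_def)
  have [measurable]: "h n \<in> borel_measurable borel" for n by (rule borel_measurable_continuous_onI[OF h])
  have hlim: "(\<lambda>n. h n x) \<longlonglongrightarrow> f x" if "x \<notin> Z" for x
  proof -
    have "(\<lambda>n. h n x) \<longlonglongrightarrow> max (- B) (min B (f x))"
      unfolding h_def by (intro tendsto_max tendsto_min tendsto_const lim that)
    then show ?thesis using B[of x] by (simp add: abs_le_iff min_absorb2 max_absorb2)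
  qed
  have "AE x in lebesgue. x \<notin> Z"
    using Z by (intro AE_not_in) (simp add: negligible_iff_null_sets)
  then have "AE x in lborel. x \<notin> Z" by (simp only: AE_completion_iff)
  then have AE: "AE x in N. x \<notin> Z"
    unfolding N_def by (subst AE_density) auto
  have "(\<lambda>n. \<integral>x. \<bar>f x - h n x\<bar> \<partial>N) \<longlonglongrightarrow> (\<integral>x. 0 \<partial>N)"
  proof (rule integral_dominated_convergence[where w = "\<lambda>_. 2 * B"])
    show "AE x in N. (\<lambda>n. \<bar>f x - h n x\<bar>) \<longlonglongrightarrow> 0"
      using AE
    proof eventually_elim
      fix x assume "x \<notin> Z"
      from tendsto_rabs[OF tendsto_diff[OF tendsto_const[of "f x"] hlim[OF this]]]
      show "(\<lambda>n. \<bar>f x - h n x\<bar>) \<longlonglongrightarrow> 0" by simp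
    qed
    show "AE x in N. norm \<bar>f x - h n x\<bar> \<le> 2 * B" for n
    proof (rule AE_I2)
      fix x show "norm \<bar>f x - h n x\<bar> \<le> 2 * B" using B[of x] hB[of n x] by (simp add: abs_le_iff)
    qed
  qed auto
  then have "eventually (\<lambda>n. (\<integral>x. \<bar>f x - h n x\<bar> \<partial>N) < e) sequentially"
    using e by (intro order_tendstoD(2)[where y = 0]) auto
  then obtain n where "(\<integral>x. \<bar>f x - h n x\<bar> \<partial>N) < e" by (auto simp: eventually_sequentially)
  then show thesis using h hB that by blast
qed

text \<open>
For continuous bounded functions this is dominated convergence. The general case follows by
approximation, as the flow preserves the Gaussian measure and is therefore a contraction in \<open>L^1\<close>.
\<close>

lemma mehler_L1_continuous:
  fixes f :: "'a \<Rightarrow> real"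
  assumes f[measurable]: "f \<in> borel_measurable borel" and B: "\<And>x. \<bar>f x\<bar> \<le> B"
    and cs: "\<And>n. (c n)\<^sup>2 + (s n)\<^sup>2 = 1" "\<And>n. - 1 < c n" "c \<longlonglongrightarrow> 1" "s \<longlonglongrightarrow> 0"
  shows "(\<lambda>n. \<integral>x. \<bar>mehler (c n) (s n) f x - f x\<bar> \<partial>N) \<longlonglongrightarrow> 0"
proof (rule LIMSEQ_I)
  fix e :: real assume "0 < e"
  then have e3: "0 < e / 3" by simp
  obtain h :: "'a \<Rightarrow> real" where h: "continuous_on UNIV h" "\<And>x. \<bar>h x\<bar> \<le> B" "(\<integral>x. \<bar>f x - h x\<bar> \<partial>N) < e / 3"
    using L1_continuous_approximation[OF f B e3] by blast
  have [measurable]: "h \<in> borel_measurable borel" by (rule borel_measurable_continuous_onI[OF h(1)])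
  have fh: "\<bar>\<bar>f x - h x\<bar>\<bar> \<le> 2 * B" for x using B[of x] h(2)[of x] by (simp add: abs_le_iff)
  have hlim: "(\<lambda>n. mehler (c n) (s n) h x) \<longlonglongrightarrow> h x" for x
  proof -
    have "(\<lambda>n. \<integral>y. h (c n *\<^sub>R x + s n *\<^sub>R y) \<partial>N) \<longlonglongrightarrow> (\<integral>y. h x \<partial>N)"
    proof (rule integral_dominated_convergence[where w = "\<lambda>_. B"])
      show "AE y in N. (\<lambda>n. h (c n *\<^sub>R x + s n *\<^sub>R y)) \<longlonglongrightarrow> h x"
      proof (rule AE_I2)
        fix y
        have "(\<lambda>n. c n *\<^sub>R x + s n *\<^sub>R y) \<longlonglongrightarrow> 1 *\<^sub>R x + 0 *\<^sub>R y" by (intro tendsto_intros cs)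
        then have "(\<lambda>n. c n *\<^sub>R x + s n *\<^sub>R y) \<longlonglongrightarrow> x" by simp
        then show "(\<lambda>n. h (c n *\<^sub>R x + s n *\<^sub>R y)) \<longlonglongrightarrow> h x"
          using continuous_on_tendsto_compose[OF h(1)] by auto
      qed
    qed (use h(2) in auto)
    then show ?thesis by (simp add: mehler_def)
  qed
  have "(\<lambda>n. \<integral>x. \<bar>mehler (c n) (s n) h x - h x\<bar> \<partial>N) \<longlonglongrightarrow> (\<integral>x. 0 \<partial>N)"
  proof (rule integral_dominated_convergence[where w = "\<lambda>_. 2 * B"])
    show "AE x in N. (\<lambda>n. \<bar>mehler (c n) (s n) h x - h x\<bar>) \<longlonglongrightarrow> 0"
    proof (rule AE_I2)
      fix x
      from tendsto_rabs[OF tendsto_diff[OF hlim[of x] tendsto_const[of "h x"]]]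
      show "(\<lambda>n. \<bar>mehler (c n) (s n) h x - h x\<bar>) \<longlonglongrightarrow> 0" by simp
    qed
    show "AE x in N. norm \<bar>mehler (c n) (s n) h x - h x\<bar> \<le> 2 * B" for n
    proof (rule AE_I2)
      fix x show "norm \<bar>mehler (c n) (s n) h x - h x\<bar> \<le> 2 * B"
      proof -
        have "\<bar>mehler (c n) (s n) h x\<bar> \<le> B" using norm_mehler_le[of h B "c n" "s n" x] h(2) by simp
        then show ?thesis using h(2)[of x] unfolding real_norm_def by linarith
      qed
    qed
  qed auto
  then have "eventually (\<lambda>n. (\<integral>x. \<bar>mehler (c n) (s n) h x - h x\<bar> \<partial>N) < e / 3) sequentially"
    using e3 by (intro order_tendstoD(2)[where y = 0]) auto
  then obtain n0 where n0: "\<And>n. n \<ge> n0 \<Longrightarrow> (\<integral>x. \<bar>mehler (c n) (s n) h x - h x\<bar> \<partial>N) < e / 3"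
    by (auto simp: eventually_sequentially)
  show "\<exists>n0. \<forall>n\<ge>n0. norm ((\<integral>x. \<bar>mehler (c n) (s n) f x - f x\<bar> \<partial>N) - 0) < e"
  proof (intro exI allI impI)
    fix n assume n: "n0 \<le> n"
    let ?P = "mehler (c n) (s n)"
    have Pb: "\<bar>?P k x\<bar> \<le> b" if "k \<in> borel_measurable borel" "\<And>x. \<bar>k x\<bar> \<le> b" for k :: "'a \<Rightarrow> real" and b x
      using norm_mehler_le[OF that(1), of b "c n" "s n" x] that(2) by simp
    have iP: "integrable N (?P k)" if [measurable]: "k \<in> borel_measurable borel" and "\<And>x. \<bar>k x\<bar> \<le> b" for k :: "'a \<Rightarrow> real" and b
      by (rule integrable_bounded_N[where B = b]) (use Pb[OF that] in auto)
    have ik: "integrable N k" if "k \<in> borel_measurable borel" and "\<And>x. \<bar>k x\<bar> \<le> b" for k :: "'a \<Rightarrow> real" and b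
      by (rule integrable_bounded_N[where B = b]) (use that in auto)
    have hm: "h \<in> borel_measurable borel" and dm: "(\<lambda>x. \<bar>f x - h x\<bar>) \<in> borel_measurable borel"
      by measurable
    note iPf = iP[OF f B] and iPh = iP[OF hm h(2)] and iPd = iP[OF dm fh]
      and jf = ik[OF f B] and jh = ik[OF hm h(2)] and jd = ik[OF dm fh]
    have iPh': "integrable N (\<lambda>x. \<bar>?P h x - h x\<bar>)"
      by (rule integrable_abs, rule Bochner_Integration.integrable_diff[OF iPh jh])
    have "(\<integral>x. \<bar>?P f x - f x\<bar> \<partial>N) \<le> (\<integral>x. ?P (\<lambda>x. \<bar>f x - h x\<bar>) x + \<bar>?P h x - h x\<bar> + \<bar>f x - h x\<bar> \<partial>N)"
    proof (rule integral_mono)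
      fix x
      have i: "integrable N (\<lambda>y. k (c n *\<^sub>R x + s n *\<^sub>R y))" if [measurable]: "k \<in> borel_measurable borel" and "\<And>x. \<bar>k x\<bar> \<le> B" for k :: "'a \<Rightarrow> real"
        by (rule integrable_bounded_N[where B = B]) (use that in auto)
      have "?P f x - ?P h x = (\<integral>y. f (c n *\<^sub>R x + s n *\<^sub>R y) - h (c n *\<^sub>R x + s n *\<^sub>R y) \<partial>N)"
        unfolding mehler_def using i[OF f B] i[of h] h(2) by simp
      then have "\<bar>?P f x - ?P h x\<bar> \<le> ?P (\<lambda>x. \<bar>f x - h x\<bar>) x"
        unfolding mehler_def by (simp add: integral_abs_bound)
      then show "\<bar>?P f x - f x\<bar> \<le> ?P (\<lambda>x. \<bar>f x - h x\<bar>) x + \<bar>?P h x - h x\<bar> + \<bar>f x - h x\<bar>" by linarith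
      show "integrable N (\<lambda>x. \<bar>?P f x - f x\<bar>)"
        by (rule integrable_abs, rule Bochner_Integration.integrable_diff[OF iPf jf])
      show "integrable N (\<lambda>x. ?P (\<lambda>x. \<bar>f x - h x\<bar>) x + \<bar>?P h x - h x\<bar> + \<bar>f x - h x\<bar>)"
        by (intro Bochner_Integration.integrable_add iPd iPh' jd)
    qed
    also have "\<dots> = (\<integral>x. ?P (\<lambda>x. \<bar>f x - h x\<bar>) x \<partial>N) + (\<integral>x. \<bar>?P h x - h x\<bar> \<partial>N) + (\<integral>x. \<bar>f x - h x\<bar> \<partial>N)"
      by (simp only: Bochner_Integration.integral_add[OF Bochner_Integration.integrable_add[OF iPd iPh'] jd]
          Bochner_Integration.integral_add[OF iPd iPh'])
    also have "(\<integral>x. ?P (\<lambda>x. \<bar>f x - h x\<bar>) x \<partial>N) = (\<integral>x. \<bar>f x - h x\<bar> \<partial>N)"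
      by (rule integral_mehler[OF cs(1,2), where B = "2 * B"]) (use fh in auto)
    also have "(\<integral>x. \<bar>f x - h x\<bar> \<partial>N) + (\<integral>x. \<bar>?P h x - h x\<bar> \<partial>N) + (\<integral>x. \<bar>f x - h x\<bar> \<partial>N) < e"
      using h(3) n0[OF n] by linarith
    finally show "norm ((\<integral>x. \<bar>?P f x - f x\<bar> \<partial>N) - 0) < e" by simp
  qed
qed

text \<open>
This is the limit of \<open>mgf_mehler_bounded_differences\<close> as the angle tends to \<open>0\<close>: the exponential is Lipschitz on the
range of \<open>f\<close>, so the moment generating functions of the regularizations converge because these
converge in \<open>L^1\<close>.
\<close>

theorem mgf_bounded_differences:
  fixes u :: "'i \<Rightarrow> 'a" and d :: "'i \<Rightarrow> real"
  assumes I: "finite I" and u: "\<And>i. i \<in> I \<Longrightarrow> u i \<bullet> L (u i) = 1"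
    and frame: "\<And>v. v \<bullet> S v \<le> \<kappa> * (\<Sum>i\<in>I. (u i \<bullet> v)\<^sup>2)" and \<kappa>: "0 \<le> \<kappa>"
    and f[measurable]: "f \<in> borel_measurable borel" and B: "\<And>x. \<bar>f x\<bar> \<le> B"
    and osc: "\<And>i x t. i \<in> I \<Longrightarrow> \<bar>f (x + t *\<^sub>R u i) - f x\<bar> \<le> d i"
    and l: "0 < l"
  shows "(\<integral>x. exp (l * f x) \<partial>N) \<le> exp (l * (\<integral>x. f x \<partial>N) + l\<^sup>2 * (\<kappa> * (\<Sum>i\<in>I. (d i)\<^sup>2) / 8))" (is "_ \<le> ?R")
proof -
  \<comment> \<open>Angles tending to \<open>0\<close>, but positive, so that the flow regularizes.\<close>
  define \<tau> where "\<tau> n = 1 / (real n + 1)" for n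
  have \<tau>: "\<tau> \<longlonglongrightarrow> 0" unfolding \<tau>_def by real_asymp
  have \<tau>01: "0 < \<tau> n" "\<tau> n \<le> 1" for n by (auto simp: \<tau>_def)
  define c s where "c n = cos (\<tau> n)" and "s n = sin (\<tau> n)" for n
  have cs: "(c n)\<^sup>2 + (s n)\<^sup>2 = 1" for n by (simp add: c_def s_def)
  have s0: "0 < s n" for n unfolding s_def using \<tau>01[of n] pi_gt3 by (intro sin_gt_zero) auto
  have c0: "0 < c n" for n unfolding c_def using \<tau>01[of n] pi_gt3 by (intro cos_gt_zero_pi) auto
  have "c \<longlonglongrightarrow> cos 0" "s \<longlonglongrightarrow> sin 0" unfolding c_def s_def by (intro tendsto_intros \<tau>)+
  then have lim: "c \<longlonglongrightarrow> 1" "s \<longlonglongrightarrow> 0" by auto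
  have c1: "- 1 < c n" for n using c0[of n] by simp
  have L1: "(\<lambda>n. \<integral>x. \<bar>mehler (c n) (s n) f x - f x\<bar> \<partial>N) \<longlonglongrightarrow> 0"
    by (rule mehler_L1_continuous[OF f B cs c1 lim])
  define \<Lambda> where "\<Lambda> = l * exp (l * B)"
  have "(\<integral>x. exp (l * f x) \<partial>N) \<le> ?R + \<Lambda> * (\<integral>x. \<bar>mehler (c n) (s n) f x - f x\<bar> \<partial>N)" for n
  proof -
    let ?P = "mehler (c n) (s n) f"
    have PB: "\<bar>?P x\<bar> \<le> B" for x using norm_mehler_le[OF f, of B "c n" "s n" x] B by simp
    have exp_le: "exp (l * v) \<le> exp (l * B)" if "\<bar>v\<bar> \<le> B" for v using that l by auto
    have i1: "integrable N (\<lambda>x. exp (l * f x))" "integrable N (\<lambda>x. exp (l * ?P x))"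
      by (rule integrable_bounded_N[where B = "exp (l * B)"], measurable, use exp_le B PB in simp)+
    have i2: "integrable N (\<lambda>x. \<bar>?P x - f x\<bar>)"
    proof (rule integrable_bounded_N[where B = "2 * B"])
      show "norm \<bar>?P x - f x\<bar> \<le> 2 * B" for x using PB[of x] B[of x] by (simp add: abs_le_iff)
    qed measurable
    have "(\<integral>x. exp (l * f x) \<partial>N) \<le> (\<integral>x. exp (l * ?P x) + \<Lambda> * \<bar>?P x - f x\<bar> \<partial>N)"
    proof (rule integral_mono)
      fix x
      have "exp (l * f x) - exp (l * ?P x) \<le> exp (l * f x) * (l * f x - l * ?P x)"
      proof -
        have "exp (l * f x) * (1 + (l * ?P x - l * f x)) \<le> exp (l * f x) * exp (l * ?P x - l * f x)"
          by (intro mult_left_mono exp_ge_add_one_self) auto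
        also have "\<dots> = exp (l * ?P x)" by (simp flip: exp_add)
        finally show ?thesis by (simp add: algebra_simps)
      qed
      also have "\<dots> \<le> exp (l * f x) * (l * \<bar>?P x - f x\<bar>)"
        using l by (intro mult_left_mono) (auto simp flip: right_diff_distrib)
      also have "\<dots> \<le> exp (l * B) * (l * \<bar>?P x - f x\<bar>)"
        using l exp_le[OF B[of x]] by (intro mult_right_mono) auto
      finally show "exp (l * f x) \<le> exp (l * ?P x) + \<Lambda> * \<bar>?P x - f x\<bar>" by (simp add: \<Lambda>_def mult_ac)
    qed (use i1 i2 in auto)
    also have "\<dots> = (\<integral>x. exp (l * ?P x) \<partial>N) + \<Lambda> * (\<integral>x. \<bar>?P x - f x\<bar> \<partial>N)"
      using i1 i2 by simp
    also have "(\<integral>x. exp (l * ?P x) \<partial>N) \<le> ?R"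
      by (rule mgf_mehler_bounded_differences[OF I u frame \<kappa> f B osc cs c1 _ l]) (use s0[of n] in auto)
    finally show ?thesis by simp
  qed
  moreover have "(\<lambda>n. ?R + \<Lambda> * (\<integral>x. \<bar>mehler (c n) (s n) f x - f x\<bar> \<partial>N)) \<longlonglongrightarrow> ?R + \<Lambda> * 0"
    by (intro tendsto_intros L1)
  ultimately show ?thesis by (intro LIMSEQ_le_const[where X = "\<lambda>n. ?R + \<Lambda> * (\<integral>x. \<bar>mehler (c n) (s n) f x - f x\<bar> \<partial>N)"]) auto
qed


theorem concentration_bounded_differences:
  fixes u :: "'i \<Rightarrow> 'a" and d :: "'i \<Rightarrow> real"
  assumes I: "finite I" and u: "\<And>i. i \<in> I \<Longrightarrow> u i \<bullet> L (u i) = 1"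
    and frame: "\<And>v. v \<bullet> S v \<le> \<kappa> * (\<Sum>i\<in>I. (u i \<bullet> v)\<^sup>2)" and \<kappa>: "0 < \<kappa>"
    and f[measurable]: "f \<in> borel_measurable borel" and B: "\<And>x. \<bar>f x\<bar> \<le> B"
    and osc: "\<And>i x t. i \<in> I \<Longrightarrow> \<bar>f (x + t *\<^sub>R u i) - f x\<bar> \<le> d i"
    and V: "0 < (\<Sum>i\<in>I. (d i)\<^sup>2)" and t: "0 < t"
  shows "measure N {x. \<bar>f x - (\<integral>x. f x \<partial>N)\<bar> \<ge> t} \<le> 2 * exp (- (2 * t\<^sup>2) / (\<kappa> * (\<Sum>i\<in>I. (d i)\<^sup>2)))"
proof -
  define V where "V = \<kappa> * (\<Sum>i\<in>I. (d i)\<^sup>2)"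
  have V0: "0 < V" using V \<kappa> by (simp add: V_def)
  \<comment> \<open>The minimizer of \<open>l\<^sup>2 * V / 8 - l * t\<close>.\<close>
  define l where "l = 4 * t / V"
  have l: "0 < l" using t V0 by (simp add: l_def)
  have upper: "measure N {x. h x - (\<integral>x. h x \<partial>N) \<ge> t} \<le> exp (- (2 * t\<^sup>2) / V)"
    if h[measurable]: "h \<in> borel_measurable borel" and hB: "\<And>x. \<bar>h x\<bar> \<le> B"
      and hosc: "\<And>i x t. i \<in> I \<Longrightarrow> \<bar>h (x + t *\<^sub>R u i) - h x\<bar> \<le> d i" for h :: "'a \<Rightarrow> real"
  proof -
    define m where "m = (\<integral>x. h x \<partial>N)"
    have i: "integrable N (\<lambda>x. exp (l * h x))"
    proof (rule integrable_bounded_N[where B = "exp (l * B)"])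
      show "norm (exp (l * h x)) \<le> exp (l * B)" for x using hB[of x] l by (simp add: abs_le_iff)
    qed measurable
    have "{x. h x - m \<ge> t} = {x \<in> space N. exp (l * h x) \<ge> exp (l * (t + m))}"
      using l by (simp add: le_diff_eq)
    then have "measure N {x. h x - m \<ge> t} \<le> (\<integral>x. exp (l * h x) \<partial>N) / exp (l * (t + m))"
      using integral_Markov_inequality_measure[OF i, of UNIV "exp (l * (t + m))"] by simp
    also have "\<dots> \<le> exp (l * m + l\<^sup>2 * (V / 8)) / exp (l * (t + m))"
      unfolding V_def m_def
      by (intro divide_right_mono mgf_bounded_differences[OF I u frame less_imp_le[OF \<kappa>] h hB hosc l]) auto
    also have "\<dots> = exp (l\<^sup>2 * (V / 8) - l * t)"
      by (simp add: algebra_simps flip: exp_diff)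
    also have "l\<^sup>2 * (V / 8) - l * t = - (2 * t\<^sup>2) / V"
      using V0 by (simp add: l_def power2_eq_square field_simps)
    finally show ?thesis by (simp add: m_def)
  qed
  define m where "m = (\<integral>x. f x \<partial>N)"
  have "measure N {x. \<bar>f x - m\<bar> \<ge> t} \<le> measure N ({x. f x - m \<ge> t} \<union> {x. - f x - (- m) \<ge> t})"
    by (rule N.finite_measure_mono) (auto simp: abs_le_iff)
  also have "\<dots> \<le> measure N {x. f x - m \<ge> t} + measure N {x. - f x - (- m) \<ge> t}"
    by (rule measure_Un_le) measurable
  also have "measure N {x. f x - m \<ge> t} \<le> exp (- (2 * t\<^sup>2) / V)"
    unfolding m_def by (rule upper[OF f B osc])
  also have "measure N {x. - f x - (- m) \<ge> t} \<le> exp (- (2 * t\<^sup>2) / V)"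
    using upper[of "\<lambda>x. - f x"] B osc by (simp add: m_def abs_minus_commute)
  finally show ?thesis by (simp add: m_def V_def)
qed

end

section \<open>The constant as a Rayleigh quotient\<close>

text \<open>
Eigenvectors of a symmetric matrix for distinct eigenvalues are orthogonal, hence independent.
\<close>

lemma finite_eigenvalues:
  fixes A :: "real^'n^'n"
  assumes sym: "transpose A = A"
  shows "finite (eigenvalues A)"
proof -
  have symA: "(A *v x) \<bullet> y = x \<bullet> (A *v y)" for x y
    using dot_lmul_matrix[of x A y] transpose_matrix_vector[of A x] by (simp add: sym)
  have "\<forall>l\<in>eigenvalues A. \<exists>v. v \<noteq> 0 \<and> A *v v = l *\<^sub>R v" by (auto simp: eigenvalues_def)
  then obtain e where e: "\<And>l. l \<in> eigenvalues A \<Longrightarrow> e l \<noteq> 0" "\<And>l. l \<in> eigenvalues A \<Longrightarrow> A *v e l = l *\<^sub>R e l"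
    by metis
  have orth: "e l \<bullet> e k = 0" if "l \<in> eigenvalues A" "k \<in> eigenvalues A" "l \<noteq> k" for l k
    using symA[of "e l" "e k"] that by (simp add: e(2))
  have inj: "inj_on e (eigenvalues A)"
  proof (rule inj_onI, rule ccontr)
    fix l k assume "l \<in> eigenvalues A" "k \<in> eigenvalues A" "e l = e k" "l \<noteq> k"
    then show False using orth[of l k] e(1)[of k] by simp
  qed
  have "pairwise orthogonal (e ` eigenvalues A)"
    by (auto simp: pairwise_def orthogonal_def intro!: orth)
  then have "independent (e ` eigenvalues A)"
    by (rule pairwise_orthogonal_independent) (use e(1) in force)
  then have "finite (e ` eigenvalues A)" by (rule independent_imp_finite)
  then show ?thesis using inj by (rule finite_imageD)
qed

lemma continuous_on_quadratic_form: "continuous_on T (\<lambda>x. x \<bullet> ((A :: real^'n^'n) *v x))"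
  by (intro continuous_on_inner continuous_on_id linear_continuous_on linear_conv_bounded_linear[THEN iffD1] matrix_vector_mul_linear)

text \<open>
The quadratic form attains its maximum \<open>l\<close> on the unit sphere at some \<open>v\<close>. The form of \<open>l - A\<close> is then
nonnegative and vanishes at \<open>v\<close>, which forces \<open>w = l v - A v\<close> to be zero: otherwise the form would be
negative at \<open>v + t w\<close> for a small negative \<open>t\<close>. So \<open>l\<close> is an eigenvalue.
\<close>

lemma Rayleigh_le_lambda_max:
  fixes A :: "real^'n^'n"
  assumes sym: "transpose A = A"
  shows "x \<bullet> (A *v x) \<le> lambda_max A * (x \<bullet> x)"
proof -
  have symA: "(A *v x) \<bullet> y = x \<bullet> (A *v y)" for x y
    using dot_lmul_matrix[of x A y] transpose_matrix_vector[of A x] by (simp add: sym)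
  have "\<exists>v\<in>sphere 0 1. \<forall>y\<in>sphere 0 1. y \<bullet> (A *v y) \<le> v \<bullet> (A *v v)"
  proof (rule continuous_attains_sup)
    have "axis undefined 1 \<in> sphere (0::real^'n) 1" by (simp add: norm_eq_1 inner_axis_axis)
    then show "sphere (0::real^'n) 1 \<noteq> {}" by blast
  qed (auto intro: continuous_on_quadratic_form)
  then obtain v where v: "norm v = 1" and max: "\<And>y. norm y = 1 \<Longrightarrow> y \<bullet> (A *v y) \<le> v \<bullet> (A *v v)"
    by auto
  define l where "l = v \<bullet> (A *v v)"
  have le: "y \<bullet> (A *v y) \<le> l * (y \<bullet> y)" for y
  proof (cases "y = 0")
    case False
    have "(y /\<^sub>R norm y) \<bullet> (A *v (y /\<^sub>R norm y)) \<le> l"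
      unfolding l_def by (rule max) (use False in simp)
    then have "(y \<bullet> (A *v y)) / (norm y)\<^sup>2 \<le> l"
      by (simp add: matrix_vector_mult_scaleR power2_eq_square divide_inverse mult_ac)
    then show ?thesis using False by (simp add: divide_le_eq power2_norm_eq_inner)
  qed simp
  define w where "w = l *\<^sub>R v - A *v v"
  have vv: "v \<bullet> v = 1" using v by (simp add: norm_eq_1)
  have "w = 0"
  proof (rule ccontr)
    assume "w \<noteq> 0"
    then have p: "0 < w \<bullet> w" by simp
    define r where "r = l * (w \<bullet> w) - w \<bullet> (A *v w)"
    have r: "0 \<le> r" using le[of w] by (simp add: r_def)
    have quad: "0 \<le> 2 * t * (w \<bullet> w) + t * t * r" for t
    proof -
      have "A *v (v + t *\<^sub>R w) = A *v v + t *\<^sub>R (A *v w)"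
        by (simp add: matrix_vector_right_distrib matrix_vector_mult_scaleR)
      then have "(v + t *\<^sub>R w) \<bullet> (A *v (v + t *\<^sub>R w)) = l + 2 * t * (w \<bullet> (A *v v)) + t * t * (w \<bullet> (A *v w))"
        using symA[of v w] by (simp add: inner_simps l_def inner_commute[of "A *v v"] algebra_simps)
      moreover have "(v + t *\<^sub>R w) \<bullet> (v + t *\<^sub>R w) = 1 + 2 * t * (w \<bullet> v) + t * t * (w \<bullet> w)"
        by (simp add: inner_simps vv inner_commute[of v w] algebra_simps)
      ultimately have "0 \<le> l * (1 + 2 * t * (w \<bullet> v) + t * t * (w \<bullet> w)) - (l + 2 * t * (w \<bullet> (A *v v)) + t * t * (w \<bullet> (A *v w)))"
        using le[of "v + t *\<^sub>R w"] by simp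
      also have "\<dots> = 2 * t * (w \<bullet> (l *\<^sub>R v - A *v v)) + t * t * r"
        by (simp add: r_def inner_diff_right algebra_simps)
      finally show ?thesis by (simp add: w_def)
    qed
    \<comment> \<open>The minimizer would be \<open>- (w \<bullet> w) / r\<close>; adding \<open>1\<close> covers the case \<open>r = 0\<close>.\<close>
    define t where "t = - (w \<bullet> w) / (r + 1)"
    have tr: "t * (r + 1) = - (w \<bullet> w)" using r by (simp add: t_def)
    have t0: "t < 0" using p r by (simp add: t_def divide_neg_pos)
    have "2 * t * (w \<bullet> w) + t * t * r = t * (w \<bullet> w) - t * t"
    proof -
      have "t * t * r = t * (t * (r + 1)) - t * t" by (simp add: algebra_simps)
      then show ?thesis by (simp add: tr)
    qed
    also have "\<dots> < 0" using mult_neg_pos[OF t0 p] mult_neg_neg[OF t0 t0] by linarith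
    finally show False using quad[of t] by simp
  qed
  then have "A *v v = l *\<^sub>R v" "v \<noteq> 0" using vv by (auto simp: w_def)
  then have "l \<in> eigenvalues A" unfolding eigenvalues_def by blast
  then have "l \<le> lambda_max A"
    unfolding lambda_max_def by (rule Max_ge[OF finite_eigenvalues[OF sym]])
  then show ?thesis using le[of x] mult_right_mono[of l "lambda_max A" "x \<bullet> x"] by simp
qed

text \<open>
Replace the coordinates of \<open>x\<close> by those of \<open>y\<close> one at a time.
\<close>

lemma bounded_differences_oscillation:
  fixes f :: "real^'n \<Rightarrow> real"
  assumes "bounded_differences f c"
  shows "\<bar>f x - f y\<bar> \<le> (\<Sum>i\<in>UNIV. c $ i)"
proof -
  have step: "\<bar>f x - f (\<chi> j. if j = i then y else x $ j)\<bar> \<le> c $ i" for i y x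
    using assms by (simp add: bounded_differences_iff)
  have "\<bar>f x - f (\<chi> j. if j \<in> A then y $ j else x $ j)\<bar> \<le> (\<Sum>i\<in>A. c $ i)" if "finite A" for A
    using that
  proof induction
    case (insert i A)
    define z where "z = (\<chi> j. if j \<in> A then y $ j else x $ j)"
    have "(\<chi> j. if j \<in> insert i A then y $ j else x $ j) = (\<chi> j. if j = i then y $ i else z $ j)"
      by (auto simp: z_def vec_eq_iff)
    then show ?case using insert step[of z i "y $ i"] by (simp add: z_def[symmetric])
  qed simp
  from this[of UNIV] show ?thesis by simp
qed

lemma pos_definite_inverse:
  fixes A :: "real^'n^'n"
  assumes "pos_definite A"
  shows "A ** matrix_inv A = mat 1" and "pos_definite (matrix_inv A)"
proof -
  have sym: "transpose A = A" and pos: "\<And>x. x \<noteq> 0 \<Longrightarrow> 0 < x \<bullet> (A *v x)"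
    using assms by (auto simp: pos_definite_def)
  have "x = 0" if "A *v x = 0" for x using pos[of x] that by auto
  then obtain B where "B ** A = mat 1" using matrix_left_invertible_ker[of A] by auto
  then have "invertible A" by (auto simp: invertible_left_inverse)
  then have inv: "A ** matrix_inv A = mat 1 \<and> matrix_inv A ** A = mat 1"
    unfolding matrix_inv_def invertible_def by (rule someI_ex)
  then show 1: "A ** matrix_inv A = mat 1" by simp
  have AQ: "A *v (matrix_inv A *v x) = x" for x
    using inv by (simp add: matrix_vector_mul_assoc)
  have "transpose (matrix_inv A) = matrix_inv A"
  proof -
    have "transpose (matrix_inv A) ** A = mat 1"
      using arg_cong[OF 1, of transpose] by (simp add: matrix_transpose_mul sym transpose_mat)
    then have "transpose (matrix_inv A) ** A ** matrix_inv A = matrix_inv A" by simp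
    then show ?thesis using 1 by (simp add: matrix_mul_assoc[symmetric])
  qed
  moreover have "0 < x \<bullet> (matrix_inv A *v x)" if "x \<noteq> 0" for x
  proof -
    have "matrix_inv A *v x \<noteq> 0" using AQ[of x] that by auto
    from pos[OF this] show ?thesis by (simp add: AQ inner_commute)
  qed
  ultimately show "pos_definite (matrix_inv A)" by (simp add: pos_definite_def)
qed

lemma pos_definite_coercive:
  fixes A :: "real^'n^'n"
  assumes "pos_definite A"
  obtains m where "0 < m" "\<And>x. m * (x \<bullet> x) \<le> x \<bullet> (A *v x)"
proof -
  have "\<exists>v\<in>sphere 0 1. \<forall>y\<in>sphere 0 1. v \<bullet> (A *v v) \<le> y \<bullet> (A *v y)"
  proof (rule continuous_attains_inf)
    have "axis undefined 1 \<in> sphere (0::real^'n) 1" by (simp add: norm_eq_1 inner_axis_axis)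
    then show "sphere (0::real^'n) 1 \<noteq> {}" by blast
  qed (auto intro: continuous_on_quadratic_form)
  then obtain v where v: "norm v = 1" and min: "\<And>y. norm y = 1 \<Longrightarrow> v \<bullet> (A *v v) \<le> y \<bullet> (A *v y)"
    by auto
  show thesis
  proof (rule that)
    have "v \<noteq> 0" using v by auto
    then show "0 < v \<bullet> (A *v v)" using assms by (simp add: pos_definite_def)
    fix y :: "real^'n"
    show "v \<bullet> (A *v v) * (y \<bullet> y) \<le> y \<bullet> (A *v y)"
    proof (cases "y = 0")
      case False
      have "v \<bullet> (A *v v) \<le> (y /\<^sub>R norm y) \<bullet> (A *v (y /\<^sub>R norm y))"
        by (rule min) (use False in simp)
      then have "v \<bullet> (A *v v) \<le> (y \<bullet> (A *v y)) / (norm y)\<^sup>2"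
        by (simp add: matrix_vector_mult_scaleR power2_eq_square divide_inverse mult_ac)
      then show ?thesis using False by (simp add: le_divide_eq power2_norm_eq_inner)
    qed simp
  qed
qed

text \<open>
Substitute \<open>v = D^(1/2) w\<close> with \<open>D\<close> the diagonal part of the inverse of \<open>\<Sigma>\<close>: the left-hand side becomes
the quadratic form of \<open>D^(1/2) \<Sigma> D^(1/2)\<close> at \<open>w\<close>, and the sum on the right becomes \<open>w \<bullet> w\<close>.
\<close>

lemma kappa_star_frame:
  fixes \<Sigma> :: "real^'n^'n"
  assumes pd: "pos_definite \<Sigma>"
  shows "v \<bullet> (\<Sigma> *v v) \<le> kappa_star \<Sigma> * (\<Sum>i\<in>UNIV. (v $ i)\<^sup>2 / matrix_inv \<Sigma> $ i $ i)" and "0 < kappa_star \<Sigma>"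
    and "\<And>i. 0 < matrix_inv \<Sigma> $ i $ i"
proof -
  let ?Q = "matrix_inv \<Sigma>"
  have sym: "transpose \<Sigma> = \<Sigma>" and pos: "\<And>x. x \<noteq> 0 \<Longrightarrow> 0 < x \<bullet> (\<Sigma> *v x)"
    using pd by (auto simp: pos_definite_def)
  show Qp: "0 < ?Q $ i $ i" for i
  proof -
    have "0 < axis i 1 \<bullet> (?Q *v axis i 1)"
      using pos_definite_inverse(2)[OF pd] by (simp add: pos_definite_def axis_eq_0_iff)
    then show ?thesis
      by (simp add: inner_axis' matrix_vector_mul_component inner_axis)
  qed
  define R where "R = diagonal_sqrt (diagonal_part ?Q)"
  define B where "B = R ** \<Sigma> ** R"
  have kB: "kappa_star \<Sigma> = lambda_max B" by (simp add: kappa_star_def B_def R_def Let_def)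
  have R: "(R *v w) $ i = sqrt (?Q $ i $ i) * w $ i" for w i
  proof -
    have "(R *v w) $ i = (\<Sum>j\<in>UNIV. if j = i then sqrt (?Q $ i $ i) * w $ i else 0)"
      unfolding matrix_vector_mult_def R_def diagonal_sqrt_def diagonal_part_def vec_lambda_beta
      by (intro sum.cong) auto
    then show ?thesis by simp
  qed
  have Rt: "transpose R = R" by (auto simp: R_def diagonal_sqrt_def diagonal_part_def transpose_def vec_eq_iff)
  have Bsym: "transpose B = B"
    unfolding B_def by (simp only: matrix_transpose_mul Rt sym matrix_mul_assoc)
  have quad: "w \<bullet> (B *v w) = (R *v w) \<bullet> (\<Sigma> *v (R *v w))" for w
  proof -
    have "(R *v x) \<bullet> y = x \<bullet> (R *v y)" for x y
      using dot_lmul_matrix[of x R y] transpose_matrix_vector[of R x] by (simp add: Rt)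
    then show ?thesis by (simp add: B_def flip: matrix_vector_mul_assoc)
  qed
  define w where "w v = (\<chi> i. v $ i / sqrt (?Q $ i $ i))" for v :: "real^'n"
  have Rw: "R *v w v = v" for v
  proof -
    have "(R *v w v) $ i = v $ i" for i using Qp[of i] by (simp add: R w_def)
    then show ?thesis by (simp add: vec_eq_iff)
  qed
  have ww: "w v \<bullet> w v = (\<Sum>i\<in>UNIV. (v $ i)\<^sup>2 / ?Q $ i $ i)" for v
    unfolding inner_vec_def w_def using Qp
    by (intro sum.cong refl) (simp add: power2_eq_square less_imp_le)
  have main: "v \<bullet> (\<Sigma> *v v) \<le> kappa_star \<Sigma> * (w v \<bullet> w v)" for v
    using Rayleigh_le_lambda_max[OF Bsym, of "w v"] by (simp only: quad Rw kB)
  then show "v \<bullet> (\<Sigma> *v v) \<le> kappa_star \<Sigma> * (\<Sum>i\<in>UNIV. (v $ i)\<^sup>2 / ?Q $ i $ i)"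
    by (simp only: ww)
  define x :: "real^'n" where "x = axis undefined 1"
  have "x \<noteq> 0" by (simp add: x_def axis_eq_0_iff)
  then have "0 < kappa_star \<Sigma> * (w x \<bullet> w x)" using pos[of x] main[of x] by linarith
  then show "0 < kappa_star \<Sigma>"
    using mult_nonpos_nonneg[of "kappa_star \<Sigma>" "w x \<bullet> w x"] by (meson inner_ge_zero not_le)
qed

section \<open>Concentration for multivariate normal vectors\<close>

text \<open>
Translation by \<open>\<mu>\<close> reduces to the centred measure with precision matrix \<open>\<Sigma>^(-1)\<close>. The directions are the
unit vectors, normalized with respect to the precision matrix.
\<close>

theorem corollary3p14:
  fixes M :: "'a measure"
    and X :: "'a \<Rightarrow> real^'n"
    and \<mu> c :: "real^'n"
    and \<Sigma> :: "real^'n^'n"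
    and f :: "real^'n \<Rightarrow> real"
    and t :: real
  assumes "prob_space M"
    and "pos_definite \<Sigma>"
    and "distributed M lborel X (\<lambda>x. ennreal (mvnormal_density \<mu> \<Sigma> x))"
    and "f \<in> borel_measurable borel"
    and "\<And>i. c $ i \<ge> 0"
    and "bounded_differences f c"
    and "t > 0"
  shows "measure M {\<omega> \<in> space M. \<bar>f (X \<omega>) - integral\<^sup>L M (\<lambda>\<omega>. f (X \<omega>))\<bar> \<ge> t}
    \<le> (if c = 0 then 0 else 2 * exp (- (2 * t\<^sup>2) / (kappa_star \<Sigma> * (norm c)\<^sup>2)))"
proof -
  interpret M: prob_space M by fact
  note f[measurable] = assms(4)
  let ?Q = "matrix_inv \<Sigma>"
  have X[measurable]: "X \<in> borel_measurable M" using distributed_measurable[OF assms(3)] by simp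
  have dX: "distr M lborel X = density lborel (\<lambda>x. ennreal (mvnormal_density \<mu> \<Sigma> x))"
    using assms(3) by (simp add: distributed_def)
  have osc: "\<bar>f x - f y\<bar> \<le> (\<Sum>i\<in>UNIV. c $ i)" for x y
    by (rule bounded_differences_oscillation[OF assms(6)])
  show ?thesis
  proof (cases "c = 0")
    case True
    then have const: "f x = f 0" for x using osc[of x 0] by simp
    have "(\<integral>\<omega>. f (X \<omega>) \<partial>M) = (\<integral>\<omega>. f 0 \<partial>M)"
      by (intro Bochner_Integration.integral_cong refl const)
    then have "(\<integral>\<omega>. f (X \<omega>) \<partial>M) = f 0" by (simp add: M.prob_space)
    moreover have "f (X \<omega>) = f 0" for \<omega> by (rule const)
    ultimately have "\<bar>f (X \<omega>) - integral\<^sup>L M (\<lambda>\<omega>. f (X \<omega>))\<bar> = 0" for \<omega> by simp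
    then have "\<not> t \<le> \<bar>f (X \<omega>) - integral\<^sup>L M (\<lambda>\<omega>. f (X \<omega>))\<bar>" for \<omega>
      using assms(7) by (simp only: not_le)
    then have empty: "{\<omega> \<in> space M. \<bar>f (X \<omega>) - integral\<^sup>L M (\<lambda>\<omega>. f (X \<omega>))\<bar> \<ge> t} = {}"
      by blast
    show ?thesis unfolding empty using True by simp
  next
    case False
    define C where "C = 1 / sqrt ((2 * pi) ^ CARD('n) * det \<Sigma>)"
    define p where "p x = C * exp (- (x \<bullet> (?Q *v x)) / 2)" for x
    have mv: "mvnormal_density \<mu> \<Sigma> x = p (x - \<mu>)" for x
      by (simp add: mvnormal_density_def p_def C_def)
    have [measurable]: "p \<in> borel_measurable borel"
      unfolding p_def[abs_def]
      by (intro borel_measurable_continuous_onI continuous_intros linear_continuous_on linear_conv_bounded_linear[THEN iffD1] matrix_vector_mul_linear) auto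
    have total: "(\<integral>\<^sup>+x. ennreal (p x) \<partial>lborel) = 1"
    proof -
      have "prob_space (distr M lborel X)" by (rule M.prob_space_distr) simp
      then have "emeasure (density lborel (\<lambda>x. ennreal (p (x - \<mu>)))) UNIV = 1"
        using prob_space.emeasure_space_1 by (fastforce simp: dX mv)
      then have "(\<integral>\<^sup>+x. ennreal (p (x + - \<mu>)) \<partial>lborel) = 1" by (simp add: emeasure_density)
      then show ?thesis by (subst (asm) nn_integral_lborel_translate) auto
    qed
    \<comment> \<open>The normalization of the density, and in particular the positivity of the constant, follows
      from \<open>X\<close> having this density under a probability measure.\<close>
    have C: "0 < C"
    proof (rule ccontr)
      assume "\<not> 0 < C"
      then have "p x \<le> 0" for x by (simp add: p_def mult_nonpos_nonneg)
      then have "(\<integral>\<^sup>+x. ennreal (p x) \<partial>lborel) = (\<integral>\<^sup>+x. 0 \<partial>(lborel :: (real^'n) measure))"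
        by (intro nn_integral_cong) (simp add: ennreal_neg)
      with total show False by simp
    qed
    obtain m where m: "0 < m" "\<And>x. m * (x \<bullet> x) \<le> x \<bullet> (?Q *v x)"
      using pos_definite_coercive[OF pos_definite_inverse(2)[OF assms(2)]] by blast
    have Qsym: "transpose ?Q = ?Q" using pos_definite_inverse(2)[OF assms(2)] by (simp add: pos_definite_def)
    interpret gaussian "\<lambda>x. ?Q *v x" "\<lambda>x. \<Sigma> *v x" C m
    proof
      show "(?Q *v x) \<bullet> y = x \<bullet> (?Q *v y)" for x y
        using dot_lmul_matrix[of x ?Q y] transpose_matrix_vector[of ?Q x] by (simp add: Qsym)
      have QS: "?Q ** \<Sigma> = mat 1"
        using pos_definite_inverse(1)[OF assms(2)] by (simp add: matrix_left_right_inverse)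
      show "?Q *v (\<Sigma> *v v) = v" for v
        by (simp add: matrix_vector_mul_assoc QS)
      show "(\<integral>\<^sup>+x. ennreal (C * exp (- (x \<bullet> (?Q *v x)) / 2)) \<partial>lborel) = 1"
        using total by (simp add: p_def)
    qed (use C m in \<open>auto simp: matrix_vector_right_distrib matrix_vector_mult_scaleR\<close>)
    have qp: "q x = p x" for x by (simp add: q_def p_def)
    have law: "distr M lborel X = distr N lborel (\<lambda>x. x + \<mu>)"
    proof (rule measure_eqI)
      fix A assume "A \<in> sets (distr M lborel X)"
      then have [measurable]: "A \<in> sets borel" by simp
      have "emeasure (distr M lborel X) A = (\<integral>\<^sup>+x. ennreal (p (x - \<mu>)) * indicator A x \<partial>lborel)"
        by (simp add: dX mv emeasure_density)
      also have "\<dots> = (\<integral>\<^sup>+x. ennreal (q x) * indicator A (x + \<mu>) \<partial>lborel)"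
        using nn_integral_lborel_translate[of "\<lambda>x. ennreal (p (x - \<mu>)) * indicator A x" \<mu>] by (simp add: qp)
      also have "\<dots> = (\<integral>\<^sup>+x. indicator A (x + \<mu>) \<partial>N)"
        by (rule nn_integral_N[symmetric]) measurable
      also have "\<dots> = (\<integral>\<^sup>+x. indicator A x \<partial>distr N lborel (\<lambda>x. x + \<mu>))"
        by (rule nn_integral_distr[symmetric]) auto
      also have "\<dots> = emeasure (distr N lborel (\<lambda>x. x + \<mu>)) A" by simp
      finally show "emeasure (distr M lborel X) A = emeasure (distr N lborel (\<lambda>x. x + \<mu>)) A" .
    qed simp
    define h where "h x = f (x + \<mu>)" for x
    have [measurable]: "h \<in> borel_measurable borel" unfolding h_def[abs_def] by measurable
    have mean: "(\<integral>\<omega>. f (X \<omega>) \<partial>M) = (\<integral>x. h x \<partial>N)"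
    proof -
      have "(\<integral>\<omega>. f (X \<omega>) \<partial>M) = (\<integral>x. f x \<partial>distr M lborel X)" by (rule integral_distr[symmetric]) auto
      also have "\<dots> = (\<integral>x. h x \<partial>N)" unfolding law h_def by (rule integral_distr) auto
      finally show ?thesis .
    qed
    define E where "E = (\<integral>x. h x \<partial>N)"
    have prob: "measure M {\<omega> \<in> space M. \<bar>f (X \<omega>) - E\<bar> \<ge> t} = measure N {x. \<bar>h x - E\<bar> \<ge> t}"
    proof -
      have m: "{x. \<bar>f x - E\<bar> \<ge> t} \<in> sets lborel" by measurable
      have "measure M {\<omega> \<in> space M. \<bar>f (X \<omega>) - E\<bar> \<ge> t} = measure (distr M lborel X) {x. \<bar>f x - E\<bar> \<ge> t}"
        by (subst measure_distr[OF _ m]) (auto intro!: arg_cong[where f = "measure M"])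
      also have "\<dots> = measure N {x. \<bar>h x - E\<bar> \<ge> t}"
        unfolding law by (subst measure_distr[OF _ m]) (auto simp: h_def intro!: arg_cong[where f = "measure N"])
      finally show ?thesis .
    qed
    define u :: "'n \<Rightarrow> real^'n" where "u i = (1 / sqrt (?Q $ i $ i)) *\<^sub>R axis i 1" for i
    have Qp: "0 < ?Q $ i $ i" for i by (rule kappa_star_frame(3)[OF assms(2)])
    have cc: "(\<Sum>i\<in>UNIV. (c $ i)\<^sup>2) = (norm c)\<^sup>2"
      unfolding power2_norm_eq_inner by (simp add: inner_vec_def power2_eq_square)
    have "measure N {x. \<bar>h x - (\<integral>x. h x \<partial>N)\<bar> \<ge> t} \<le> 2 * exp (- (2 * t\<^sup>2) / (kappa_star \<Sigma> * (\<Sum>i\<in>UNIV. (c $ i)\<^sup>2)))"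
    proof (rule concentration_bounded_differences[where u = u and B = "\<bar>f 0\<bar> + (\<Sum>i\<in>UNIV. c $ i)"])
      fix i
      have "axis i 1 \<bullet> (?Q *v axis i 1) = ?Q $ i $ i"
        by (simp add: inner_axis' matrix_vector_mul_component inner_axis)
      then show "u i \<bullet> (?Q *v u i) = 1"
        using Qp[of i] by (simp add: u_def matrix_vector_mult_scaleR)
    next
      fix v :: "real^'n"
      have "(u i \<bullet> v)\<^sup>2 = (v $ i)\<^sup>2 / ?Q $ i $ i" for i
        using Qp[of i] by (simp add: u_def inner_axis' power_divide)
      then show "v \<bullet> (\<Sigma> *v v) \<le> kappa_star \<Sigma> * (\<Sum>i\<in>UNIV. (u i \<bullet> v)\<^sup>2)"
        using kappa_star_frame(1)[OF assms(2), of v] by simp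
    next
      show "\<bar>h x\<bar> \<le> \<bar>f 0\<bar> + (\<Sum>i\<in>UNIV. c $ i)" for x
        using osc[of "x + \<mu>" 0] by (simp add: h_def)
    next
      fix i x and r :: real
      define y where "y = x + \<mu>"
      have "x + r *\<^sub>R u i + \<mu> = (\<chi> j. if j = i then y $ i + r / sqrt (?Q $ i $ i) else y $ j)"
        by (auto simp: vec_eq_iff u_def y_def axis_def)
      moreover have "\<bar>f y - f (\<chi> j. if j = i then y $ i + r / sqrt (?Q $ i $ i) else y $ j)\<bar> \<le> c $ i"
        using assms(6) by (simp add: bounded_differences_iff)
      ultimately show "\<bar>h (x + r *\<^sub>R u i) - h x\<bar> \<le> c $ i"
        by (simp add: h_def y_def abs_minus_commute)
    qed (use kappa_star_frame(2)[OF assms(2)] False assms(7) in \<open>auto simp: cc\<close>)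
    then show ?thesis using False by (simp add: mean prob cc flip: E_def)
  qed
qed

end
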